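(* Let $\alpha,\beta,\beta_1',\beta_2'\ge 0$, and for $\alpha_1',\alpha_2'\ge 0$ let $\langle\cdot\rangle'$ be the quenched Gibbs average of the Viana-Bray model perturbed by two independent perturbations with parameters $\alpha_1',\beta_1'$ and $\alpha_2',\beta_2'$ (defined in the context). Then for almost all values (with respect to Lebesgue measure) of $(\alpha_1',\alpha_2')$, for all integers $r,s\ge 1$, $$\lim_{N\to\infty}\ \sum_{a=0}^{\min\{2r,2s\}}(-1)^{a+1}\frac{(2r+2s-a-1)!}{a!\,(2r-a)!\,(2s-a)!}\ \langle q^2_{2r}\,q^2_{2s}\rangle'_a=0 ,$$ where $\langle q^2_{2r}q^2_{2s}\rangle'_a$ denotes the average of the product of the squares of a $2r$-replica overlap and a $2s$-replica overlap having exactly $a$ replicas in common: $$\langle q^2_{2r}q^2_{2s}\rangle'_a=\mathbb{E}\,(\omega')^{\otimes(2r+2s-a)}\big(q^2_{1,\ldots,2r}\;q^2_{1,\ldots,a,2r+1,\ldots,2r+2s-a}\big).$$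
   Context: Spin configurations are $\sigma\in\Sigma=\{-1,1\}^N$. The Viana-Bray Hamiltonian is $H_N(\sigma)=-\sum_{\nu=1}^{P_{\alpha N}}J_\nu\sigma_{i_\nu}\sigma_{j_\nu}$, where $P_\zeta$ denotes a Poisson random variable of mean $\zeta$, the $J_\nu$ are i.i.d. with $J_\nu=\pm1$ with probability $1/2$ each, the $i_\nu,j_\nu$ are i.i.d. uniform on $\{1,\ldots,N\}$, and all these variables (the quenched variables) are independent. For $\delta=1,2$ let $\hat H_\delta(\sigma)=\sum_{\nu=1}^{P'_{\delta}}J'_{\delta,\nu}\sigma_{i'_{\delta,\nu}}\sigma_{j'_{\delta,\nu}}$, where $P'_\delta$ is Poisson of mean $\alpha'_\delta$, the $J'_{\delta,\nu}$ are i.i.d. uniform $\pm1$, the $i'_{\delta,\nu},j'_{\delta,\nu}$ are i.i.d. uniform on $\{1,\ldots,N\}$, all independent of each other and of the variables in $H_N$ (and independent for $\delta=1$ and $\delta=2$). The perturbed Gibbs measure $\omega'$ on $\Sigma$ assigns to $\sigma$ a weight proportional to $\exp(-\beta H_N(\sigma)-\beta_1'\hat H_1(\sigma)-\beta_2'\hat H_2(\sigma))$. $\mathbb{E}$ denotes expectation over all quenched variables; replicas $\sigma^{(1)},\sigma^{(2)},\ldots$ are independent samples from $\omega'$ with the same quenched variables, and $\langle\cdot\rangle'=\mathbb{E}(\omega')^{\otimes k}(\cdot)$ for the needed number $k$ of replicas. Overlaps: $q_{r_1\cdots r_n}=\frac1N\sum_{i=1}^N\sigma_i^{(r_1)}\cdots\sigma_i^{(r_n)}$.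 *)

theory Defs
  imports "HOL-Probability.Probability"
begin

section \<open>The quenched variables\<close>

text \<open>A realisation of the quenched variables of one Hamiltonian consists of the number of terms
  and the sequence of couplings and site pairs \<open>(J\<^sub>\<nu>, i\<^sub>\<nu>, j\<^sub>\<nu>)\<close>; terms are indexed from \<open>\<nu> = 0\<close>.\<close>

type_synonym bonds = "nat \<times> (nat \<Rightarrow> real \<times> nat \<times> nat)"

type_synonym config = "nat \<Rightarrow> real"

text \<open>The library's \<open>poisson_pmf\<close> is only specified for positive rates; mean 0 is the point
  mass at 0.\<close>

definition poisson_law :: "real \<Rightarrow> nat pmf" where
  "poisson_law \<zeta> = (if \<zeta> = 0 then return_pmf 0 else poisson_pmf \<zeta>)"

definition bond_law :: "nat \<Rightarrow> (real \<times> nat \<times> nat) pmf" where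
  "bond_law N = pair_pmf (pmf_of_set {-1, 1}) (pair_pmf (pmf_of_set {1..N}) (pmf_of_set {1..N}))"

definition bonds_law :: "nat \<Rightarrow> real \<Rightarrow> bonds measure" where
  "bonds_law N \<zeta> =
     measure_pmf (poisson_law \<zeta>) \<Otimes>\<^sub>M (\<Pi>\<^sub>M \<nu>\<in>UNIV. measure_pmf (bond_law N))"

text \<open>The components belong to the Viana-Bray Hamiltonian and to the first and second
  perturbation; \<open>\<alpha>\<^sub>1\<close>, \<open>\<alpha>\<^sub>2\<close> here and \<open>\<beta>\<^sub>1\<close>, \<open>\<beta>\<^sub>2\<close> below are the (primed) perturbation
  parameters. Only the mean of the first number of terms grows with \<open>N\<close>.\<close>

definition quenched_law :: "nat \<Rightarrow> real \<Rightarrow> real \<Rightarrow> real \<Rightarrow> (bonds \<times> bonds \<times> bonds) measure" where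
  "quenched_law N \<alpha> \<alpha>\<^sub>1 \<alpha>\<^sub>2 =
     bonds_law N (\<alpha> * real N) \<Otimes>\<^sub>M (bonds_law N \<alpha>\<^sub>1 \<Otimes>\<^sub>M bonds_law N \<alpha>\<^sub>2)"

section \<open>Hamiltonians and the perturbed Gibbs measure\<close>

definition configs :: "nat \<Rightarrow> config set" where
  "configs N = {1..N} \<rightarrow>\<^sub>E {-1, 1}"

definition bond_sum :: "bonds \<Rightarrow> config \<Rightarrow> real" where
  "bond_sum b \<sigma> = (\<Sum>\<nu><fst b. case snd b \<nu> of (J, i, j) \<Rightarrow> J * \<sigma> i * \<sigma> j)"

definition viana_bray_hamiltonian :: "bonds \<Rightarrow> config \<Rightarrow> real" where
  "viana_bray_hamiltonian b \<sigma> = - bond_sum b \<sigma>"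

text \<open>Unlike the Viana-Bray Hamiltonian, the perturbations carry no minus sign.\<close>

definition perturbation_hamiltonian :: "bonds \<Rightarrow> config \<Rightarrow> real" where
  "perturbation_hamiltonian b \<sigma> = bond_sum b \<sigma>"

definition boltzmann_weight ::
    "real \<Rightarrow> real \<Rightarrow> real \<Rightarrow> bonds \<times> bonds \<times> bonds \<Rightarrow> config \<Rightarrow> real" where
  "boltzmann_weight \<beta> \<beta>\<^sub>1 \<beta>\<^sub>2 = (\<lambda>(b, b\<^sub>1, b\<^sub>2) \<sigma>.
     exp (- \<beta> * viana_bray_hamiltonian b \<sigma>
          - \<beta>\<^sub>1 * perturbation_hamiltonian b\<^sub>1 \<sigma> - \<beta>\<^sub>2 * perturbation_hamiltonian b\<^sub>2 \<sigma>))"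

definition partition_function ::
    "nat \<Rightarrow> real \<Rightarrow> real \<Rightarrow> real \<Rightarrow> bonds \<times> bonds \<times> bonds \<Rightarrow> real" where
  "partition_function N \<beta> \<beta>\<^sub>1 \<beta>\<^sub>2 \<xi> = (\<Sum>\<sigma>\<in>configs N. boltzmann_weight \<beta> \<beta>\<^sub>1 \<beta>\<^sub>2 \<xi> \<sigma>)"

definition gibbs ::
    "nat \<Rightarrow> real \<Rightarrow> real \<Rightarrow> real \<Rightarrow> bonds \<times> bonds \<times> bonds \<Rightarrow> config pmf" where
  "gibbs N \<beta> \<beta>\<^sub>1 \<beta>\<^sub>2 \<xi> = embed_pmf (\<lambda>\<sigma>. if \<sigma> \<in> configs N
     then boltzmann_weight \<beta> \<beta>\<^sub>1 \<beta>\<^sub>2 \<xi> \<sigma> / partition_function N \<beta> \<beta>\<^sub>1 \<beta>\<^sub>2 \<xi> else 0)"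

section \<open>Replicas, quenched averages and overlaps\<close>

text \<open>Under \<open>replicas N \<beta> \<beta>\<^sub>1 \<beta>\<^sub>2 \<xi> k\<close> the configurations \<open>s 1, \<dots>, s k\<close> are independent
  samples of the Gibbs measure with the same quenched variables \<open>\<xi>\<close>.\<close>

definition replicas ::
    "nat \<Rightarrow> real \<Rightarrow> real \<Rightarrow> real \<Rightarrow> bonds \<times> bonds \<times> bonds \<Rightarrow> nat \<Rightarrow> (nat \<Rightarrow> config) pmf" where
  "replicas N \<beta> \<beta>\<^sub>1 \<beta>\<^sub>2 \<xi> k = Pi_pmf {1..k} undefined (\<lambda>_. gibbs N \<beta> \<beta>\<^sub>1 \<beta>\<^sub>2 \<xi>)"

definition quenched_average ::
    "nat \<Rightarrow> real \<Rightarrow> real \<Rightarrow> real \<Rightarrow> real \<Rightarrow> real \<Rightarrow> real \<Rightarrow> nat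
      \<Rightarrow> ((nat \<Rightarrow> config) \<Rightarrow> real) \<Rightarrow> real" where
  "quenched_average N \<alpha> \<beta> \<alpha>\<^sub>1 \<beta>\<^sub>1 \<alpha>\<^sub>2 \<beta>\<^sub>2 k F =
     (\<integral>\<xi>. measure_pmf.expectation (replicas N \<beta> \<beta>\<^sub>1 \<beta>\<^sub>2 \<xi> k) F \<partial>quenched_law N \<alpha> \<alpha>\<^sub>1 \<alpha>\<^sub>2)"

text \<open>Overlaps are only taken over distinct replicas, given here by the set of their indices.\<close>

definition overlap :: "nat \<Rightarrow> nat set \<Rightarrow> (nat \<Rightarrow> config) \<Rightarrow> real" where
  "overlap N R s = (1 / real N) * (\<Sum>i=1..N. \<Prod>l\<in>R. s l i)"

text \<open>\<open>overlap_sq_average \<dots> m n a\<close> is \<open>\<langle>q\<^sup>2\<^sub>m q\<^sup>2\<^sub>n\<rangle>'\<^sub>a\<close>, for \<open>a \<le> min m n\<close>.\<close>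

definition overlap_sq_average ::
    "nat \<Rightarrow> real \<Rightarrow> real \<Rightarrow> real \<Rightarrow> real \<Rightarrow> real \<Rightarrow> real \<Rightarrow> nat \<Rightarrow> nat \<Rightarrow> nat \<Rightarrow> real" where
  "overlap_sq_average N \<alpha> \<beta> \<alpha>\<^sub>1 \<beta>\<^sub>1 \<alpha>\<^sub>2 \<beta>\<^sub>2 m n a =
     quenched_average N \<alpha> \<beta> \<alpha>\<^sub>1 \<beta>\<^sub>1 \<alpha>\<^sub>2 \<beta>\<^sub>2 (m + n - a)
       (\<lambda>s. (overlap N {1..m} s)\<^sup>2 * (overlap N ({1..a} \<union> {m + 1..m + n - a}) s)\<^sup>2)"

section \<open>Well-definedness\<close>

lemma finite_configs [simp]: "finite (configs N)"
  by (simp add: configs_def finite_PiE)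

lemma configs_nonempty: "configs N \<noteq> {}"
  by (simp add: configs_def PiE_eq_empty_iff)

lemma boltzmann_weight_pos: "boltzmann_weight \<beta> \<beta>\<^sub>1 \<beta>\<^sub>2 \<xi> \<sigma> > 0"
  by (simp add: boltzmann_weight_def split: prod.split)

lemma partition_function_pos: "partition_function N \<beta> \<beta>\<^sub>1 \<beta>\<^sub>2 \<xi> > 0"
  unfolding partition_function_def
  by (intro sum_pos boltzmann_weight_pos finite_configs configs_nonempty)

lemma pmf_gibbs:
  "pmf (gibbs N \<beta> \<beta>\<^sub>1 \<beta>\<^sub>2 \<xi>) \<sigma> = (if \<sigma> \<in> configs N
     then boltzmann_weight \<beta> \<beta>\<^sub>1 \<beta>\<^sub>2 \<xi> \<sigma> / partition_function N \<beta> \<beta>\<^sub>1 \<beta>\<^sub>2 \<xi> else 0)"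
  unfolding gibbs_def
proof (rule pmf_embed_pmf)
  let ?w = "boltzmann_weight \<beta> \<beta>\<^sub>1 \<beta>\<^sub>2 \<xi>" and ?Z = "partition_function N \<beta> \<beta>\<^sub>1 \<beta>\<^sub>2 \<xi>"
  let ?f = "\<lambda>\<sigma>. if \<sigma> \<in> configs N then ?w \<sigma> / ?Z else 0"
  show nonneg: "0 \<le> ?f \<sigma>" for \<sigma>
    using boltzmann_weight_pos[of \<beta> \<beta>\<^sub>1 \<beta>\<^sub>2 \<xi> \<sigma>] partition_function_pos[of N \<beta> \<beta>\<^sub>1 \<beta>\<^sub>2 \<xi>] by simp
  have "(\<integral>\<^sup>+\<sigma>. ennreal (?f \<sigma>) \<partial>count_space UNIV) = (\<Sum>\<sigma>\<in>configs N. ennreal (?f \<sigma>))"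
    by (rule nn_integral_count_space'[OF finite_configs]) (auto split: if_splits)
  also have "\<dots> = ennreal (\<Sum>\<sigma>\<in>configs N. ?f \<sigma>)"
    by (rule sum_ennreal[OF nonneg])
  also have "(\<Sum>\<sigma>\<in>configs N. ?f \<sigma>) = (\<Sum>\<sigma>\<in>configs N. ?w \<sigma>) / ?Z"
    by (simp add: sum_divide_distrib)
  also have "\<dots> = 1"
    using partition_function_pos[of N \<beta> \<beta>\<^sub>1 \<beta>\<^sub>2 \<xi>] by (simp add: partition_function_def)
  finally show "(\<integral>\<^sup>+\<sigma>. ennreal (?f \<sigma>) \<partial>count_space UNIV) = 1" by simp
qed

lemma set_pmf_gibbs: "set_pmf (gibbs N \<beta> \<beta>\<^sub>1 \<beta>\<^sub>2 \<xi>) = configs N"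
  using boltzmann_weight_pos[of \<beta> \<beta>\<^sub>1 \<beta>\<^sub>2 \<xi>] partition_function_pos[of N \<beta> \<beta>\<^sub>1 \<beta>\<^sub>2 \<xi>]
  by (auto simp: set_pmf_eq pmf_gibbs less_imp_neq[symmetric])

lemma prob_space_bonds_law: "prob_space (bonds_law N \<zeta>)"
  unfolding bonds_law_def
  by (intro prob_space_pair prob_space_PiM measure_pmf.prob_space_axioms)

lemma prob_space_quenched_law: "prob_space (quenched_law N \<alpha> \<alpha>\<^sub>1 \<alpha>\<^sub>2)"
  unfolding quenched_law_def by (intro prob_space_pair prob_space_bonds_law)

lemma bond_sum_measurable: "(\<lambda>b. bond_sum b \<sigma>) \<in> borel_measurable (bonds_law N \<zeta>)"
proof -
  have count: "fst \<in> bonds_law N \<zeta> \<rightarrow>\<^sub>M count_space UNIV"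
    unfolding bonds_law_def by measurable
  have bond: "(\<lambda>b. case snd b \<nu> of (J, i, j) \<Rightarrow> J * \<sigma> i * \<sigma> j) \<in> borel_measurable (bonds_law N \<zeta>)"
    for \<nu>
  proof -
    have "(\<lambda>b. snd b \<nu>) \<in> bonds_law N \<zeta> \<rightarrow>\<^sub>M measure_pmf (bond_law N)"
      unfolding bonds_law_def by measurable
    then show ?thesis
      by (rule measurable_compose) simp
  qed
  show ?thesis
    unfolding bond_sum_def
    by (rule measurable_compose_countable[OF _ count]) (intro borel_measurable_sum bond)
qed

lemma boltzmann_weight_measurable:
  "(\<lambda>\<xi>. boltzmann_weight \<beta> \<beta>\<^sub>1 \<beta>\<^sub>2 \<xi> \<sigma>) \<in> borel_measurable (quenched_law N \<alpha> \<alpha>\<^sub>1 \<alpha>\<^sub>2)"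
proof -
  note [measurable] = bond_sum_measurable
  show ?thesis
    unfolding boltzmann_weight_def viana_bray_hamiltonian_def perturbation_hamiltonian_def
      quenched_law_def case_prod_beta
    by measurable
qed

text \<open>The expectation over the quenched variables in \<open>quenched_average\<close> is never the default
  value of a non-integrable function.\<close>

lemma integrable_quenched_average:
  fixes F :: "(nat \<Rightarrow> config) \<Rightarrow> real"
  shows "integrable (quenched_law N \<alpha> \<alpha>\<^sub>1 \<alpha>\<^sub>2)
     (\<lambda>\<xi>. measure_pmf.expectation (replicas N \<beta> \<beta>\<^sub>1 \<beta>\<^sub>2 \<xi> k) F)"
proof -
  interpret prob_space "quenched_law N \<alpha> \<alpha>\<^sub>1 \<alpha>\<^sub>2" by (rule prob_space_quenched_law)
  define A where "A = PiE_dflt {1..k} undefined (\<lambda>_. configs N)"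
  have A: "finite A"
    unfolding A_def by (intro finite_PiE_dflt) auto
  have sup: "set_pmf (replicas N \<beta> \<beta>\<^sub>1 \<beta>\<^sub>2 \<xi> k) = A" for \<xi>
    by (simp add: replicas_def A_def set_Pi_pmf set_pmf_gibbs comp_def)
  have eq: "measure_pmf.expectation (replicas N \<beta> \<beta>\<^sub>1 \<beta>\<^sub>2 \<xi> k) F =
      (\<Sum>s\<in>A. F s * pmf (replicas N \<beta> \<beta>\<^sub>1 \<beta>\<^sub>2 \<xi> k) s)" for \<xi>
    by (rule integral_measure_pmf_real[OF A]) (simp add: sup)
  have meas: "(\<lambda>\<xi>. pmf (replicas N \<beta> \<beta>\<^sub>1 \<beta>\<^sub>2 \<xi> k) s)
      \<in> borel_measurable (quenched_law N \<alpha> \<alpha>\<^sub>1 \<alpha>\<^sub>2)" for s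
  proof -
    note [measurable] = boltzmann_weight_measurable
    have [measurable]: "(\<lambda>\<xi>. pmf (gibbs N \<beta> \<beta>\<^sub>1 \<beta>\<^sub>2 \<xi>) \<sigma>)
        \<in> borel_measurable (quenched_law N \<alpha> \<alpha>\<^sub>1 \<alpha>\<^sub>2)" for \<sigma>
      unfolding pmf_gibbs partition_function_def by (cases "\<sigma> \<in> configs N") simp_all
    show ?thesis
      by (cases "\<forall>l. l \<notin> {1..k} \<longrightarrow> s l = undefined") (simp_all add: replicas_def pmf_Pi)
  qed
  show ?thesis
    unfolding eq
  proof (intro Bochner_Integration.integrable_sum integrable_mult_right)
    show "integrable (quenched_law N \<alpha> \<alpha>\<^sub>1 \<alpha>\<^sub>2) (\<lambda>\<xi>. pmf (replicas N \<beta> \<beta>\<^sub>1 \<beta>\<^sub>2 \<xi> k) s)" for s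
      by (rule integrable_const_bound[where B = 1]) (simp_all add: meas pmf_le_1)
  qed
qed

end

theory Submission
  imports Defs "HOL-Real_Asymp.Real_Asymp"
begin

text \<open>The limit holds for every \<open>\<alpha>\<^sub>1\<close> and \<open>\<alpha>\<^sub>2\<close>, not only for almost all of them. Let
  \<open>F\<close> be the Gibbs average of \<open>(\<sigma>\<^sub>k \<sigma>\<^sub>l)\<close> to the power \<open>2 s\<close>, averaged over the sites
  \<open>k, l\<close>. Adding one bond of strength \<open>tanh\<^sup>-\<^sup>1 x\<close> with random sign and random end points changes
  \<open>F\<close> by a power series in \<open>x\<^sup>2\<close> whose coefficient at \<open>x\<close> to the power \<open>2 r\<close> is, up to the factor
  \<open>-2 s\<close>, the integrand of the claimed identity. It therefore suffices that the expectation of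
  \<open>F\<close> is asymptotically unchanged for a sequence of strengths \<open>x\<close> tending to zero.

  Such strengths are produced by the model itself. A chain of \<open>K\<close> Viana-Bray bonds whose interior
  sites meet no other bond acts, once the interior spins are summed out, as a single bond with
  \<open>x = (tanh \<beta>)\<^sup>K\<close>. The number of such chains is of order \<open>N\<close>, and it changes by a bounded amount
  when one bond is replaced, so its fluctuations are of order \<open>\<surd>N\<close>. Biasing the law of the disorder
  by this number, which amounts to inserting one more chain, hence changes the expectation of any
  bounded functional by \<open>O(1 / \<surd>N)\<close>. If \<open>\<alpha> = 0\<close> or \<open>\<beta> = 0\<close> all correlations vanish in the
  limit.\<close>

text \<open>A prescribed tuple of K bonds forms an isolated chain only with probability of order N
  to the power -(K - 1), one factor for each interior site; the number of index tuples, of order N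
  to the power K, restores a count of order N. The interior must avoid every other bond, so
  inserting a chain also reweights the remaining disorder, by the power K - 1 of the fraction of
  untouched sites. Two weights therefore have to be decoupled from the observable, the chain count
  and this power; both vary little when one bond is replaced, so one variance estimate serves for
  both. The argument needs a deterministic number of independent bonds: it compares K + n bonds with
  n bonds plus one effective bond, and the Poisson law afterwards absorbs the shift by K. The
  perturbation bonds are kept fixed meanwhile. Their number does not grow with N, so the sites that
  they act on can be forbidden as interior sites at a cost of order 1 / N; dominated convergence
  then restores their average.\<close>

type_synonym bond = "real \<times> nat \<times> nat"

section \<open>Averages over finite sets and over lists\<close>

text \<open>By the conventions for sums and division, the average over an empty or infinite set is
  0, so that bounds such as \<open>abs_avg_le_const\<close> and \<open>avg_square_le\<close> cover
  these cases too.\<close>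

definition avg :: "'a set \<Rightarrow> ('a \<Rightarrow> real) \<Rightarrow> real" where
  "avg A f = (\<Sum>x\<in>A. f x) / real (card A)"

lemma avg_cong [cong]: "A = B \<Longrightarrow> (\<And>x. x \<in> B \<Longrightarrow> f x = g x) \<Longrightarrow> avg A f = avg B g"
  by (simp add: avg_def)

lemma avg_add: "avg A (\<lambda>x. f x + g x) = avg A f + avg A g"
  by (simp add: avg_def sum.distrib add_divide_distrib)

lemma avg_diff: "avg A (\<lambda>x. f x - g x) = avg A f - avg A g"
  by (simp add: avg_def sum_subtractf diff_divide_distrib)

lemma avg_cmult: "avg A (\<lambda>x. c * f x) = c * avg A f"
  by (simp add: avg_def sum_distrib_left)

lemma avg_multc: "avg A (\<lambda>x. f x * c) = avg A f * c"
  by (simp add: avg_def sum_distrib_right)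

lemma avg_sum: "avg A (\<lambda>x. \<Sum>i\<in>I. f i x) = (\<Sum>i\<in>I. avg A (f i))"
  unfolding avg_def sum_divide_distrib by (rule sum.swap)

lemma avg_swap: "avg A (\<lambda>x. avg B (f x)) = avg B (\<lambda>y. avg A (\<lambda>x. f x y))"
  by (simp add: avg_def sum_divide_distrib sum.swap[of _ A B] mult.commute)

lemma avg_const [simp]: "finite A \<Longrightarrow> A \<noteq> {} \<Longrightarrow> avg A (\<lambda>_. c) = c"
  by (simp add: avg_def)

lemma avg_mono: "(\<And>x. x \<in> A \<Longrightarrow> f x \<le> g x) \<Longrightarrow> avg A f \<le> avg A g"
  by (simp add: avg_def sum_mono divide_right_mono)

lemma avg_nonneg: "(\<And>x. x \<in> A \<Longrightarrow> 0 \<le> f x) \<Longrightarrow> 0 \<le> avg A f"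
  by (simp add: avg_def sum_nonneg)

lemma avg_le_const: "finite A \<Longrightarrow> A \<noteq> {} \<Longrightarrow> (\<And>x. x \<in> A \<Longrightarrow> f x \<le> c) \<Longrightarrow> avg A f \<le> c"
  using avg_mono[of A f "\<lambda>_. c"] by simp

lemma abs_avg_le: "\<bar>avg A f\<bar> \<le> avg A (\<lambda>x. \<bar>f x\<bar>)"
  by (simp add: avg_def divide_right_mono sum_abs)

lemma abs_avg_le_const:
  assumes "0 \<le> c" "\<And>x. x \<in> A \<Longrightarrow> \<bar>f x\<bar> \<le> c"
  shows "\<bar>avg A f\<bar> \<le> c"
proof (cases "finite A \<and> A \<noteq> {}")
  case True
  then show ?thesis
    using order.trans[OF abs_avg_le avg_le_const] assms by metis
next
  case False
  with assms(1) show ?thesis by (auto simp: avg_def)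
qed

lemma avg_square_le: "(avg A f)\<^sup>2 \<le> avg A (\<lambda>x. (f x)\<^sup>2)"
proof (cases "finite A \<and> A \<noteq> {}")
  case True
  have "0 \<le> avg A (\<lambda>x. (f x - avg A f)\<^sup>2)"
    by (intro avg_nonneg) simp
  also have "\<dots> = avg A (\<lambda>x. (f x)\<^sup>2 - 2 * avg A f * f x + (avg A f)\<^sup>2)"
    by (simp add: power2_diff algebra_simps)
  also have "\<dots> = avg A (\<lambda>x. (f x)\<^sup>2) - (avg A f)\<^sup>2"
    using True by (simp add: avg_add avg_diff avg_cmult power2_eq_square mult.assoc)
  finally show ?thesis by simp
qed (auto simp: avg_def)

lemma avg_image: "inj_on g A \<Longrightarrow> avg (g ` A) f = avg A (\<lambda>x. f (g x))"
  by (simp add: avg_def sum.reindex card_image)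

lemma avg_times:
  assumes "finite A" "finite B"
  shows "avg (A \<times> B) f = avg A (\<lambda>x. avg B (\<lambda>y. f (x, y)))"
  using assms by (simp add: avg_def sum.cartesian_product sum_divide_distrib mult.commute)

section \<open>Uniform averages over lists of fixed length\<close>

definition lists_of :: "'a set \<Rightarrow> nat \<Rightarrow> 'a list set" where
  "lists_of A n = {xs. set xs \<subseteq> A \<and> length xs = n}"

lemma finite_lists_of [simp]: "finite A \<Longrightarrow> finite (lists_of A n)"
  by (simp add: lists_of_def finite_lists_length_eq)

lemma card_lists_of: "finite A \<Longrightarrow> card (lists_of A n) = card A ^ n"
  by (simp add: lists_of_def card_lists_length_eq)

lemma lists_of_nonempty [simp]: "A \<noteq> {} \<Longrightarrow> lists_of A n \<noteq> {}"
proof -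
  assume "A \<noteq> {}"
  then obtain a where "a \<in> A" by blast
  then have "replicate n a \<in> lists_of A n" by (auto simp: lists_of_def)
  then show ?thesis by blast
qed

lemma length_lists_of: "xs \<in> lists_of A n \<Longrightarrow> length xs = n"
  by (simp add: lists_of_def)

lemma lists_of_0 [simp]: "lists_of A 0 = {[]}"
  by (auto simp: lists_of_def)

lemma lists_of_Suc: "lists_of A (Suc n) = (\<lambda>(x, xs). x # xs) ` (A \<times> lists_of A n)"
  by (auto simp: lists_of_def length_Suc_conv image_iff)

lemma avg_lists_of_Suc:
  assumes "finite A"
  shows "avg (lists_of A (Suc n)) f = avg A (\<lambda>x. avg (lists_of A n) (\<lambda>xs. f (x # xs)))"
proof -
  have "inj_on (\<lambda>(x, xs). x # xs) (A \<times> lists_of A n)" by (auto simp: inj_on_def)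
  with assms show ?thesis by (simp add: lists_of_Suc avg_image avg_times)
qed

lemma avg_lists_of_add:
  assumes "finite A"
  shows "avg (lists_of A (k + n)) f = avg (lists_of A k) (\<lambda>ys. avg (lists_of A n) (\<lambda>zs. f (ys @ zs)))"
proof (induction k arbitrary: f)
  case 0
  then show ?case by (simp add: avg_def)
next
  case (Suc k)
  show ?case
    using assms by (simp add: avg_lists_of_Suc Suc.IH)
qed

text \<open>Exchangeability of the uniform law: reading off the coordinates in another order is a
  bijection of \<open>lists_of A n\<close>. Its inverse reads position \<open>h i\<close>, the place
  of \<open>i\<close> in \<open>ix\<close>.\<close>

lemma avg_lists_of_permute:
  fixes ix :: "nat list"
  assumes ix: "distinct ix" "set ix = {..<n}"
  shows "avg (lists_of A n) (\<lambda>xs. f (map (\<lambda>i. xs ! i) ix)) = avg (lists_of A n) f"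
proof -
  have len: "length ix = n" using ix distinct_card[of ix] by simp
  let ?g = "\<lambda>xs :: 'a list. map (\<lambda>i. xs ! i) ix"
  have inj: "inj_on ?g (lists_of A n)"
  proof (rule inj_onI)
    fix xs ys assume h: "xs \<in> lists_of A n" "ys \<in> lists_of A n" "?g xs = ?g ys"
    then have eq: "\<forall>i\<in>set ix. xs ! i = ys ! i" by simp
    show "xs = ys"
    proof (rule nth_equalityI)
      show "length xs = length ys" using h(1,2) by (simp add: length_lists_of)
      fix i assume "i < length xs"
      then show "xs ! i = ys ! i" using eq h(1) ix(2) by (simp add: length_lists_of)
    qed
  qed
  have bij: "bij_betw (\<lambda>j. ix ! j) {..<n} {..<n}"
    by (rule bij_betw_nth) (use ix len in simp_all)
  define h where "h = the_inv_into {..<n} (\<lambda>j. ix ! j)"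
  have h: "h i < n" if "i < n" for i
    using bij_betwE[OF bij_betw_the_inv_into[OF bij]] that unfolding h_def by simp
  have "?g ` lists_of A n = lists_of A n"
  proof (rule equalityI)
    show "?g ` lists_of A n \<subseteq> lists_of A n"
    proof (rule image_subsetI)
      fix xs assume "xs \<in> lists_of A n"
      then show "?g xs \<in> lists_of A n"
        using ix(2) len nth_mem[of _ xs] unfolding lists_of_def by fastforce
    qed
    show "lists_of A n \<subseteq> ?g ` lists_of A n"
    proof
      fix ys assume ys: "ys \<in> lists_of A n"
      define xs where "xs = map (\<lambda>i. ys ! h i) [0..<n]"
      have "xs \<in> lists_of A n"
        using ys h nth_mem[of _ ys] unfolding xs_def lists_of_def by fastforce
      moreover have "ys = ?g xs"
      proof (rule nth_equalityI)
        show "length ys = length (?g xs)" using len ys by (simp add: length_lists_of)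
        fix j assume "j < length ys"
        then have j: "j < n" using ys by (simp add: length_lists_of)
        have lt: "ix ! j < n" using bij_betwE[OF bij] j by simp
        have "h (ix ! j) = j"
          unfolding h_def by (rule the_inv_into_f_f[OF bij_betw_imp_inj_on[OF bij]]) (use j in simp)
        then show "ys ! j = ?g xs ! j"
          using j len lt by (simp add: xs_def)
      qed
      ultimately show "ys \<in> ?g ` lists_of A n" by (rule rev_image_eqI)
    qed
  qed
  with avg_image[OF inj, of f] show ?thesis by simp
qed

text \<open>A bound of Efron-Stein type. Conditioning on the first entry splits the variance into
  the mean conditional variance, controlled by the induction hypothesis, and the variance of the
  conditional mean \<open>g\<close>, whose values differ by at most \<open>D\<close>. Each
  coordinate thus contributes at most D^2.\<close>

lemma avg_lists_of_variance:
  fixes f :: "'a list \<Rightarrow> real"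
  assumes A: "finite A" "A \<noteq> {}" and "0 \<le> D"
    and "\<And>xs i x. xs \<in> lists_of A n \<Longrightarrow> i < n \<Longrightarrow> x \<in> A \<Longrightarrow> \<bar>f (xs[i := x]) - f xs\<bar> \<le> D"
  shows "avg (lists_of A n) (\<lambda>xs. (f xs - avg (lists_of A n) f)\<^sup>2) \<le> real n * D\<^sup>2"
  using assms(4)
proof (induction n arbitrary: f)
  case 0
  then show ?case by (simp add: avg_def)
next
  case (Suc n)
  let ?L = "lists_of A n"
  have L: "finite ?L" "?L \<noteq> {}" using A by auto
  define g where "g x = avg ?L (\<lambda>xs. f (x # xs))" for x
  define m where "m = avg A g"
  have tot: "avg (lists_of A (Suc n)) f = m"
    using A by (simp add: avg_lists_of_Suc g_def m_def)
  have gd: "\<bar>g x - g y\<bar> \<le> D" if "x \<in> A" "y \<in> A" for x y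
    unfolding g_def avg_diff[symmetric]
  proof (rule abs_avg_le_const[OF \<open>0 \<le> D\<close>])
    fix xs assume "xs \<in> ?L"
    with that have "y # xs \<in> lists_of A (Suc n)" by (simp add: lists_of_def)
    from Suc.prems[OF this, of 0 x] that show "\<bar>f (x # xs) - f (y # xs)\<bar> \<le> D" by simp
  qed
  have gm: "\<bar>g x - m\<bar> \<le> D" if "x \<in> A" for x
  proof -
    have "g x - m = avg A (\<lambda>y. g x - g y)" using A by (simp add: avg_diff m_def)
    also have "\<bar>\<dots>\<bar> \<le> D" by (rule abs_avg_le_const[OF \<open>0 \<le> D\<close>]) (use gd that in auto)
    finally show ?thesis .
  qed
  have ih: "avg ?L (\<lambda>xs. (f (x # xs) - g x)\<^sup>2) \<le> real n * D\<^sup>2" if x: "x \<in> A" for x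
    unfolding g_def
  proof (rule Suc.IH)
    fix xs i y assume h: "xs \<in> ?L" "i < n" "y \<in> A"
    then have "x # xs \<in> lists_of A (Suc n)" using x by (simp add: lists_of_def)
    from Suc.prems[OF this, of "Suc i" y] h
    show "\<bar>f (x # xs[i := y]) - f (x # xs)\<bar> \<le> D" by simp
  qed
  \<comment> \<open>The cross term vanishes because \<open>g x\<close> is the mean of
    \<open>f (x # xs)\<close> over \<open>xs\<close>.\<close>
  have "avg ?L (\<lambda>xs. (f (x # xs) - m)\<^sup>2) = avg ?L (\<lambda>xs. (f (x # xs) - g x)\<^sup>2) + (g x - m)\<^sup>2" for x
  proof -
    have "(f (x # xs) - m)\<^sup>2 = (f (x # xs) - g x)\<^sup>2 + 2 * (g x - m) * (f (x # xs) - g x) + (g x - m)\<^sup>2"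
      for xs by (simp add: power2_eq_square algebra_simps)
    then have "avg ?L (\<lambda>xs. (f (x # xs) - m)\<^sup>2) = avg ?L (\<lambda>xs. (f (x # xs) - g x)\<^sup>2)
       + 2 * (g x - m) * (avg ?L (\<lambda>xs. f (x # xs)) - g x) + (g x - m)\<^sup>2"
      using L by (simp add: avg_add avg_cmult avg_diff)
    then show ?thesis by (simp add: g_def)
  qed
  then have "avg (lists_of A (Suc n)) (\<lambda>xs. (f xs - avg (lists_of A (Suc n)) f)\<^sup>2)
      = avg A (\<lambda>x. avg ?L (\<lambda>xs. (f (x # xs) - g x)\<^sup>2) + (g x - m)\<^sup>2)"
    unfolding tot using A by (simp add: avg_lists_of_Suc)
  also have "\<dots> \<le> avg A (\<lambda>x. real n * D\<^sup>2 + D\<^sup>2)"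
  proof (rule avg_mono)
    fix x assume "x \<in> A"
    then show "avg ?L (\<lambda>xs. (f (x # xs) - g x)\<^sup>2) + (g x - m)\<^sup>2 \<le> real n * D\<^sup>2 + D\<^sup>2"
      using ih gm \<open>0 \<le> D\<close> by (intro add_mono) (auto simp: abs_le_square_iff[symmetric])
  qed
  also have "\<dots> = real (Suc n) * D\<^sup>2"
    using A by (simp add: algebra_simps)
  finally show ?case .
qed

text \<open>The covariance with a function bounded by 1 is at most the mean absolute deviation of
  \<open>f\<close>, hence at most its standard deviation. If \<open>f\<close> has mean of order n
  and \<open>D\<close> stays bounded, the relative error is of order 1 / sqrt n, which is why
  biasing by \<open>f\<close> is harmless.\<close>

lemma avg_lists_of_decouple:
  fixes f g :: "'a list \<Rightarrow> real"
  assumes A: "finite A" "A \<noteq> {}" and "0 \<le> D"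
    and D: "\<And>xs i x. xs \<in> lists_of A n \<Longrightarrow> i < n \<Longrightarrow> x \<in> A \<Longrightarrow> \<bar>f (xs[i := x]) - f xs\<bar> \<le> D"
    and g: "\<And>xs. xs \<in> lists_of A n \<Longrightarrow> \<bar>g xs\<bar> \<le> 1"
  shows "\<bar>avg (lists_of A n) (\<lambda>xs. f xs * g xs) - avg (lists_of A n) f * avg (lists_of A n) g\<bar>
      \<le> D * sqrt (real n)"
proof -
  let ?L = "lists_of A n"
  let ?m = "avg ?L f"
  have "avg ?L (\<lambda>xs. f xs * g xs) - ?m * avg ?L g = avg ?L (\<lambda>xs. (f xs - ?m) * g xs)"
    by (simp add: left_diff_distrib avg_diff avg_cmult)
  then have "\<bar>avg ?L (\<lambda>xs. f xs * g xs) - ?m * avg ?L g\<bar> \<le> avg ?L (\<lambda>xs. \<bar>(f xs - ?m) * g xs\<bar>)"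
    by (simp add: abs_avg_le)
  also have "\<dots> \<le> avg ?L (\<lambda>xs. \<bar>f xs - ?m\<bar>)"
    by (rule avg_mono) (use g in \<open>auto simp: abs_mult intro!: mult_left_le\<close>)
  also have "\<dots> \<le> sqrt (avg ?L (\<lambda>xs. (f xs - ?m)\<^sup>2))"
    by (rule real_le_rsqrt) (use avg_square_le[of ?L "\<lambda>xs. \<bar>f xs - ?m\<bar>"] in simp)
  also have "\<dots> \<le> sqrt (real n * D\<^sup>2)"
    using avg_lists_of_variance[of A D n f] assms by simp
  also have "\<dots> = D * sqrt (real n)"
    using \<open>0 \<le> D\<close> by (simp add: real_sqrt_mult)
  finally show ?thesis .
qed

section \<open>Isolated chains of bonds\<close>

abbreviation src :: "bond \<Rightarrow> nat" where "src e \<equiv> fst (snd e)"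

abbreviation tgt :: "bond \<Rightarrow> nat" where "tgt e \<equiv> snd (snd e)"

definition touches :: "nat \<Rightarrow> bond \<Rightarrow> bool" where
  "touches v e \<longleftrightarrow> v = src e \<or> v = tgt e"

text \<open>The bonds with indices \<open>ix\<close>, each traversed from its first to its second site, form a chain.
  The set \<open>B\<close> collects the sites which the perturbations act on.\<close>

definition isolated_chain :: "nat set \<Rightarrow> bond list \<Rightarrow> nat list \<Rightarrow> bool" where
  "isolated_chain B xs ix \<longleftrightarrow>
     (\<forall>i\<in>set ix. src (xs ! i) \<noteq> tgt (xs ! i)) \<and>
     (\<forall>l. Suc l < length ix \<longrightarrow>
        src (xs ! (ix ! Suc l)) = tgt (xs ! (ix ! l)) \<and> tgt (xs ! (ix ! l)) \<notin> B \<and>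
        (\<forall>j<length xs. touches (tgt (xs ! (ix ! l))) (xs ! j) \<longrightarrow> j = ix ! l \<or> j = ix ! Suc l))"

definition index_tuples :: "nat \<Rightarrow> nat \<Rightarrow> nat list set" where
  "index_tuples K n = {ix. length ix = K \<and> distinct ix \<and> set ix \<subseteq> {..<n}}"

definition chains :: "nat \<Rightarrow> nat set \<Rightarrow> bond list \<Rightarrow> nat list set" where
  "chains K B xs = {ix \<in> index_tuples K (length xs). isolated_chain B xs ix}"

lemma finite_index_tuples [simp]: "finite (index_tuples K n)"
  unfolding index_tuples_def
  by (rule finite_subset[OF _ finite_lists_length_eq[of "{..<n}" K]]) auto

lemma finite_chains [simp]: "finite (chains K B xs)"
  by (simp add: chains_def)

lemma chainsD:
  assumes "ix \<in> chains K B xs"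
  shows "length ix = K" "distinct ix" "set ix \<subseteq> {..<length xs}" "isolated_chain B xs ix"
  using assms by (auto simp: chains_def index_tuples_def)

lemma chains_step:
  assumes ix: "ix \<in> chains K B xs" and l: "Suc l < K"
  shows "src (xs ! (ix ! Suc l)) = tgt (xs ! (ix ! l))"
    and "\<And>j. j < length xs \<Longrightarrow> touches (tgt (xs ! (ix ! l))) (xs ! j) \<Longrightarrow> j = ix ! l \<or> j = ix ! Suc l"
    and "ix ! l \<noteq> ix ! Suc l" and "ix ! l < length xs" and "ix ! Suc l < length xs"
    and "src (xs ! (ix ! l)) \<noteq> tgt (xs ! (ix ! l))"
    and "src (xs ! (ix ! Suc l)) \<noteq> tgt (xs ! (ix ! Suc l))"
proof -
  note D = chainsD[OF ix]
  have m: "ix ! l \<in> set ix" "ix ! Suc l \<in> set ix" using D(1) l by auto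
  show "src (xs ! (ix ! Suc l)) = tgt (xs ! (ix ! l))"
    and "\<And>j. j < length xs \<Longrightarrow> touches (tgt (xs ! (ix ! l))) (xs ! j) \<Longrightarrow> j = ix ! l \<or> j = ix ! Suc l"
    using D(1,4) l unfolding isolated_chain_def by blast+
  show "ix ! l \<noteq> ix ! Suc l" using D(1,2) l by (simp add: nth_eq_iff_index_eq)
  show "ix ! l < length xs" "ix ! Suc l < length xs" using D(3) m by auto
  show "src (xs ! (ix ! l)) \<noteq> tgt (xs ! (ix ! l))"
    and "src (xs ! (ix ! Suc l)) \<noteq> tgt (xs ! (ix ! Suc l))"
    using D(4) m unfolding isolated_chain_def by blast+
qed

text \<open>An interior site lies on exactly two bonds, so a chain is determined by any one of its bonds;
  this bounds the effect of replacing one bond on the number of chains.\<close>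

lemma chains_forward:
  assumes "ix \<in> chains K B xs" "iy \<in> chains K B xs" "Suc l < K" "ix ! l = iy ! l"
  shows "ix ! Suc l = iy ! Suc l"
  using chains_step(1,3,5)[OF assms(2,3)] chains_step(2)[OF assms(1,3), of "iy ! Suc l"] assms(4)
  by (auto simp: touches_def)

lemma chains_backward:
  assumes "ix \<in> chains K B xs" "iy \<in> chains K B xs" "Suc l < K" "ix ! Suc l = iy ! Suc l"
  shows "ix ! l = iy ! l"
  using chains_step(1,3,4)[OF assms(2,3)] chains_step(1)[OF assms(1,3)]
    chains_step(2)[OF assms(1,3), of "iy ! l"] assms(4)
  by (auto simp: touches_def)

lemma chains_eqI:
  assumes "ix \<in> chains K B xs" "iy \<in> chains K B xs" "l < K" "ix ! l = iy ! l"
  shows "ix = iy"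
proof (rule nth_equalityI)
  show "length ix = length iy" using assms(1,2) by (simp add: chainsD(1))
  fix j assume "j < length ix"
  then have j: "j < K" using assms(1) by (simp add: chainsD(1))
  show "ix ! j = iy ! j"
  proof (cases "l \<le> j")
    case True
    then show ?thesis
      using j
    proof (induction j rule: dec_induct)
      case base
      then show ?case using assms(4) by simp
    next
      case (step m)
      then show ?case using chains_forward[OF assms(1,2)] by simp
    qed
  next
    case False
    then have "j \<le> l" by simp
    then show ?thesis
      using \<open>l < K\<close>
    proof (induction j rule: inc_induct)
      case base
      then show ?case using assms(4) by simp
    next
      case (step m)
      then show ?case using chains_backward[OF assms(1,2), of m] by simp
    qed
  qed
qed

text \<open>A bond of the second chain ending at an interior site of the first must be one of the
  two bonds there. It cannot be the outgoing one, which starts at that site and would then be a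
  loop. So the chains share a bond and \<open>chains_eqI\<close> applies.\<close>

lemma chains_interior_eqI:
  assumes "ix \<in> chains K B xs" "iy \<in> chains K B xs" "Suc l < K"
    "tgt (xs ! (ix ! l)) = tgt (xs ! (iy ! l))"
  shows "ix = iy"
proof (rule chains_eqI[OF assms(1,2)])
  show "l < K" using assms(3) by simp
  have "iy ! l = ix ! l \<or> iy ! l = ix ! Suc l"
    by (rule chains_step(2)[OF assms(1,3) chains_step(4)[OF assms(2,3)]])
      (simp add: touches_def assms(4))
  moreover have "iy ! l \<noteq> ix ! Suc l"
    using chains_step(6)[OF assms(2,3)] chains_step(1)[OF assms(1,3)] assms(4) by metis
  ultimately show "ix ! l = iy ! l" by simp
qed

lemma card_le_1I: "finite A \<Longrightarrow> (\<And>x y. x \<in> A \<Longrightarrow> y \<in> A \<Longrightarrow> x = y) \<Longrightarrow> card A \<le> 1"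
  by (simp add: card_le_Suc0_iff_eq)

text \<open>A chain is lost only if it contains the replaced bond, at one of its \<open>K\<close>
  places (\<open>P\<close>), or if an end of the new bond hits one of its interior sites
  (\<open>Q\<close>, for either end). Each of these 3 K families has at most one member, by
  \<open>chains_eqI\<close> and \<open>chains_interior_eqI\<close>.\<close>

lemma card_chains_update_le:
  assumes "i < length xs"
  shows "card (chains K B xs) \<le> card (chains K B (xs[i := e])) + 3 * K"
proof -
  let ?C = "chains K B xs" and ?C' = "chains K B (xs[i := e])"
  define P where "P l = {ix \<in> ?C. ix ! l = i}" for l
  define Q where "Q v l = {ix \<in> ?C. Suc l < K \<and> tgt (xs ! (ix ! l)) = v}" for v l
  have P: "card (P l) \<le> 1" if "l < K" for l
    by (rule card_le_1I) (use that in \<open>auto simp: P_def intro: chains_eqI\<close>)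
  have Q: "card (Q v l) \<le> 1" for v l
    by (rule card_le_1I) (auto simp: Q_def intro: chains_interior_eqI)
  let ?U = "(\<Union>l<K. P l) \<union> (\<Union>l<K. Q (src e) l) \<union> (\<Union>l<K. Q (tgt e) l)"
  have "?C \<subseteq> ?C' \<union> ?U"
  proof
    fix ix assume ix: "ix \<in> ?C"
    show "ix \<in> ?C' \<union> ?U"
    proof (rule ccontr)
      assume not: "ix \<notin> ?C' \<union> ?U"
      have len: "length ix = K" using ix by (rule chainsD)
      have ni: "i \<notin> set ix"
        using not ix len by (auto simp: P_def in_set_conv_nth)
      have nt: "\<not> touches (tgt (xs ! (ix ! l))) e" if "Suc l < K" for l
        using not ix that by (auto simp: Q_def touches_def)
      have same: "xs[i := e] ! j = xs ! j" if "j \<in> set ix" for j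
        using that ni by (metis nth_list_update_neq)
      have same': "xs[i := e] ! (ix ! l) = xs ! (ix ! l)" if "l < K" for l
        using that len by (intro same) auto
      have "isolated_chain B (xs[i := e]) ix"
        unfolding isolated_chain_def
      proof (intro conjI ballI allI impI)
        fix j assume "j \<in> set ix"
        then show "src (xs[i := e] ! j) \<noteq> tgt (xs[i := e] ! j)"
          using chainsD(4)[OF ix] same unfolding isolated_chain_def by simp
      next
        fix l assume l: "Suc l < length ix"
        then show "src (xs[i := e] ! (ix ! Suc l)) = tgt (xs[i := e] ! (ix ! l))"
          "tgt (xs[i := e] ! (ix ! l)) \<notin> B"
          using chainsD(4)[OF ix] same' len unfolding isolated_chain_def by simp_all
        fix j assume "j < length (xs[i := e])"
          "touches (tgt (xs[i := e] ! (ix ! l))) (xs[i := e] ! j)"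
        then show "j = ix ! l \<or> j = ix ! Suc l"
          using nt[of l] l len same'[of l] assms chains_step(2)[OF ix, of l j]
          by (cases "j = i") auto
      qed
      with ix have "ix \<in> ?C'" by (auto simp: chains_def)
      with not show False by simp
    qed
  qed
  then have "card ?C \<le> card (?C' \<union> ?U)"
    by (rule card_mono[rotated]) (auto simp: P_def Q_def)
  also have "\<dots> \<le> card ?C' + (card (\<Union>l<K. P l) + card (\<Union>l<K. Q (src e) l)
      + card (\<Union>l<K. Q (tgt e) l))"
    by (intro order.trans[OF card_Un_le] add_mono order.refl)
  also have "\<dots> \<le> card ?C' + (K + K + K)"
  proof (intro add_mono order.refl)
    show "card (\<Union>l<K. P l) \<le> K"
      using order.trans[OF card_UN_le[of "{..<K}" P] sum_mono[of "{..<K}" "\<lambda>l. card (P l)" "\<lambda>_. 1"]] P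
      by simp
    show "card (\<Union>l<K. Q v l) \<le> K" for v
      using order.trans[OF card_UN_le[of "{..<K}" "Q v"] sum_mono[of "{..<K}" "\<lambda>l. card (Q v l)" "\<lambda>_. 1"]] Q
      by simp
    then show "card (\<Union>l<K. Q (tgt e) l) \<le> K" .
  qed
  finally show ?thesis by simp
qed

lemma card_chains_bounded_difference:
  assumes "i < length xs"
  shows "\<bar>real (card (chains K B (xs[i := e]))) - real (card (chains K B xs))\<bar> \<le> 3 * real K"
proof -
  \<comment> \<open>The opposite inequality comes from undoing the replacement.\<close>
  have "card (chains K B (xs[i := e])) \<le> card (chains K B (xs[i := e, i := xs ! i])) + 3 * K"
    by (rule card_chains_update_le) (use assms in simp)
  then have "card (chains K B (xs[i := e])) \<le> card (chains K B xs) + 3 * K"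
    by simp
  moreover have "card (chains K B xs) \<le> card (chains K B (xs[i := e])) + 3 * K"
    using assms by (rule card_chains_update_le)
  ultimately show ?thesis by linarith
qed

text \<open>For an observable that ignores the order of the bonds, every index tuple contributes the
  same as the first \<open>K\<close> positions: a reordering of the list carries one tuple to the
  other and preserves the uniform law.\<close>

lemma avg_card_chains:
  assumes F: "\<And>xs ix. xs \<in> lists_of A (K + n) \<Longrightarrow> distinct ix \<Longrightarrow> set ix = {..<K + n} \<Longrightarrow>
     F (map (\<lambda>i. xs ! i) ix) = F xs"
  shows "avg (lists_of A (K + n)) (\<lambda>xs. real (card (chains K B xs)) * F xs) =
     real (card (index_tuples K (K + n))) *
       avg (lists_of A (K + n)) (\<lambda>xs. of_bool (isolated_chain B xs [0..<K]) * F xs)"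
proof -
  let ?L = "lists_of A (K + n)" and ?T = "index_tuples K (K + n)"
  have "avg ?L (\<lambda>xs. real (card (chains K B xs)) * F xs)
      = avg ?L (\<lambda>xs. \<Sum>ix\<in>?T. of_bool (isolated_chain B xs ix) * F xs)"
  proof (rule avg_cong[OF refl])
    fix xs assume "xs \<in> ?L"
    then have "chains K B xs = {ix \<in> ?T. isolated_chain B xs ix}"
      by (simp add: chains_def length_lists_of)
    then have "real (card (chains K B xs)) = (\<Sum>ix\<in>?T. of_bool (isolated_chain B xs ix))"
      by (simp add: Int_def)
    then show "real (card (chains K B xs)) * F xs = (\<Sum>ix\<in>?T. of_bool (isolated_chain B xs ix) * F xs)"
      by (simp only: sum_distrib_right)
  qed
  also have "\<dots> = (\<Sum>ix\<in>?T. avg ?L (\<lambda>xs. of_bool (isolated_chain B xs ix) * F xs))"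
    by (rule avg_sum)
  also have "\<dots> = (\<Sum>ix\<in>?T. avg ?L (\<lambda>xs. of_bool (isolated_chain B xs [0..<K]) * F xs))"
  proof (rule sum.cong[OF refl])
    fix ix assume "ix \<in> ?T"
    then have ix: "length ix = K" "distinct ix" "set ix \<subseteq> {..<K + n}"
      by (auto simp: index_tuples_def)
    \<comment> \<open>\<open>p\<close> completes \<open>ix\<close> to an enumeration of all
      positions, so that the chain comes to stand in front.\<close>
    define p where "p = ix @ filter (\<lambda>j. j \<notin> set ix) [0..<K + n]"
    have p: "distinct p" "set p = {..<K + n}" using ix by (auto simp: p_def)
    have lenp: "length p = K + n" using p distinct_card[of p] by simp
    have pl: "p ! l = ix ! l" if "l < K" for l using that ix by (simp add: p_def nth_append)
    have plt: "p ! l < K + n" if "l < K + n" for l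
      using p(2) lenp that nth_mem[of l p] by simp
    have iso: "isolated_chain B xs ix \<longleftrightarrow> isolated_chain B (map (\<lambda>i. xs ! i) p) [0..<K]"
      if xs: "xs \<in> ?L" for xs
    proof -
      let ?ys = "map (\<lambda>i. xs ! i) p"
      have len: "length xs = K + n" using xs by (simp add: length_lists_of)
      have nth: "?ys ! l = xs ! (p ! l)" if "l < K + n" for l using that lenp by simp
      have nth': "?ys ! l = xs ! (ix ! l)" if "l < K" for l using that lenp pl by simp
      have all: "(\<forall>j<K + n. touches v (xs ! j) \<longrightarrow> j = ix ! l \<or> j = ix ! Suc l) \<longleftrightarrow>
          (\<forall>j<K + n. touches v (?ys ! j) \<longrightarrow> j = l \<or> j = Suc l)" (is "?a \<longleftrightarrow> ?b")
        if l: "Suc l < K" for v l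
      proof
        assume a: ?a
        show ?b
        proof (intro allI impI)
          fix j assume j: "j < K + n" "touches v (?ys ! j)"
          then have "p ! j = ix ! l \<or> p ! j = ix ! Suc l" using a plt nth by simp
          then have "p ! j = p ! l \<or> p ! j = p ! Suc l" using pl l by simp
          then show "j = l \<or> j = Suc l" using p(1) lenp l j(1) by (simp add: nth_eq_iff_index_eq)
        qed
      next
        assume b: ?b
        show ?a
        proof (intro allI impI)
          fix j assume j: "j < K + n" "touches v (xs ! j)"
          then obtain j' where j': "j' < K + n" "p ! j' = j"
            using p(2) lenp by (metis in_set_conv_nth lessThan_iff)
          then have "j' = l \<or> j' = Suc l" using b j nth by simp
          then show "j = ix ! l \<or> j = ix ! Suc l" using j' pl l by auto
        qed
      qed
      have "(\<forall>i\<in>set ix. src (xs ! i) \<noteq> tgt (xs ! i)) \<longleftrightarrow>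
          (\<forall>l<K. src (xs ! (ix ! l)) \<noteq> tgt (xs ! (ix ! l)))"
        using ix(1) by (metis in_set_conv_nth)
      also have "\<dots> \<longleftrightarrow> (\<forall>i\<in>set [0..<K]. src (?ys ! i) \<noteq> tgt (?ys ! i))"
        using nth' by auto
      finally have a: "(\<forall>i\<in>set ix. src (xs ! i) \<noteq> tgt (xs ! i)) \<longleftrightarrow>
          (\<forall>i\<in>set [0..<K]. src (?ys ! i) \<noteq> tgt (?ys ! i))" .
      have b: "(src (xs ! (ix ! Suc l)) = tgt (xs ! (ix ! l)) \<and> tgt (xs ! (ix ! l)) \<notin> B \<and>
          (\<forall>j<length xs. touches (tgt (xs ! (ix ! l))) (xs ! j) \<longrightarrow> j = ix ! l \<or> j = ix ! Suc l)) \<longleftrightarrow>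
        (src (?ys ! ([0..<K] ! Suc l)) = tgt (?ys ! ([0..<K] ! l)) \<and>
          tgt (?ys ! ([0..<K] ! l)) \<notin> B \<and>
          (\<forall>j<length ?ys. touches (tgt (?ys ! ([0..<K] ! l))) (?ys ! j) \<longrightarrow>
             j = [0..<K] ! l \<or> j = [0..<K] ! Suc l))" if l: "Suc l < K" for l
      proof -
        have 1: "[0..<K] ! l = l" "[0..<K] ! Suc l = Suc l" "?ys ! l = xs ! (ix ! l)"
          "?ys ! Suc l = xs ! (ix ! Suc l)" "length ?ys = K + n" "length xs = K + n"
          using l nth'[of l] nth'[of "Suc l"] len lenp by simp_all
        show ?thesis unfolding 1 all[OF l] by (rule refl)
      qed
      have c: "length [0..<K] = K" by simp
      show ?thesis
        unfolding isolated_chain_def a ix(1) c using b by blast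
    qed
    have "avg ?L (\<lambda>xs. of_bool (isolated_chain B xs ix) * F xs)
       = avg ?L (\<lambda>xs. of_bool (isolated_chain B (map (\<lambda>i. xs ! i) p) [0..<K]) * F (map (\<lambda>i. xs ! i) p))"
      using iso F[OF _ p] by (intro avg_cong) simp_all
    also have "\<dots> = avg ?L (\<lambda>xs. of_bool (isolated_chain B xs [0..<K]) * F xs)"
      by (rule avg_lists_of_permute[OF p])
    finally show "avg ?L (\<lambda>xs. of_bool (isolated_chain B xs ix) * F xs) = \<dots>" .
  qed
  also have "\<dots> = real (card ?T) * avg ?L (\<lambda>xs. of_bool (isolated_chain B xs [0..<K]) * F xs)"
    by simp
  finally show ?thesis .
qed

section \<open>Summing out free spins\<close>

definition gibbs_mean :: "nat \<Rightarrow> (config \<Rightarrow> real) \<Rightarrow> (config \<Rightarrow> real) \<Rightarrow> real" where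
  "gibbs_mean N w f = (\<Sum>\<sigma>\<in>configs N. w \<sigma> * f \<sigma>) / (\<Sum>\<sigma>\<in>configs N. w \<sigma>)"

abbreviation spins2 :: "nat \<Rightarrow> nat \<Rightarrow> config \<Rightarrow> real" where
  "spins2 i j \<equiv> \<lambda>\<sigma>. \<sigma> i * \<sigma> j"

abbreviation spins4 :: "nat \<Rightarrow> nat \<Rightarrow> nat \<Rightarrow> nat \<Rightarrow> config \<Rightarrow> real" where
  "spins4 i j k l \<equiv> \<lambda>\<sigma>. \<sigma> i * \<sigma> j * (\<sigma> k * \<sigma> l)"

definition spin_free :: "nat \<Rightarrow> (config \<Rightarrow> real) \<Rightarrow> bool" where
  "spin_free v g \<longleftrightarrow> (\<forall>\<sigma> c. g (\<sigma>(v := c)) = g \<sigma>)"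

lemma spin_freeI: "(\<And>\<sigma> c. g (\<sigma>(v := c)) = g \<sigma>) \<Longrightarrow> spin_free v g"
  by (simp add: spin_free_def)

lemma spin_freeD: "spin_free v g \<Longrightarrow> g (\<sigma>(v := c)) = g \<sigma>"
  by (simp add: spin_free_def)

lemma spin_free_mult: "spin_free v f \<Longrightarrow> spin_free v g \<Longrightarrow> spin_free v (\<lambda>\<sigma>. f \<sigma> * g \<sigma>)"
  by (simp add: spin_free_def)

lemma spin_free_const [simp]: "spin_free v (\<lambda>_. c)"
  by (simp add: spin_free_def)

lemma spin_free_spin: "v \<noteq> a \<Longrightarrow> spin_free v (\<lambda>\<sigma>. \<sigma> a)"
  by (simp add: spin_free_def)

lemma configs_spin: "\<sigma> \<in> configs N \<Longrightarrow> v \<in> {1..N} \<Longrightarrow> \<sigma> v = -1 \<or> \<sigma> v = 1"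
  by (auto simp: configs_def PiE_iff)

lemma configs_spin_sq: "\<sigma> \<in> configs N \<Longrightarrow> v \<in> {1..N} \<Longrightarrow> \<sigma> v * \<sigma> v = 1"
  using configs_spin by fastforce

lemma configs_spin_abs: "\<sigma> \<in> configs N \<Longrightarrow> v \<in> {1..N} \<Longrightarrow> \<bar>\<sigma> v\<bar> = 1"
  using configs_spin by fastforce

lemma sum_configs_flip:
  assumes "v \<in> {1..N}"
  shows "(\<Sum>\<sigma>\<in>configs N. f (\<sigma>(v := - \<sigma> v))) = (\<Sum>\<sigma>\<in>configs N. f \<sigma>)"
proof (rule sum.reindex_bij_witness[where i = "\<lambda>\<sigma>. \<sigma>(v := - \<sigma> v)" and j = "\<lambda>\<sigma>. \<sigma>(v := - \<sigma> v)"])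
  fix \<sigma> assume "\<sigma> \<in> configs N"
  then show "\<sigma>(v := - \<sigma> v) \<in> configs N"
    using assms by (auto simp: configs_def PiE_iff extensional_def)
  then show "\<sigma>(v := - \<sigma> v) \<in> configs N" .
qed auto

text \<open>Flipping the spin at \<open>v\<close> permutes the configurations and negates every
  summand.\<close>

lemma sum_configs_free_spin:
  assumes "v \<in> {1..N}" "spin_free v g"
  shows "(\<Sum>\<sigma>\<in>configs N. g \<sigma> * \<sigma> v) = 0"
proof -
  have "(\<Sum>\<sigma>\<in>configs N. g \<sigma> * \<sigma> v) = (\<Sum>\<sigma>\<in>configs N. g (\<sigma>(v := - \<sigma> v)) * (\<sigma>(v := - \<sigma> v)) v)"
    by (rule sum_configs_flip[OF assms(1), symmetric])
  also have "\<dots> = - (\<Sum>\<sigma>\<in>configs N. g \<sigma> * \<sigma> v)"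
    by (simp add: spin_freeD[OF assms(2)] sum_negf)
  finally show ?thesis by simp
qed

text \<open>Decimation of one site: when the product is multiplied out, the terms linear in the spin
  at \<open>v\<close> sum to 0, and in the mixed term that spin squares to 1. Strengths of bonds in
  series therefore multiply.\<close>

lemma sum_configs_trace_spin:
  assumes v: "v \<in> {1..N}" and g: "spin_free v g" and ab: "a \<noteq> v" "b \<noteq> v"
  shows "(\<Sum>\<sigma>\<in>configs N. g \<sigma> * ((1 + y * \<sigma> a * \<sigma> v) * (1 + t * \<sigma> v * \<sigma> b)))
       = (\<Sum>\<sigma>\<in>configs N. g \<sigma> * (1 + y * t * \<sigma> a * \<sigma> b))"
proof -
  define h where "h \<sigma> = g \<sigma> * (y * \<sigma> a + t * \<sigma> b)" for \<sigma>
  have h: "spin_free v h"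
    using g ab by (simp add: spin_free_def h_def)
  have "g \<sigma> * ((1 + y * \<sigma> a * \<sigma> v) * (1 + t * \<sigma> v * \<sigma> b)) = g \<sigma> * (1 + y * t * \<sigma> a * \<sigma> b) + h \<sigma> * \<sigma> v"
    if "\<sigma> \<in> configs N" for \<sigma>
  proof -
    have "g \<sigma> * ((1 + y * \<sigma> a * \<sigma> v) * (1 + t * \<sigma> v * \<sigma> b))
        = g \<sigma> * (1 + y * t * \<sigma> a * \<sigma> b * (\<sigma> v * \<sigma> v)) + h \<sigma> * \<sigma> v"
      by (simp add: h_def algebra_simps)
    then show ?thesis using configs_spin_sq[OF that v] by simp
  qed
  then have "(\<Sum>\<sigma>\<in>configs N. g \<sigma> * ((1 + y * \<sigma> a * \<sigma> v) * (1 + t * \<sigma> v * \<sigma> b)))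
      = (\<Sum>\<sigma>\<in>configs N. g \<sigma> * (1 + y * t * \<sigma> a * \<sigma> b) + h \<sigma> * \<sigma> v)"
    by (rule sum.cong[OF refl])
  then show ?thesis
    by (simp add: sum.distrib sum_configs_free_spin[OF v h])
qed

text \<open>\<open>u\<close> is the starting site and \<open>vs\<close> lists the sites reached, so
  \<open>butlast vs\<close> is the interior and \<open>last vs\<close> the far end. The two lists
  are meant to have equal length; the second equation truncates otherwise.\<close>

fun chain_bonds :: "nat \<Rightarrow> real list \<Rightarrow> nat list \<Rightarrow> bond list" where
  "chain_bonds u (J # Js) (v # vs) = (J, u, v) # chain_bonds v Js vs"
| "chain_bonds u _ _ = []"

definition bond_factor :: "real \<Rightarrow> bond list \<Rightarrow> config \<Rightarrow> real" where
  "bond_factor t ys \<sigma> = (\<Prod>(J, i, j)\<leftarrow>ys. 1 + t * J * \<sigma> i * \<sigma> j)"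

lemma bond_factor_simps [simp]:
  "bond_factor t [] \<sigma> = 1"
  "bond_factor t ((J, i, j) # ys) \<sigma> = (1 + t * J * \<sigma> i * \<sigma> j) * bond_factor t ys \<sigma>"
  by (simp_all add: bond_factor_def)

lemma spin_free_bond_factor_chain:
  assumes "x \<noteq> u" "x \<notin> set vs"
  shows "spin_free x (bond_factor t (chain_bonds u Js vs))"
  using assms
proof (induction u Js vs rule: chain_bonds.induct)
  case (1 u J Js v vs)
  then have "spin_free x (bond_factor t (chain_bonds v Js vs))" by simp
  with 1 show ?case by (auto simp: spin_free_def)
qed (auto simp: spin_free_def)

text \<open>The form suited to induction: the site \<open>u\<close> is itself to be summed out and
  is already tied to a fixed outer site \<open>a\<close> by an effective bond of strength
  \<open>y\<close>. Each step removes \<open>u\<close> and multiplies \<open>y\<close> by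
  \<open>t\<close> and the sign of the next bond.\<close>

lemma sum_configs_trace_chain_aux:
  assumes "length Js = length vs"
    and "distinct (butlast (u # vs))" "set (butlast (u # vs)) \<subseteq> {1..N}"
    and "\<And>x. x \<in> set (butlast (u # vs)) \<Longrightarrow> spin_free x g"
    and "a \<notin> set (butlast (u # vs))" "last (u # vs) \<notin> set (butlast (u # vs))"
  shows "(\<Sum>\<sigma>\<in>configs N. g \<sigma> * ((1 + y * \<sigma> a * \<sigma> u) * bond_factor t (chain_bonds u Js vs) \<sigma>))
       = (\<Sum>\<sigma>\<in>configs N. g \<sigma> * (1 + y * t ^ length vs * prod_list Js * \<sigma> a * \<sigma> (last (u # vs))))"
  using assms
proof (induction Js vs arbitrary: u y rule: list_induct2)
  case Nil
  then show ?case by simp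
next
  case (Cons J Js v vs)
  let ?h = "\<lambda>\<sigma>. g \<sigma> * bond_factor t (chain_bonds v Js vs) \<sigma>"
  have bl: "butlast (u # v # vs) = u # butlast (v # vs)" by simp
  have u: "u \<notin> set (butlast (v # vs))" "u \<noteq> last (v # vs)" using Cons.prems unfolding bl by auto
  then have uv: "u \<notin> set (v # vs)"
    using append_butlast_last_id[of "v # vs"] by (metis Un_iff empty_iff insert_iff list.distinct(1) list.set(1,2) set_append)
  have h: "spin_free u ?h"
    using Cons.prems(3)[of u] uv by (intro spin_free_mult spin_free_bond_factor_chain) auto
  have au: "a \<noteq> u" "v \<noteq> u" "u \<in> {1..N}" using Cons.prems uv by auto
  have "(\<Sum>\<sigma>\<in>configs N. g \<sigma> * ((1 + y * \<sigma> a * \<sigma> u) * bond_factor t (chain_bonds u (J # Js) (v # vs)) \<sigma>))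
     = (\<Sum>\<sigma>\<in>configs N. ?h \<sigma> * ((1 + y * \<sigma> a * \<sigma> u) * (1 + (t * J) * \<sigma> u * \<sigma> v)))"
    by (simp add: mult_ac)
  also have "\<dots> = (\<Sum>\<sigma>\<in>configs N. ?h \<sigma> * (1 + y * (t * J) * \<sigma> a * \<sigma> v))"
    by (rule sum_configs_trace_spin[OF au(3) h au(1,2)])
  also have "\<dots> = (\<Sum>\<sigma>\<in>configs N. g \<sigma> * ((1 + (y * (t * J)) * \<sigma> a * \<sigma> v) * bond_factor t (chain_bonds v Js vs) \<sigma>))"
    by (simp add: mult_ac)
  also have "\<dots> = (\<Sum>\<sigma>\<in>configs N. g \<sigma> * (1 + (y * (t * J)) * t ^ length vs * prod_list Js * \<sigma> a * \<sigma> (last (v # vs))))"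
    by (rule Cons.IH) (use Cons.prems bl in auto)
  also have "\<dots> = (\<Sum>\<sigma>\<in>configs N. g \<sigma> * (1 + y * t ^ length (v # vs) * prod_list (J # Js) * \<sigma> a * \<sigma> (last (u # v # vs))))"
    by (simp add: mult_ac)
  finally show ?case .
qed

lemma sum_configs_trace_chain:
  assumes "length Js = length vs" "vs \<noteq> []"
    and "distinct (butlast vs)" "set (butlast vs) \<subseteq> {1..N}"
    and "\<And>x. x \<in> set (butlast vs) \<Longrightarrow> spin_free x g"
    and "u \<notin> set (butlast vs)" "last vs \<notin> set (butlast vs)"
  shows "(\<Sum>\<sigma>\<in>configs N. g \<sigma> * bond_factor t (chain_bonds u Js vs) \<sigma>)
       = (\<Sum>\<sigma>\<in>configs N. g \<sigma> * (1 + t ^ length vs * prod_list Js * \<sigma> u * \<sigma> (last vs)))"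
proof -
  obtain v vs' where vs: "vs = v # vs'" using assms(2) by (cases vs) auto
  then obtain J Js' where Js: "Js = J # Js'" using assms(1) by (cases Js) auto
  have "(\<Sum>\<sigma>\<in>configs N. g \<sigma> * bond_factor t (chain_bonds u Js vs) \<sigma>)
     = (\<Sum>\<sigma>\<in>configs N. g \<sigma> * ((1 + (t * J) * \<sigma> u * \<sigma> v) * bond_factor t (chain_bonds v Js' vs') \<sigma>))"
    by (simp add: vs Js mult_ac)
  also have "\<dots> = (\<Sum>\<sigma>\<in>configs N. g \<sigma> * (1 + (t * J) * t ^ length vs' * prod_list Js' * \<sigma> u * \<sigma> (last (v # vs'))))"
    by (rule sum_configs_trace_chain_aux) (use assms vs Js in auto)
  finally show ?thesis by (simp add: vs Js mult_ac)
qed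

section \<open>Boltzmann weights of bond lists and of chains\<close>

definition energy :: "bond list \<Rightarrow> config \<Rightarrow> real" where
  "energy xs \<sigma> = (\<Sum>(J, i, j)\<leftarrow>xs. J * \<sigma> i * \<sigma> j)"

lemma energy_append: "energy (xs @ ys) \<sigma> = energy xs \<sigma> + energy ys \<sigma>"
  by (simp add: energy_def)

definition bond_space :: "nat \<Rightarrow> bond set" where
  "bond_space N = {-1, 1} \<times> {1..N} \<times> {1..N}"

abbreviation bond_lists :: "nat \<Rightarrow> nat \<Rightarrow> bond list set" where
  "bond_lists N n \<equiv> lists_of (bond_space N) n"

lemma finite_bond_space [simp]: "finite (bond_space N)"
  by (simp add: bond_space_def)

lemma bond_space_nonempty: "N \<noteq> 0 \<Longrightarrow> bond_space N \<noteq> {}"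
  by (auto simp: bond_space_def)

lemma card_bond_space: "card (bond_space N) = 2 * N\<^sup>2"
  by (simp add: bond_space_def card_cartesian_product power2_eq_square)

text \<open>The high temperature identity: exp (\<beta> x) = cosh \<beta> (1 + x tanh \<beta>)
  whenever x is 1 or -1, applied to every bond.\<close>

lemma exp_energy_eq_bond_factor:
  assumes "set ys \<subseteq> bond_space N" "\<sigma> \<in> configs N"
  shows "exp (\<beta> * energy ys \<sigma>) = cosh \<beta> ^ length ys * bond_factor (tanh \<beta>) ys \<sigma>"
  using assms(1)
proof (induction ys)
  case (Cons e ys)
  obtain J i j where e: "e = (J, i, j)" by (cases e) auto
  have J: "J = -1 \<or> J = 1" and ij: "i \<in> {1..N}" "j \<in> {1..N}"
    using Cons.prems by (auto simp: e bond_space_def)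
  have s: "J * \<sigma> i * \<sigma> j = -1 \<or> J * \<sigma> i * \<sigma> j = 1"
    using J configs_spin[OF assms(2) ij(1)] configs_spin[OF assms(2) ij(2)] by auto
  have c: "cosh \<beta> > 0" by simp
  have "exp (\<beta> * x) = cosh \<beta> * (1 + tanh \<beta> * x)" if "x = -1 \<or> x = 1" for x :: real
    using that c by (auto simp: tanh_def field_simps sinh_def cosh_def)
  from this[OF s] have "exp (\<beta> * (J * \<sigma> i * \<sigma> j)) = cosh \<beta> * (1 + tanh \<beta> * J * \<sigma> i * \<sigma> j)"
    by (simp add: mult.assoc)
  moreover have "exp (\<beta> * energy (e # ys) \<sigma>) = exp (\<beta> * (J * \<sigma> i * \<sigma> j)) * exp (\<beta> * energy ys \<sigma>)"
    by (simp add: energy_def e distrib_left exp_add)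
  ultimately show ?case
    using Cons by (simp add: e mult_ac)
qed (simp add: energy_def)

lemma length_chain_bonds: "length Js = length vs \<Longrightarrow> length (chain_bonds u Js vs) = length vs"
  by (induction u Js vs rule: chain_bonds.induct) auto

lemma nth_chain_bonds:
  "length Js = length vs \<Longrightarrow> l < length vs \<Longrightarrow> chain_bonds u Js vs ! l = (Js ! l, (u # vs) ! l, vs ! l)"
proof (induction u Js vs arbitrary: l rule: chain_bonds.induct)
  case (1 u J Js v vs)
  then show ?case by (cases l) auto
qed auto

lemma set_chain_bonds:
  assumes "length Js = length vs" "set Js \<subseteq> {-1, 1}" "u \<in> {1..N}" "set vs \<subseteq> {1..N}"
  shows "set (chain_bonds u Js vs) \<subseteq> bond_space N"
  using assms by (induction u Js vs rule: chain_bonds.induct) (auto simp: bond_space_def)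

text \<open>The interior is summed out both in the numerator, with the observable \<open>f\<close>,
  and in the normalisation, with the constant 1; the powers of cosh \<beta> cancel. This is why
  \<open>f\<close> must be free of the interior spins.\<close>

lemma gibbs_mean_chain:
  assumes Js: "length Js = length vs" "set Js \<subseteq> {-1, 1}" and vs: "vs \<noteq> []" "u \<in> {1..N}" "set vs \<subseteq> {1..N}"
    and "distinct (butlast vs)" "u \<notin> set (butlast vs)" "last vs \<notin> set (butlast vs)"
    and w: "\<And>x. x \<in> set (butlast vs) \<Longrightarrow> spin_free x w"
    and f: "\<And>x. x \<in> set (butlast vs) \<Longrightarrow> spin_free x f"
  shows "gibbs_mean N (\<lambda>\<sigma>. w \<sigma> * exp (\<beta> * energy (chain_bonds u Js vs) \<sigma>)) f
       = gibbs_mean N (\<lambda>\<sigma>. w \<sigma> * (1 + tanh \<beta> ^ length vs * prod_list Js * \<sigma> u * \<sigma> (last vs))) f"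
proof -
  have sub: "set (butlast vs) \<subseteq> {1..N}" using vs(3) in_set_butlastD by fastforce
  define C where "C = cosh \<beta> ^ length vs"
  have C: "C > 0" by (simp add: C_def)
  have *: "(\<Sum>\<sigma>\<in>configs N. w \<sigma> * exp (\<beta> * energy (chain_bonds u Js vs) \<sigma>) * h \<sigma>)
      = C * (\<Sum>\<sigma>\<in>configs N. w \<sigma> * (1 + tanh \<beta> ^ length vs * prod_list Js * \<sigma> u * \<sigma> (last vs)) * h \<sigma>)"
    if h: "\<And>x. x \<in> set (butlast vs) \<Longrightarrow> spin_free x h" for h
  proof -
    have "(\<Sum>\<sigma>\<in>configs N. w \<sigma> * exp (\<beta> * energy (chain_bonds u Js vs) \<sigma>) * h \<sigma>)
      = (\<Sum>\<sigma>\<in>configs N. C * ((w \<sigma> * h \<sigma>) * bond_factor (tanh \<beta>) (chain_bonds u Js vs) \<sigma>))"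
      using exp_energy_eq_bond_factor[OF set_chain_bonds[OF Js vs(2,3)], of _ \<beta>]
      by (intro sum.cong refl) (simp add: C_def length_chain_bonds[OF Js(1)] mult_ac)
    also have "\<dots> = C * (\<Sum>\<sigma>\<in>configs N. (w \<sigma> * h \<sigma>) * (1 + tanh \<beta> ^ length vs * prod_list Js * \<sigma> u * \<sigma> (last vs)))"
      unfolding sum_distrib_left[symmetric]
      by (subst sum_configs_trace_chain) (use assms sub h in \<open>auto intro: spin_free_mult\<close>)
    finally show ?thesis by (simp add: mult_ac)
  qed
  show ?thesis
    using *[OF f] *[of "\<lambda>_. 1"] C by (simp add: gibbs_mean_def)
qed

lemma abs_gibbs_mean_le:
  assumes "\<And>\<sigma>. \<sigma> \<in> configs N \<Longrightarrow> 0 \<le> w \<sigma>" "\<And>\<sigma>. \<sigma> \<in> configs N \<Longrightarrow> \<bar>f \<sigma>\<bar> \<le> 1"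
  shows "\<bar>gibbs_mean N w f\<bar> \<le> 1"
proof -
  have "\<bar>\<Sum>\<sigma>\<in>configs N. w \<sigma> * f \<sigma>\<bar> \<le> (\<Sum>\<sigma>\<in>configs N. \<bar>w \<sigma> * f \<sigma>\<bar>)" by (rule sum_abs)
  also have "\<dots> \<le> (\<Sum>\<sigma>\<in>configs N. w \<sigma>)"
    using assms by (intro sum_mono) (auto simp: abs_mult intro!: mult_left_le)
  finally have le: "\<bar>\<Sum>\<sigma>\<in>configs N. w \<sigma> * f \<sigma>\<bar> \<le> (\<Sum>\<sigma>\<in>configs N. w \<sigma>)" .
  have "0 \<le> (\<Sum>\<sigma>\<in>configs N. w \<sigma>)" using assms by (intro sum_nonneg) auto
  with le show ?thesis
    unfolding gibbs_mean_def abs_divide by (intro divide_le_eq_1[THEN iffD2]) auto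
qed

text \<open>Isolation expressed through the visited sites. Only the interior is constrained: the two
  ends may coincide, lie in \<open>B\<close> or meet bonds of \<open>zs\<close>, and so are
  asymptotically independent and uniform.\<close>

definition good_path :: "nat set \<Rightarrow> bond list \<Rightarrow> nat \<Rightarrow> nat list \<Rightarrow> bool" where
  "good_path B zs u vs \<longleftrightarrow> distinct (butlast vs) \<and>
     (\<forall>v\<in>set (butlast vs). v \<noteq> u \<and> v \<noteq> last vs \<and> v \<notin> B \<and> (\<forall>e\<in>set zs. \<not> touches v e))"

text \<open>With \<open>m \<ge> 1\<close> there is an interior site, and then the conditions on the
  path already exclude loops, including one at the first bond.\<close>

lemma isolated_chain_chain_bonds:
  assumes len: "length Js = Suc m" "length vs = Suc m" and "m \<ge> 1"
  shows "isolated_chain B (chain_bonds u Js vs @ zs) [0..<Suc m] \<longleftrightarrow> good_path B zs u vs"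
    (is "?iso \<longleftrightarrow> ?good")
proof -
  let ?c = "chain_bonds u Js vs"
  let ?xs = "?c @ zs"
  have lc: "length ?c = Suc m" using len by (simp add: length_chain_bonds)
  have nc: "?xs ! l = (Js ! l, (u # vs) ! l, vs ! l)" if "l < Suc m" for l
    using that len lc by (simp add: nth_append nth_chain_bonds)
  have bl: "butlast vs ! l = vs ! l" if "l < m" for l
    using that len by (simp add: nth_butlast)
  have la: "last vs = vs ! m" using len by (cases vs) (auto simp: last_conv_nth)
  have sbl: "v \<in> set (butlast vs) \<longleftrightarrow> (\<exists>l<m. v = vs ! l)" for v
    using bl len by (auto simp: in_set_conv_nth)
  show ?thesis
  proof
    assume iso: ?iso
    have I1: "src (?xs ! l) \<noteq> tgt (?xs ! l)" if "l < Suc m" for l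
      using iso that unfolding isolated_chain_def by (auto simp del: upt_Suc)
    have I2: "tgt (?xs ! l) \<notin> B \<and> (\<forall>j<length ?xs. touches (tgt (?xs ! l)) (?xs ! j) \<longrightarrow> j = l \<or> j = Suc l)"
      if "l < m" for l
    proof -
      have e: "[0..<Suc m] ! l = l" "[0..<Suc m] ! Suc l = Suc l" "Suc l < length [0..<Suc m]"
        using that by (simp_all del: upt_Suc)
      show ?thesis using iso e unfolding isolated_chain_def by metis
    qed
    have loop: "(u # vs) ! l \<noteq> vs ! l" if "l < Suc m" for l
      using I1[OF that] nc[OF that] by simp
    have B: "vs ! l \<notin> B" and T: "\<And>j. j < length ?xs \<Longrightarrow> touches (vs ! l) (?xs ! j) \<Longrightarrow> j = l \<or> j = Suc l"
      if "l < m" for l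
      using I2[OF that] nc[of l] that by simp_all
    \<comment> \<open>A repeated site would put bond \<open>j\<close> at the interior site
      \<open>vs ! l\<close>, so \<open>j\<close> is \<open>l\<close> or \<open>Suc l\<close>; in the
      second case bond \<open>Suc l\<close> would start and end at the same site.\<close>
    have D: "j = l" if "l < m" "j < Suc m" "vs ! l = vs ! j" for l j
    proof -
      have "touches (vs ! l) (?xs ! j)" using nc[of j] that by (simp add: touches_def)
      then have "j = l \<or> j = Suc l" using T[of l j] that lc by simp
      then show ?thesis using loop[of j] that by auto
    qed
    have U: "vs ! l \<noteq> u" if "l < m" for l
    proof
      assume "vs ! l = u"
      then have "touches (vs ! l) (?xs ! 0)" using nc[of 0] by (simp add: touches_def)
      then have "l = 0" using T[of l 0] that lc by simp
      then show False using loop[of 0] \<open>vs ! l = u\<close> by simp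
    qed
    have Z: "\<not> touches (vs ! l) e" if "l < m" "e \<in> set zs" for l e
    proof
      assume t: "touches (vs ! l) e"
      obtain j where j: "j < length zs" "zs ! j = e" using \<open>e \<in> set zs\<close> by (auto simp: in_set_conv_nth)
      then have "?xs ! (Suc m + j) = e" using lc by (simp add: nth_append)
      then show False using T[OF that(1), of "Suc m + j"] t j lc that(1) by auto
    qed
    have "distinct (butlast vs)"
      using D len bl by (simp add: distinct_conv_nth) (metis less_SucI)
    moreover have "v \<noteq> last vs" if "v \<in> set (butlast vs)" for v
      using that D[of _ m] la unfolding sbl by auto
    ultimately show ?good
      unfolding good_path_def
    proof (intro conjI ballI)
      fix v assume "v \<in> set (butlast vs)"
      then obtain l where l: "l < m" "v = vs ! l" unfolding sbl by blast
      show "v \<noteq> u" "v \<notin> B" using l U B by simp_all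
      fix e assume "e \<in> set zs"
      then show "\<not> touches v e" using Z l by simp
    qed
  next
    assume good: ?good
    have mem: "vs ! l \<in> set (butlast vs)" if "l < m" for l
      unfolding sbl using that by (intro exI[of _ l]) simp
    have G: "v \<noteq> u" "v \<noteq> last vs" "v \<notin> B" "\<And>e. e \<in> set zs \<Longrightarrow> \<not> touches v e"
      if "v \<in> set (butlast vs)" for v
      using good that unfolding good_path_def by simp_all
    have D: "j = l" if "l < m" "j < Suc m" "vs ! l = vs ! j" for l j
    proof (cases "j = m")
      case True
      then show ?thesis using G(2)[OF mem[OF that(1)]] that(3) la by simp
    next
      case False
      then have "butlast vs ! l = butlast vs ! j" "j < length (butlast vs)" "l < length (butlast vs)"
        using that bl len by auto
      moreover have "distinct (butlast vs)" using good unfolding good_path_def by simp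
      ultimately show ?thesis by (simp add: nth_eq_iff_index_eq)
    qed
    have U: "vs ! l \<noteq> u" "vs ! l \<notin> B" "\<And>e. e \<in> set zs \<Longrightarrow> \<not> touches (vs ! l) e" if "l < m" for l
      using G(1,3,4)[OF mem[OF that]] by simp_all
    have loop: "(u # vs) ! l \<noteq> vs ! l" if "l < Suc m" for l
    proof (cases l)
      case 0
      then show ?thesis using U(1)[of 0] \<open>m \<ge> 1\<close> by auto
    next
      case (Suc k)
      then show ?thesis using D[of k l] that by auto
    qed
    have T: "j = l \<or> j = Suc l" if l: "l < m" and j: "j < length ?xs" "touches (vs ! l) (?xs ! j)" for l j
    proof (cases "j < Suc m")
      case True
      then have "vs ! l = (u # vs) ! j \<or> vs ! l = vs ! j"
        using j(2) nc[OF True] by (simp add: touches_def)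
      then show ?thesis
      proof
        assume h: "vs ! l = (u # vs) ! j"
        then obtain k where "j = Suc k" using U(1)[OF l] by (cases j) auto
        then show ?thesis using h D[OF l, of k] True by simp
      next
        assume "vs ! l = vs ! j"
        then show ?thesis using D[OF l True] by simp
      qed
    next
      case False
      then have "?xs ! j \<in> set zs" using j(1) lc by (auto simp: nth_append)
      then show ?thesis using U(3)[OF l] j(2) by blast
    qed
    show ?iso
      unfolding isolated_chain_def
    proof (intro conjI ballI allI impI)
      fix i assume "i \<in> set [0..<Suc m]"
      then have "i < Suc m" by (simp del: upt_Suc)
      then show "src (?xs ! i) \<noteq> tgt (?xs ! i)"
        using loop nc by simp
    next
      fix l assume "Suc l < length [0..<Suc m]"
      then have l: "l < m" by (simp del: upt_Suc)
      have e: "[0..<Suc m] ! l = l" "[0..<Suc m] ! Suc l = Suc l"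
        using l by (simp_all del: upt_Suc)
      show "src (?xs ! ([0..<Suc m] ! Suc l)) = tgt (?xs ! ([0..<Suc m] ! l))"
        "tgt (?xs ! ([0..<Suc m] ! l)) \<notin> B"
        unfolding e using nc[of l] nc[of "Suc l"] l U(2) by simp_all
      fix j assume "j < length ?xs" "touches (tgt (?xs ! ([0..<Suc m] ! l))) (?xs ! j)"
      then show "j = [0..<Suc m] ! l \<or> j = [0..<Suc m] ! Suc l"
        unfolding e using nc[of l] l T[OF l] by simp
    qed
  qed
qed

lemma isolated_chain_imp_chain_bonds:
  assumes "length ys = Suc m" and iso: "isolated_chain B (ys @ zs) [0..<Suc m]"
  shows "ys = chain_bonds (src (ys ! 0)) (map fst ys) (map tgt ys)"
proof (rule nth_equalityI)
  show "length ys = length (chain_bonds (src (ys ! 0)) (map fst ys) (map tgt ys))"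
    by (simp add: length_chain_bonds)
  fix l assume l: "l < length ys"
  have "src (ys ! l) = (src (ys ! 0) # map tgt ys) ! l"
  proof (cases l)
    case (Suc k)
    then have "src ((ys @ zs) ! ([0..<Suc m] ! Suc k)) = tgt ((ys @ zs) ! ([0..<Suc m] ! k))"
      using iso l assms(1) unfolding isolated_chain_def by (simp del: upt_Suc)
    then show ?thesis using Suc l assms(1) by (simp add: nth_append del: upt_Suc)
  qed simp
  then show "ys ! l = chain_bonds (src (ys ! 0)) (map fst ys) (map tgt ys) ! l"
    using l by (simp add: nth_chain_bonds prod_eq_iff)
qed

lemma map_fst_chain_bonds:
  "length Js = length vs \<Longrightarrow> map fst (chain_bonds u Js vs) = Js"
  "length Js = length vs \<Longrightarrow> map tgt (chain_bonds u Js vs) = vs"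
  by (induction u Js vs rule: chain_bonds.induct) auto

text \<open>An isolated chain is the same as its signs together with a good path. A list of
  \<open>Suc m\<close> bonds has 2 m + 2 site entries but a path only m + 2, and the difference is
  the factor \<open>real N ^ m\<close> in the denominator.\<close>

lemma avg_isolated_chain:
  assumes N: "N > 0" and m: "m \<ge> 1"
  shows "avg (bond_lists N (Suc m)) (\<lambda>ys. of_bool (isolated_chain B (ys @ zs) [0..<Suc m]) * G ys)
    = avg (lists_of {-1, 1} (Suc m)) (\<lambda>Js. avg {1..N} (\<lambda>u. avg (lists_of {1..N} (Suc m)) (\<lambda>vs.
        of_bool (good_path B zs u vs) * G (chain_bonds u Js vs)))) / real N ^ m"
proof -
  let ?L = "bond_lists N (Suc m)"
  let ?J = "lists_of {-1, 1 :: real} (Suc m)" and ?V = "lists_of {1..N} (Suc m)"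
  let ?iso = "\<lambda>ys. isolated_chain B (ys @ zs) [0..<Suc m]"
  let ?P = "{p \<in> ?J \<times> {1..N} \<times> ?V. case p of (Js, u, vs) \<Rightarrow> good_path B zs u vs}"
  have "(\<Sum>ys\<in>?L. of_bool (?iso ys) * G ys) = (\<Sum>ys\<in>{ys\<in>?L. ?iso ys}. G ys)"
    by (rule sum.mono_neutral_cong_right) auto
  also have "\<dots> = (\<Sum>p\<in>?P. case p of (Js, u, vs) \<Rightarrow> G (chain_bonds u Js vs))"
  proof (rule sum.reindex_bij_witness[where
      i = "\<lambda>(Js, u, vs). chain_bonds u Js vs" and
      j = "\<lambda>ys. (map fst ys, src (ys ! 0), map tgt ys)"])
    fix ys assume ys: "ys \<in> {ys\<in>?L. ?iso ys}"
    then have len: "length ys = Suc m" and sub: "set ys \<subseteq> bond_space N"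
      and iso: "?iso ys" by (auto simp: lists_of_def simp del: upt_Suc)
    have eq: "chain_bonds (src (ys ! 0)) (map fst ys) (map tgt ys) = ys"
      by (rule isolated_chain_imp_chain_bonds[OF len iso, symmetric])
    then show "(case (map fst ys, src (ys ! 0), map tgt ys) of
        (Js, u, vs) \<Rightarrow> chain_bonds u Js vs) = ys" by simp
    have "good_path B zs (src (ys ! 0)) (map tgt ys)"
      using isolated_chain_chain_bonds[of "map fst ys" m "map tgt ys" B
          "src (ys ! 0)" zs] iso len m unfolding eq by (simp del: upt_Suc)
    moreover have "ys ! 0 \<in> set ys" using len by simp
    then have "ys ! 0 \<in> bond_space N" using sub by blast
    ultimately show "(map fst ys, src (ys ! 0), map tgt ys) \<in> ?P"
      using sub len by (auto simp: lists_of_def bond_space_def)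
    show "(case (map fst ys, src (ys ! 0), map tgt ys) of
        (Js, u, vs) \<Rightarrow> G (chain_bonds u Js vs)) = G ys" using eq by simp
  next
    fix p assume p: "p \<in> ?P"
    obtain Js u vs where [simp]: "p = (Js, u, vs)" by (cases p) auto
    have h: "length Js = Suc m" "length vs = Suc m" "set Js \<subseteq> {-1, 1}" "u \<in> {1..N}" "set vs \<subseteq> {1..N}"
      "good_path B zs u vs"
      using p by (auto simp: lists_of_def)
    have "chain_bonds u Js vs ! 0 = (Js ! 0, u, vs ! 0)" using h(1,2) by (simp add: nth_chain_bonds)
    then show "(\<lambda>ys. (map fst ys, src (ys ! 0), map tgt ys))
        (case p of (Js, u, vs) \<Rightarrow> chain_bonds u Js vs) = p"
      using h(1,2) by (simp add: map_fst_chain_bonds)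
    show "(case p of (Js, u, vs) \<Rightarrow> chain_bonds u Js vs) \<in> {ys\<in>?L. ?iso ys}"
      using h isolated_chain_chain_bonds[OF h(1,2) m, of B u zs] set_chain_bonds[of Js vs u N]
      by (simp add: lists_of_def length_chain_bonds del: upt_Suc)
  qed
  also have "\<dots> = (\<Sum>p\<in>?J \<times> {1..N} \<times> ?V. case p of (Js, u, vs) \<Rightarrow>
      of_bool (good_path B zs u vs) * G (chain_bonds u Js vs))"
    by (rule sum.mono_neutral_cong_left) auto
  also have "\<dots> = (\<Sum>Js\<in>?J. \<Sum>u\<in>{1..N}. \<Sum>vs\<in>?V. of_bool (good_path B zs u vs) * G (chain_bonds u Js vs))"
    by (simp only: sum.cartesian_product[symmetric])
  finally have S: "(\<Sum>ys\<in>?L. of_bool (?iso ys) * G ys) =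
      (\<Sum>Js\<in>?J. \<Sum>u\<in>{1..N}. \<Sum>vs\<in>?V. of_bool (good_path B zs u vs) * G (chain_bonds u Js vs))" .
  have c: "real (card ?L) = 2 ^ Suc m * real N * real N ^ Suc m * real N ^ m"
    by (simp add: card_lists_of card_bond_space power_mult_distrib power2_eq_square)
  have cJ: "real (card ?J) = 2 ^ Suc m" by (simp add: card_lists_of)
  have cV: "real (card ?V) = real N ^ Suc m" by (simp add: card_lists_of)
  show ?thesis
    unfolding avg_def S c cJ cV by (simp add: sum_divide_distrib[symmetric] field_simps del: power_Suc)
qed

section \<open>Stability under insertion of a chain\<close>

definition free_sites :: "nat \<Rightarrow> bond list \<Rightarrow> nat set" where
  "free_sites N zs = {v \<in> {1..N}. \<forall>e\<in>set zs. \<not> touches v e}"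

definition free_fraction :: "nat \<Rightarrow> bond list \<Rightarrow> real" where
  "free_fraction N zs = avg {1..N} (\<lambda>v. of_bool (\<forall>e\<in>set zs. \<not> touches v e))"

lemma finite_free_sites [simp]: "finite (free_sites N zs)"
  by (simp add: free_sites_def)

lemma free_fraction_eq: "free_fraction N zs = real (card (free_sites N zs)) / real N"
  by (simp add: free_fraction_def free_sites_def avg_def Int_def)

lemma free_fraction_bounds: "0 \<le> free_fraction N zs" "free_fraction N zs \<le> 1"
proof -
  show "0 \<le> free_fraction N zs" unfolding free_fraction_def by (rule avg_nonneg) simp
  have "\<bar>free_fraction N zs\<bar> \<le> 1" unfolding free_fraction_def by (rule abs_avg_le_const) auto
  then show "free_fraction N zs \<le> 1" by simp
qed

lemma abs_power_diff_le:
  fixes a b :: real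
  assumes "\<bar>a\<bar> \<le> 1" "\<bar>b\<bar> \<le> 1"
  shows "\<bar>a ^ m - b ^ m\<bar> \<le> real m * \<bar>a - b\<bar>"
  using norm_power_diff[of a b m] assms by simp

lemma avg_of_bool: "finite A \<Longrightarrow> avg A (\<lambda>x. of_bool (P x)) = real (card {x \<in> A. P x}) / real (card A)"
  by (simp add: avg_def Int_def)

text \<open>Only the ends of the old and of the new bond, at most four sites, can change their
  status.\<close>

lemma free_fraction_update:
  assumes "i < length zs"
  shows "\<bar>free_fraction N (zs[i := e]) - free_fraction N zs\<bar> \<le> 4 / real N"
proof -
  have "\<bar>free_fraction N (zs[i := e]) - free_fraction N zs\<bar>
      \<le> avg {1..N} (\<lambda>v. \<bar>of_bool (\<forall>e\<in>set (zs[i := e]). \<not> touches v e) - of_bool (\<forall>e\<in>set zs. \<not> touches v e)\<bar>)"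
    unfolding free_fraction_def avg_diff[symmetric] by (rule abs_avg_le)
  also have "\<dots> \<le> avg {1..N} (\<lambda>v. of_bool (v \<in> {src e, tgt e, src (zs ! i), tgt (zs ! i)}))"
  proof (rule avg_mono)
    fix v
    let ?z = "{src e, tgt e, src (zs ! i), tgt (zs ! i)}"
    show "\<bar>of_bool (\<forall>e\<in>set (zs[i := e]). \<not> touches v e) - of_bool (\<forall>e\<in>set zs. \<not> touches v e)\<bar>
        \<le> (of_bool (v \<in> ?z) :: real)"
    proof (cases "v \<in> ?z")
      case False
      then have nt: "\<not> touches v e" "\<not> touches v (zs ! i)" by (auto simp: touches_def)
      have "(\<forall>j<length zs. \<not> touches v (zs[i := e] ! j)) \<longleftrightarrow> (\<forall>j<length zs. \<not> touches v (zs ! j))"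
        using nt assms by (metis nth_list_update_eq nth_list_update_neq)
      then have "(\<forall>e\<in>set (zs[i := e]). \<not> touches v e) \<longleftrightarrow> (\<forall>e\<in>set zs. \<not> touches v e)"
        by (metis in_set_conv_nth length_list_update)
      then show ?thesis by simp
    qed auto
  qed
  also have "\<dots> = real (card {v \<in> {1..N}. v \<in> {src e, tgt e, src (zs ! i), tgt (zs ! i)}}) / real N"
    by (subst avg_of_bool) simp_all
  also have "\<dots> \<le> 4 / real N"
  proof (rule divide_right_mono)
    have "card {v \<in> {1..N}. v \<in> {src e, tgt e, src (zs ! i), tgt (zs ! i)}}
        \<le> card (set [src e, tgt e, src (zs ! i), tgt (zs ! i)])"
      by (rule card_mono) auto
    also have "\<dots> \<le> 4" using card_length[of "[src e, tgt e, src (zs ! i), tgt (zs ! i)]"] by simp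
    finally show "real (card {v \<in> {1..N}. v \<in> {src e, tgt e, src (zs ! i), tgt (zs ! i)}}) \<le> 4"
      by simp
  qed simp
  finally show ?thesis .
qed

text \<open>A given site is missed by each of the 2 n independent uniform bond ends with probability
  1 - 1 / N.\<close>

lemma avg_free_fraction:
  assumes "N > 0"
  shows "avg (bond_lists N n) (free_fraction N) = (1 - 1 / real N) ^ (2 * n)"
proof -
  have site: "avg {1..N} (\<lambda>i. of_bool (v \<noteq> i)) = 1 - 1 / real N" if "v \<in> {1..N}" for v
  proof -
    have "(\<Sum>i\<in>{1..N}. of_bool (v \<noteq> i)) = real (card ({1..N} - {v}))"
      by (simp add: Int_def set_diff_eq neq_commute conj_commute)
    also have "\<dots> = real N - 1"
      using that by (simp add: of_nat_diff)
    finally show ?thesis using assms by (simp add: avg_def diff_divide_distrib)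
  qed
  have bond: "avg (bond_space N) (\<lambda>e. of_bool (\<not> touches v e)) = (1 - 1 / real N)\<^sup>2" if "v \<in> {1..N}" for v
  proof -
    have "avg (bond_space N) (\<lambda>e. of_bool (\<not> touches v e))
        = avg {-1, 1 :: real} (\<lambda>_. avg {1..N} (\<lambda>i. avg {1..N} (\<lambda>j. of_bool (v \<noteq> i) * of_bool (v \<noteq> j))))"
    proof -
      have "(of_bool (\<not> touches v (J, i, j)) :: real) = of_bool (v \<noteq> i) * of_bool (v \<noteq> j)" for J i j
        by (simp add: touches_def)
      then show ?thesis
        unfolding bond_space_def by (subst avg_times, simp, simp, subst avg_times) simp_all
    qed
    also have "\<dots> = (1 - 1 / real N)\<^sup>2"
      using site[OF that] by (simp only: avg_cmult avg_multc) (simp add: power2_eq_square)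
    finally show ?thesis .
  qed
  have lists: "avg (bond_lists N n) (\<lambda>zs. of_bool (\<forall>e\<in>set zs. \<not> touches v e)) = ((1 - 1 / real N)\<^sup>2) ^ n"
    if "v \<in> {1..N}" for v
  proof (induction n)
    case 0
    then show ?case by (simp add: avg_def)
  next
    case (Suc n)
    have "avg (bond_lists N (Suc n)) (\<lambda>zs. of_bool (\<forall>e\<in>set zs. \<not> touches v e))
      = avg (bond_space N) (\<lambda>e. of_bool (\<not> touches v e) *
          avg (bond_lists N n) (\<lambda>zs. of_bool (\<forall>e\<in>set zs. \<not> touches v e)))"
      by (simp add: avg_lists_of_Suc avg_cmult[symmetric] of_bool_conj)
    then show ?case unfolding Suc.IH avg_multc bond[OF that] by simp
  qed
  have "avg (bond_lists N n) (free_fraction N)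
      = avg {1..N} (\<lambda>v. avg (bond_lists N n) (\<lambda>zs. of_bool (\<forall>e\<in>set zs. \<not> touches v e)))"
    unfolding free_fraction_def by (rule avg_swap)
  also have "\<dots> = avg {1..N} (\<lambda>v. ((1 - 1 / real N)\<^sup>2) ^ n)"
    by (rule avg_cong[OF refl lists])
  also have "\<dots> = (1 - 1 / real N) ^ (2 * n)"
    using assms by (simp add: power_mult)
  finally show ?thesis .
qed

text \<open>Jensen's inequality for the power; Bernoulli's inequality provides the tangent at the
  mean.\<close>

lemma power_avg_le_avg_power:
  assumes "finite A" "A \<noteq> {}" "\<And>x. x \<in> A \<Longrightarrow> 0 \<le> f x" "0 < avg A f"
  shows "avg A f ^ m \<le> avg A (\<lambda>x. f x ^ m)"
proof -
  define c where "c = avg A f"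
  have c: "c > 0" using assms by (simp add: c_def)
  have "c ^ m + real m * c ^ m / c * (f x - c) \<le> f x ^ m" if "x \<in> A" for x
  proof -
    have "1 + real m * ((f x - c) / c) \<le> (1 + (f x - c) / c) ^ m"
      using assms(3)[OF that] c by (intro Bernoulli_inequality) (simp add: field_simps)
    also have "1 + (f x - c) / c = f x / c" using c by (simp add: field_simps)
    finally have "c ^ m * (1 + real m * ((f x - c) / c)) \<le> c ^ m * (f x / c) ^ m"
      using c by (intro mult_left_mono) auto
    then show ?thesis using c by (simp add: field_simps)
  qed
  then have "avg A (\<lambda>x. c ^ m + real m * c ^ m / c * (f x - c)) \<le> avg A (\<lambda>x. f x ^ m)"
    by (rule avg_mono)
  moreover have "avg A (\<lambda>x. c ^ m + real m * c ^ m / c * (f x - c)) = c ^ m"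
    unfolding avg_add avg_cmult avg_diff using assms(1,2) by (simp add: c_def)
  ultimately show ?thesis by (simp add: c_def)
qed

text \<open>Every factor of the falling factorial is at least \<open>card S - m\<close>. If
  \<open>S\<close> has fewer than \<open>m\<close> elements, the truncated difference makes the left
  side 0.\<close>

lemma card_distinct_lists_ge:
  assumes "finite S"
  shows "(card S - m) ^ m \<le> card {xs. length xs = m \<and> distinct xs \<and> set xs \<subseteq> S}"
proof (cases "m \<le> card S")
  case True
  have "(card S - m) ^ m = (\<Prod>i\<in>{card S - m + 1..card S}. card S - m)"
    using True by simp
  also have "\<dots> \<le> \<Prod>{card S - m + 1..card S}"
    by (rule prod_mono) auto
  finally show ?thesis
    using card_lists_distinct_length_eq[OF assms True] by simp
next
  case False
  then show ?thesis by (cases m) auto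
qed

lemma card_index_tuples_ge: "n ^ K \<le> card (index_tuples K (K + n))"
  using card_distinct_lists_ge[of "{..<K + n}" K] by (simp add: index_tuples_def)

text \<open>A good interior is a list of distinct free sites outside \<open>B\<close> and different
  from the ends. With f free sites there are at most f^m such lists and at least (f - (2 + T +
  m))^m: two sites are lost to the ends, at most \<open>T\<close> to \<open>B\<close>, and
  \<open>m\<close> to distinctness.\<close>

lemma avg_good_path:
  assumes N: "N > 0" and B: "finite B" "card B \<le> T" and uv: "u \<in> {1..N}" "v \<in> {1..N}"
  shows "\<bar>avg (lists_of {1..N} m) (\<lambda>is. of_bool (good_path B zs u (is @ [v]))) - free_fraction N zs ^ m\<bar>
    \<le> real m * (real (2 + T + m) / real N)"
proof -
  define f where "f = card (free_sites N zs)"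
  define S where "S = free_sites N zs - ({u, v} \<union> B)"
  define G where "G = {is. length is = m \<and> distinct is \<and> set is \<subseteq> S}"
  have good: "good_path B zs u (is @ [v]) \<longleftrightarrow> distinct is \<and> set is \<subseteq> S"
    if "is \<in> lists_of {1..N} m" for "is"
    using that by (auto simp: good_path_def S_def free_sites_def lists_of_def)
  have GS: "G \<subseteq> lists_of {1..N} m" by (auto simp: G_def S_def free_sites_def lists_of_def)
  have "(\<Sum>is\<in>lists_of {1..N} m. of_bool (good_path B zs u (is @ [v]))) = (\<Sum>is\<in>G. 1 :: real)"
  proof (rule sum.mono_neutral_cong_right[OF _ GS])
    show "\<forall>is\<in>lists_of {1..N} m - G. of_bool (good_path B zs u (is @ [v])) = (0 :: real)"
      using good by (auto simp: G_def lists_of_def)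
    show "of_bool (good_path B zs u (is @ [v])) = (1 :: real)" if "is \<in> G" for "is"
      using good[of "is"] that GS by (auto simp: G_def)
  qed simp
  then have w: "avg (lists_of {1..N} m) (\<lambda>is. of_bool (good_path B zs u (is @ [v]))) = real (card G) / real N ^ m"
    by (simp add: avg_def card_lists_of)
  have fS: "finite S" by (simp add: S_def)
  have "card S \<ge> f - card ({u, v} \<union> B)"
    unfolding S_def f_def using B by (intro diff_card_le_card_Diff) auto
  moreover have "card ({u, v} \<union> B) \<le> 2 + T"
    using card_Un_le[of "{u, v}" B] card_insert_le_m1[of 2 "{v}" u] B by simp
  ultimately have cS: "f - (2 + T + m) \<le> card S - m" by simp
  have "(f - (2 + T + m)) ^ m \<le> (card S - m) ^ m" using cS by (rule power_mono) simp
  also have "\<dots> \<le> card G" unfolding G_def using fS by (rule card_distinct_lists_ge)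
  finally have lower: "(f - (2 + T + m)) ^ m \<le> card G" .
  have upper: "card G \<le> f ^ m"
  proof -
    have "card G \<le> card (lists_of (free_sites N zs) m)"
    proof (rule card_mono)
      show "finite (lists_of (free_sites N zs) m)" by simp
    qed (auto simp: G_def S_def lists_of_def)
    then show ?thesis by (simp add: card_lists_of f_def)
  qed
  have fN: "f \<le> N"
  proof -
    have "free_sites N zs \<subseteq> {1..N}" by (auto simp: free_sites_def)
    from card_mono[OF _ this] show ?thesis by (simp add: f_def)
  qed
  let ?a = "real f / real N" and ?b = "real (f - (2 + T + m)) / real N"
  have "real (card G) / real N ^ m \<le> ?a ^ m"
    using upper by (simp add: power_divide divide_right_mono flip: of_nat_power)
  moreover have "?b ^ m \<le> real (card G) / real N ^ m"
    using lower by (simp add: power_divide divide_right_mono flip: of_nat_power)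
  moreover have "?a ^ m - ?b ^ m \<le> real m * (real (2 + T + m) / real N)"
  proof -
    have "\<bar>?a ^ m - ?b ^ m\<bar> \<le> real m * \<bar>?a - ?b\<bar>"
      using N fN by (intro abs_power_diff_le) auto
    also have "\<bar>?a - ?b\<bar> \<le> real (2 + T + m) / real N"
    proof -
      have "\<bar>real f - real (f - (2 + T + m))\<bar> / real N \<le> real (2 + T + m) / real N"
        by (rule divide_right_mono) auto
      then show ?thesis by (simp add: diff_divide_distrib[symmetric] abs_divide)
    qed
    finally show ?thesis by (simp add: mult_left_mono)
  qed
  moreover have "free_fraction N zs ^ m = ?a ^ m" by (simp add: free_fraction_eq f_def)
  ultimately show ?thesis unfolding w by linarith
qed

text \<open>A product of independent uniform signs is again a uniform sign.\<close>

lemma avg_signs_prod_list: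
  "avg (lists_of {-1, 1 :: real} (Suc m)) (\<lambda>Js. g (prod_list Js)) = avg {-1, 1} g"
proof (induction m arbitrary: g)
  case 0
  show ?case by (subst avg_lists_of_Suc) (simp_all add: avg_def)
next
  case (Suc m)
  have "avg (lists_of {-1, 1 :: real} (Suc (Suc m))) (\<lambda>Js. g (prod_list Js))
      = avg {-1, 1} (\<lambda>J. avg (lists_of {-1, 1} (Suc m)) (\<lambda>Js. g (J * prod_list Js)))"
    by (subst avg_lists_of_Suc) simp_all
  also have "\<dots> = avg {-1, 1} (\<lambda>J. avg {-1, 1} (\<lambda>J'. g (J * J')))"
    by (simp only: Suc.IH[of "\<lambda>x. g (_ * x)"])
  also have "\<dots> = avg {-1, 1} g"
    by (simp add: avg_def field_simps)
  finally show ?case .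
qed

lemma avg_lists_of_snoc:
  assumes "finite A"
  shows "avg (lists_of A (Suc m)) f = avg (lists_of A m) (\<lambda>xs. avg A (\<lambda>x. f (xs @ [x])))"
proof -
  have "avg (lists_of A (Suc m)) f = avg (lists_of A m) (\<lambda>xs. avg (lists_of A (Suc 0)) (\<lambda>zs. f (xs @ zs)))"
    using avg_lists_of_add[OF assms, of m "Suc 0" f] by simp
  also have "\<dots> = avg (lists_of A m) (\<lambda>xs. avg A (\<lambda>x. f (xs @ [x])))"
    using assms by (subst avg_lists_of_Suc) (simp_all add: avg_def)
  finally show "avg (lists_of A (Suc m)) f = avg (lists_of A m) (\<lambda>xs. avg A (\<lambda>x. f (xs @ [x])))" .
qed

text \<open>Attaching an isolated chain of \<open>Suc m\<close> bonds amounts, after summing out its interior, to a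
  single effective bond with product sign and uniformly distributed end points.\<close>

lemma avg_isolated_chain_effective:
  fixes F :: "bond list \<Rightarrow> real" and Feff :: "real \<Rightarrow> nat \<Rightarrow> nat \<Rightarrow> real"
  assumes N: "N > 0" and m: "m \<ge> 1" and B: "finite B" "card B \<le> T" and "0 \<le> \<epsilon>"
    and Feff: "\<And>J u v. J \<in> {-1, 1} \<Longrightarrow> u \<in> {1..N} \<Longrightarrow> v \<in> {1..N} \<Longrightarrow> \<bar>Feff J u v\<bar> \<le> 1"
    and F: "\<And>Js u vs. Js \<in> lists_of {-1, 1} (Suc m) \<Longrightarrow> u \<in> {1..N} \<Longrightarrow> vs \<in> lists_of {1..N} (Suc m) \<Longrightarrow>
       good_path B zs u vs \<Longrightarrow>
       \<bar>F (chain_bonds u Js vs @ zs) - Feff (prod_list Js) u (last vs)\<bar> \<le> \<epsilon>"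
  shows "\<bar>real N ^ m * avg (bond_lists N (Suc m))
        (\<lambda>ys. of_bool (isolated_chain B (ys @ zs) [0..<Suc m]) * F (ys @ zs))
      - free_fraction N zs ^ m * avg {-1, 1} (\<lambda>J. avg {1..N} (\<lambda>u. avg {1..N} (\<lambda>v. Feff J u v)))\<bar>
    \<le> \<epsilon> + real m * (real (2 + T + m) / real N)"
proof -
  let ?J = "lists_of {-1, 1 :: real} (Suc m)" and ?V = "lists_of {1..N} (Suc m)"
  let ?g = "\<lambda>u vs. of_bool (good_path B zs u vs) :: real"
  let ?d = "real m * (real (2 + T + m) / real N)"
  let ?u = "free_fraction N zs ^ m"
  \<comment> \<open>\<open>W u v\<close> is the probability that a random interior is good for the
    ends \<open>u\<close> and \<open>v\<close>. By \<open>avg_good_path\<close> it hardly depends on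
    the ends, so it can be pulled out as a power of the free fraction.\<close>
  define W where "W u v = avg (lists_of {1..N} m) (\<lambda>is. ?g u (is @ [v]))" for u v
  have "real N ^ m * avg (bond_lists N (Suc m))
        (\<lambda>ys. of_bool (isolated_chain B (ys @ zs) [0..<Suc m]) * F (ys @ zs))
      = avg ?J (\<lambda>Js. avg {1..N} (\<lambda>u. avg ?V (\<lambda>vs. ?g u vs * F (chain_bonds u Js vs @ zs))))"
    using N by (subst avg_isolated_chain[OF N m]) simp
  moreover have "\<bar>\<dots> - avg ?J (\<lambda>Js. avg {1..N} (\<lambda>u. avg ?V (\<lambda>vs. ?g u vs * Feff (prod_list Js) u (last vs))))\<bar> \<le> \<epsilon>"
    unfolding avg_diff[symmetric] right_diff_distrib[symmetric]
    by (intro abs_avg_le_const \<open>0 \<le> \<epsilon>\<close>) (use F \<open>0 \<le> \<epsilon>\<close> in auto)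
  moreover have "avg ?J (\<lambda>Js. avg {1..N} (\<lambda>u. avg ?V (\<lambda>vs. ?g u vs * Feff (prod_list Js) u (last vs))))
     = avg {-1, 1} (\<lambda>J. avg {1..N} (\<lambda>u. avg {1..N} (\<lambda>v. Feff J u v * W u v)))"
  proof -
    have "avg ?V (\<lambda>vs. ?g u vs * Feff J u (last vs)) = avg {1..N} (\<lambda>v. Feff J u v * W u v)" for J u
    proof -
      have "avg ?V (\<lambda>vs. ?g u vs * Feff J u (last vs))
         = avg (lists_of {1..N} m) (\<lambda>is. avg {1..N} (\<lambda>v. ?g u (is @ [v]) * Feff J u v))"
        by (subst avg_lists_of_snoc) simp_all
      also have "\<dots> = avg {1..N} (\<lambda>v. avg (lists_of {1..N} m) (\<lambda>is. ?g u (is @ [v]) * Feff J u v))"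
        by (rule avg_swap)
      also have "\<dots> = avg {1..N} (\<lambda>v. Feff J u v * W u v)"
        unfolding avg_multc W_def by (simp only: mult.commute)
      finally show ?thesis .
    qed
    then show ?thesis
      by (simp only: avg_signs_prod_list[of m "\<lambda>J. avg {1..N} (\<lambda>u. avg {1..N} (\<lambda>v. Feff J u v * W u v))"])
  qed
  moreover have "\<bar>avg {-1, 1} (\<lambda>J. avg {1..N} (\<lambda>u. avg {1..N} (\<lambda>v. Feff J u v * W u v)))
      - ?u * avg {-1, 1} (\<lambda>J. avg {1..N} (\<lambda>u. avg {1..N} (\<lambda>v. Feff J u v)))\<bar> \<le> ?d"
    unfolding avg_cmult[symmetric] avg_diff[symmetric]
  proof (intro abs_avg_le_const)
    fix J u v assume h: "J \<in> {-1, 1 :: real}" "u \<in> {1..N}" "v \<in> {1..N}"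
    have "Feff J u v * W u v - ?u * Feff J u v = Feff J u v * (W u v - ?u)"
      by (simp add: algebra_simps)
    also have "\<bar>\<dots>\<bar> \<le> 1 * ?d"
      unfolding abs_mult W_def using Feff[OF h] avg_good_path[OF N B h(2,3), where zs = zs and m = m]
      by (intro mult_mono) auto
    finally show "\<bar>Feff J u v * W u v - ?u * Feff J u v\<bar> \<le> ?d"
      by simp
  qed simp_all
  ultimately show ?thesis by linarith
qed

text \<open>Let X be the chain count, u the m-th power of the free fraction, and write E for uniform
  averages. Then E (X F) is close to P E (u A) by the change of variables, and to E X E F by
  decoupling; E X is close to P E u, and E (u A) to E u E A. Together these bound P E u times the
  difference of E F and E A, whence the claim after inserting lower bounds for P and E u.\<close>

lemma chain_stability_abstract:
  fixes F :: "bond list \<Rightarrow> real"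
    and Feff :: "bond list \<Rightarrow> real \<Rightarrow> nat \<Rightarrow> nat \<Rightarrow> real"
  assumes N: "N \<ge> 2" and m: "m \<ge> 1" and n: "n > 0" and B: "finite B" "card B \<le> T" and "0 \<le> \<epsilon>"
    and Fb: "\<And>xs. xs \<in> bond_lists N (Suc m + n) \<Longrightarrow> \<bar>F xs\<bar> \<le> 1"
    and Fperm: "\<And>xs ix. xs \<in> bond_lists N (Suc m + n) \<Longrightarrow> distinct ix \<Longrightarrow>
       set ix = {..<Suc m + n} \<Longrightarrow> F (map (\<lambda>i. xs ! i) ix) = F xs"
    and Feff: "\<And>zs J u v. zs \<in> bond_lists N n \<Longrightarrow> J \<in> {-1, 1} \<Longrightarrow> u \<in> {1..N} \<Longrightarrow>
       v \<in> {1..N} \<Longrightarrow> \<bar>Feff zs J u v\<bar> \<le> 1"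
    and F: "\<And>zs Js u vs. zs \<in> bond_lists N n \<Longrightarrow> Js \<in> lists_of {-1, 1} (Suc m) \<Longrightarrow>
       u \<in> {1..N} \<Longrightarrow> vs \<in> lists_of {1..N} (Suc m) \<Longrightarrow> good_path B zs u vs \<Longrightarrow>
       \<bar>F (chain_bonds u Js vs @ zs) - Feff zs (prod_list Js) u (last vs)\<bar> \<le> \<epsilon>"
  defines "A \<equiv> \<lambda>zs. avg {-1, 1} (\<lambda>J. avg {1..N} (\<lambda>u. avg {1..N} (\<lambda>v. Feff zs J u v)))"
  shows "(1 - 1 / real N) ^ (2 * n * m) *
      \<bar>avg (bond_lists N (Suc m + n)) F - avg (bond_lists N n) A\<bar>
    \<le> 3 * real (Suc m) * sqrt (real (Suc m + n)) * real N ^ m / real n ^ Suc m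
      + 2 * (\<epsilon> + real m * (real (2 + T + m) / real N)) + real m * (4 / real N) * sqrt (real n)"
proof -
  let ?K = "Suc m" and ?S = "bond_space N"
  let ?L = "lists_of ?S (Suc m + n)" and ?M = "lists_of ?S n"
  define X where "X xs = real (card (chains ?K B xs))" for xs
  \<comment> \<open>The number of index tuples times the probability scale of a chain;
    \<open>P\<close> times the mean of \<open>?uf\<close> is the leading term of the mean chain
    count.\<close>
  define P where "P = real (card (index_tuples ?K (?K + n))) / real N ^ m"
  let ?e = "\<epsilon> + real m * (real (2 + T + m) / real N)"
  let ?uf = "\<lambda>zs. free_fraction N zs ^ m"
  have N0: "N > 0" using N by simp
  have S: "finite ?S" "?S \<noteq> {}" using N0 bond_space_nonempty[of N] by auto
  have nL: "finite ?L" "?L \<noteq> {}" and nM: "finite ?M" "?M \<noteq> {}" using S by auto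
  have P: "real n ^ ?K / real N ^ m \<le> P"
    unfolding P_def using card_index_tuples_ge[of n ?K]
    by (intro divide_right_mono) (simp_all del: power_Suc flip: of_nat_power)
  have P0: "P > 0" using P n N0 by (smt (verit) divide_pos_pos of_nat_0_less_iff zero_less_power)
  have d0: "0 \<le> real m * (real (2 + T + m) / real N)" by simp
  \<comment> \<open>Stated for a general observable because it is needed twice: for
    \<open>F\<close>, and for the constant 1, which evaluates the mean chain count itself.\<close>
  have count: "\<bar>avg ?L (\<lambda>xs. X xs * G xs) - P * avg ?M (\<lambda>zs. ?uf zs * Ge zs)\<bar> \<le> P * (\<epsilon>' + real m * (real (2 + T + m) / real N))"
    if Gperm: "\<And>xs ix. xs \<in> ?L \<Longrightarrow> distinct ix \<Longrightarrow> set ix = {..<Suc m + n} \<Longrightarrow> G (map (\<lambda>i. xs ! i) ix) = G xs"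
      and eps: "0 \<le> \<epsilon>'"
      and G: "\<And>zs. zs \<in> ?M \<Longrightarrow> \<bar>real N ^ m * avg (lists_of ?S (Suc m))
        (\<lambda>ys. of_bool (isolated_chain B (ys @ zs) [0..<Suc m]) * G (ys @ zs)) - ?uf zs * Ge zs\<bar>
        \<le> \<epsilon>' + real m * (real (2 + T + m) / real N)" for G Ge \<epsilon>'
  proof -
    have "avg ?L (\<lambda>xs. X xs * G xs) = real (card (index_tuples ?K (?K + n))) *
        avg ?L (\<lambda>xs. of_bool (isolated_chain B xs [0..<?K]) * G xs)"
      unfolding X_def by (rule avg_card_chains[OF Gperm])
    also have "\<dots> = real (card (index_tuples ?K (?K + n))) *
        avg ?M (\<lambda>zs. avg (lists_of ?S ?K) (\<lambda>ys. of_bool (isolated_chain B (ys @ zs) [0..<?K]) * G (ys @ zs)))"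
      by (subst avg_lists_of_add[OF S(1)], subst avg_swap) (rule refl)
    also have "\<dots> = P * avg ?M (\<lambda>zs. real N ^ m *
        avg (lists_of ?S ?K) (\<lambda>ys. of_bool (isolated_chain B (ys @ zs) [0..<?K]) * G (ys @ zs)))"
      unfolding P_def avg_cmult using N0 by simp
    finally have "avg ?L (\<lambda>xs. X xs * G xs) - P * avg ?M (\<lambda>zs. ?uf zs * Ge zs) = P * avg ?M (\<lambda>zs. real N ^ m *
        avg (lists_of ?S ?K) (\<lambda>ys. of_bool (isolated_chain B (ys @ zs) [0..<?K]) * G (ys @ zs)) - ?uf zs * Ge zs)"
      by (simp add: avg_diff right_diff_distrib)
    also have "\<bar>\<dots>\<bar> \<le> P * (\<epsilon>' + real m * (real (2 + T + m) / real N))"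
      unfolding abs_mult using P0 eps d0 G by (intro mult_mono abs_avg_le_const) auto
    finally show ?thesis .
  qed
  have c1: "\<bar>avg ?L (\<lambda>xs. X xs * F xs) - P * avg ?M (\<lambda>zs. ?uf zs * A zs)\<bar> \<le> P * ?e"
  proof (rule count[OF Fperm \<open>0 \<le> \<epsilon>\<close>])
    fix zs assume zs: "zs \<in> ?M"
    show "\<bar>real N ^ m * avg (lists_of ?S (Suc m))
        (\<lambda>ys. of_bool (isolated_chain B (ys @ zs) [0..<Suc m]) * F (ys @ zs)) - ?uf zs * A zs\<bar> \<le> ?e"
      unfolding A_def
      by (rule avg_isolated_chain_effective[OF N0 m B \<open>0 \<le> \<epsilon>\<close>]) (use Feff F zs in auto)
  qed
  have c2: "\<bar>avg ?L (\<lambda>xs. X xs * 1) - P * avg ?M (\<lambda>zs. ?uf zs * 1)\<bar> \<le> P * (0 + real m * (real (2 + T + m) / real N))"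
  proof (rule count)
    fix zs
    have one: "avg {-1, 1 :: real} (\<lambda>J. avg {1..N} (\<lambda>u. avg {1..N} (\<lambda>v. 1))) = 1"
      using N0 by simp
    show "\<bar>real N ^ m * avg (lists_of ?S (Suc m))
        (\<lambda>ys. of_bool (isolated_chain B (ys @ zs) [0..<Suc m]) * 1) - ?uf zs * 1\<bar>
        \<le> 0 + real m * (real (2 + T + m) / real N)"
      using avg_isolated_chain_effective[OF N0 m B order.refl, where Feff = "\<lambda>_ _ _. 1" and zs = zs and F = "\<lambda>_. 1"] unfolding one by simp
  qed simp_all
  have c3: "\<bar>avg ?L (\<lambda>xs. X xs * F xs) - avg ?L X * avg ?L F\<bar> \<le> 3 * real ?K * sqrt (real (?K + n))"
    by (rule avg_lists_of_decouple[OF S])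
      (use Fb in \<open>auto simp: X_def length_lists_of intro!: card_chains_bounded_difference[of _ _ "Suc m", simplified]\<close>)
  have A1: "\<bar>A zs\<bar> \<le> 1" if "zs \<in> ?M" for zs
    unfolding A_def using Feff that by (intro abs_avg_le_const) auto
  have c4: "\<bar>avg ?M (\<lambda>zs. ?uf zs * A zs) - avg ?M ?uf * avg ?M A\<bar> \<le> real m * (4 / real N) * sqrt (real n)"
  proof (rule avg_lists_of_decouple[OF S _ _ A1])
    fix xs i x assume "xs \<in> ?M" "i < n" "x \<in> ?S"
    then have "\<bar>free_fraction N (xs[i := x]) - free_fraction N xs\<bar> \<le> 4 / real N"
      by (intro free_fraction_update) (simp add: length_lists_of)
    then show "\<bar>?uf (xs[i := x]) - ?uf xs\<bar> \<le> real m * (4 / real N)"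
      using abs_power_diff_le[of "free_fraction N (xs[i := x])" "free_fraction N xs" m] free_fraction_bounds
      by (smt (verit) mult_left_mono of_nat_0_le_iff)
  qed simp_all
  define U where "U = avg ?M ?uf"
  \<comment> \<open>Jensen turns the explicit mean of the free fraction into a lower bound for the
    mean of its power.\<close>
  have U: "(1 - 1 / real N) ^ (2 * n * m) \<le> U"
  proof -
    have "0 < (1 - 1 / real N) ^ (2 * n)" using N by simp
    then show ?thesis
      using power_avg_le_avg_power[OF nM, of "free_fraction N" m] free_fraction_bounds avg_free_fraction[OF N0, of n]
      by (simp add: U_def power_mult)
  qed
  define a where "a = avg ?L F"
  define b where "b = avg ?M A"
  have a1: "\<bar>a\<bar> \<le> 1" unfolding a_def by (rule abs_avg_le_const) (use Fb in auto)
  define c where "c = 3 * real ?K * sqrt (real (?K + n))"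
  define d where "d = real m * (real (2 + T + m) / real N)"
  define s where "s = real m * (4 / real N) * sqrt (real n)"
  define y where "y = avg ?L (\<lambda>xs. X xs * F xs)"
  define z where "z = avg ?M (\<lambda>zs. ?uf zs * A zs)"
  define x where "x = avg ?L X"
  have h1: "\<bar>y - P * z\<bar> \<le> P * (\<epsilon> + d)" using c1 by (simp add: y_def z_def d_def)
  have h2: "\<bar>x - P * U\<bar> \<le> P * d" using c2 by (simp add: x_def U_def d_def)
  have h3: "\<bar>y - x * a\<bar> \<le> c" using c3 by (simp add: y_def x_def a_def c_def)
  have h4: "\<bar>z - U * b\<bar> \<le> s" using c4 by (simp add: z_def U_def b_def s_def)
  have h2': "\<bar>x * a - P * U * a\<bar> \<le> P * d"
    using h2 a1 mult_mono[of "\<bar>x - P * U\<bar>" "P * d" "\<bar>a\<bar>" 1] by (simp add: left_diff_distrib[symmetric] abs_mult)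
  have h4': "\<bar>P * z - P * U * b\<bar> \<le> P * s"
    using h4 P0 by (simp add: mult.assoc right_diff_distrib[symmetric] abs_mult)
  have "\<bar>P * U * a - P * U * b\<bar> \<le> c + P * (\<epsilon> + d) + P * d + P * s"
    using h1 h2' h3 h4' by linarith
  moreover have "\<bar>P * U * a - P * U * b\<bar> = P * (U * \<bar>a - b\<bar>)"
  proof -
    have "0 \<le> U" unfolding U_def by (intro avg_nonneg zero_le_power free_fraction_bounds)
    then show ?thesis
      using P0 by (simp add: right_diff_distrib[symmetric] abs_mult mult.assoc)
  qed
  moreover have "c + P * (\<epsilon> + d) + P * d + P * s = P * (c / P + \<epsilon> + d + d + s)"
    using P0 by (simp add: distrib_left)
  ultimately have "P * (U * \<bar>a - b\<bar>) \<le> P * (c / P + \<epsilon> + d + d + s)"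
    by simp
  then have r: "U * \<bar>a - b\<bar> \<le> c / P + \<epsilon> + d + d + s" using P0 by simp
  have "(1 - 1 / real N) ^ (2 * n * m) * \<bar>a - b\<bar> \<le> U * \<bar>a - b\<bar>"
    using U by (rule mult_right_mono) simp
  also note r
  also have "c / P \<le> c / (real n ^ ?K / real N ^ m)"
    using P n N0 P0 by (intro divide_left_mono) (auto simp: c_def zero_less_mult_iff zero_less_divide_iff)
  finally show ?thesis
    using \<open>0 \<le> \<epsilon>\<close> unfolding a_def b_def c_def d_def s_def by (simp add: mult.assoc)
qed

section \<open>Application to powers of two-spin correlations\<close>

definition corr_power :: "nat \<Rightarrow> nat \<Rightarrow> (config \<Rightarrow> real) \<Rightarrow> real" where
  "corr_power N p w = avg {1..N} (\<lambda>k. avg {1..N} (\<lambda>l. gibbs_mean N w (spins2 k l) ^ p))"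

definition bonded_average :: "nat \<Rightarrow> ((config \<Rightarrow> real) \<Rightarrow> real) \<Rightarrow> real \<Rightarrow> (config \<Rightarrow> real) \<Rightarrow> real" where
  "bonded_average N \<Phi> x w = avg {-1, 1} (\<lambda>J. avg {1..N} (\<lambda>u. avg {1..N} (\<lambda>v.
     \<Phi> (\<lambda>\<sigma>. w \<sigma> * (1 + x * J * \<sigma> u * \<sigma> v)))))"

lemma abs_gibbs_mean_two_spin_le:
  assumes "\<And>\<sigma>. \<sigma> \<in> configs N \<Longrightarrow> 0 \<le> w \<sigma>" "k \<in> {1..N}" "l \<in> {1..N}"
  shows "\<bar>gibbs_mean N w (spins2 k l)\<bar> \<le> 1"
  using assms(1)
  by (rule abs_gibbs_mean_le) (simp_all add: abs_mult configs_spin_abs[OF _ assms(2)] configs_spin_abs[OF _ assms(3)])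

lemma gibbs_mean_power_bounds:
  assumes "\<And>\<sigma>. \<sigma> \<in> configs N \<Longrightarrow> 0 \<le> w \<sigma>" "even p" "k \<in> {1..N}" "l \<in> {1..N}"
  shows "0 \<le> gibbs_mean N w (spins2 k l) ^ p" "gibbs_mean N w (spins2 k l) ^ p \<le> 1"
proof -
  show "0 \<le> gibbs_mean N w (spins2 k l) ^ p" using assms(2) by (rule zero_le_even_power)
  show "gibbs_mean N w (spins2 k l) ^ p \<le> 1"
    using power_le_one[OF abs_ge_zero abs_gibbs_mean_two_spin_le[where w = w, OF assms(1,3,4)], of p]
      assms(2) by (simp add: power_even_abs)
qed

lemma corr_power_bounds:
  assumes "\<And>\<sigma>. \<sigma> \<in> configs N \<Longrightarrow> 0 \<le> w \<sigma>" "even p"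
  shows "0 \<le> corr_power N p w" "corr_power N p w \<le> 1"
proof -
  show "0 \<le> corr_power N p w"
    unfolding corr_power_def by (intro avg_nonneg gibbs_mean_power_bounds assms)
  have "\<bar>corr_power N p w\<bar> \<le> 1"
    unfolding corr_power_def using gibbs_mean_power_bounds[where w = w, OF assms]
    by (intro abs_avg_le_const) auto
  then show "corr_power N p w \<le> 1" by simp
qed

lemma abs_corr_power_le:
  assumes "\<And>\<sigma>. \<sigma> \<in> configs N \<Longrightarrow> 0 \<le> w \<sigma>" "even p"
  shows "\<bar>corr_power N p w\<bar> \<le> 1"
  using corr_power_bounds[where w = w, OF assms] by simp

text \<open>Pairs of sites meeting a set of at most \<open>m\<close> sites form a fraction of at
  most 2 m / N, and each contributes at most 1 because even powers of correlations lie between 0 and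
  1.\<close>

lemma corr_power_diff_le:
  assumes N: "N > 0" and w: "\<And>\<sigma>. \<sigma> \<in> configs N \<Longrightarrow> 0 \<le> w \<sigma>" and w': "\<And>\<sigma>. \<sigma> \<in> configs N \<Longrightarrow> 0 \<le> w' \<sigma>"
    and p: "even p" and I: "finite I" "card I \<le> m"
    and eq: "\<And>k l. k \<notin> I \<Longrightarrow> l \<notin> I \<Longrightarrow> k \<in> {1..N} \<Longrightarrow> l \<in> {1..N} \<Longrightarrow>
       gibbs_mean N w (spins2 k l) = gibbs_mean N w' (spins2 k l)"
  shows "\<bar>corr_power N p w - corr_power N p w'\<bar> \<le> 2 * real m / real N"
proof -
  let ?i = "\<lambda>k. of_bool (k \<in> I) :: real"
  have i: "avg {1..N} ?i \<le> real m / real N"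
  proof -
    have "card {k \<in> {1..N}. k \<in> I} \<le> m"
      using card_mono[OF I(1), of "{k \<in> {1..N}. k \<in> I}"] I(2) by fastforce
    then show ?thesis by (subst avg_of_bool) (simp_all add: divide_right_mono)
  qed
  have "\<bar>corr_power N p w - corr_power N p w'\<bar>
      \<le> avg {1..N} (\<lambda>k. avg {1..N} (\<lambda>l. \<bar>gibbs_mean N w (spins2 k l) ^ p - gibbs_mean N w' (spins2 k l) ^ p\<bar>))"
    unfolding corr_power_def avg_diff[symmetric]
    by (rule order.trans[OF abs_avg_le avg_mono[OF abs_avg_le]])
  also have "\<dots> \<le> avg {1..N} (\<lambda>k. avg {1..N} (\<lambda>l. ?i k + ?i l))"
  proof (intro avg_mono)
    fix k l assume kl: "k \<in> {1..N}" "l \<in> {1..N}"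
    show "\<bar>gibbs_mean N w (spins2 k l) ^ p - gibbs_mean N w' (spins2 k l) ^ p\<bar> \<le> ?i k + ?i l"
    proof (cases "k \<in> I \<or> l \<in> I")
      case True
      then have "1 \<le> ?i k + ?i l" by auto
      then show ?thesis
        using gibbs_mean_power_bounds[where w = w, OF w p kl] gibbs_mean_power_bounds[where w = w', OF w' p kl] by linarith
    next
      case False
      then show ?thesis using eq[of k l] kl by simp
    qed
  qed
  also have "\<dots> = 2 * avg {1..N} ?i"
    using N by (simp add: avg_add)
  also have "\<dots> \<le> 2 * (real m / real N)" using i by simp
  finally show ?thesis by simp
qed

lemma energy_permute:
  assumes "length xs = n" "distinct ix" "set ix = {..<n}"
  shows "energy (map (\<lambda>i. xs ! i) ix) \<sigma> = energy xs \<sigma>"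
proof -
  let ?f = "\<lambda>(J, i, j). J * \<sigma> i * \<sigma> j"
  have "mset ix = mset_set {..<n}"
    using mset_set_set[OF assms(2)] assms(3) by simp
  also have "\<dots> = mset [0..<n]"
    using mset_set_set[of "[0..<n]"] by (simp add: atLeast0LessThan)
  finally have "mset ix = mset [0..<n]" .
  then have "mset (map (\<lambda>i. xs ! i) ix) = mset (map (\<lambda>i. xs ! i) [0..<n])"
    by (simp only: mset_map)
  also have "map (\<lambda>i. xs ! i) [0..<n] = xs" using assms(1) map_nth by blast
  finally have "mset (map ?f (map (\<lambda>i. xs ! i) ix)) = mset (map ?f xs)" by (simp only: mset_map)
  then show ?thesis unfolding energy_def by (metis sum_mset_sum_list)
qed

lemma spin_free_energy:
  assumes "\<And>e. e \<in> set xs \<Longrightarrow> \<not> touches v e"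
  shows "spin_free v (energy xs)"
proof (rule spin_freeI)
  fix \<sigma> :: config and c
  show "energy xs (\<sigma>(v := c)) = energy xs \<sigma>"
    unfolding energy_def
  proof (intro arg_cong[of _ _ sum_list] map_cong refl)
    fix e assume "e \<in> set xs"
    from assms[OF this] show "(case e of (J, i, j) \<Rightarrow> J * (\<sigma>(v := c)) i * (\<sigma>(v := c)) j) = (case e of (J, i, j) \<Rightarrow> J * \<sigma> i * \<sigma> j)"
      by (cases e) (auto simp: touches_def)
  qed
qed

lemma prod_list_signs: "set Js \<subseteq> {-1, 1 :: real} \<Longrightarrow> prod_list Js \<in> {-1, 1}"
  by (induction Js) auto

lemma abs_tanh_power_less: "\<bar>tanh (\<beta> :: real) ^ Suc m\<bar> < 1"
proof -
  have "\<bar>tanh \<beta>\<bar> < 1" using tanh_real_bounds[of \<beta>] by auto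
  moreover have "\<bar>tanh \<beta>\<bar> * \<bar>tanh \<beta>\<bar> ^ m \<le> \<bar>tanh \<beta>\<bar>"
    using calculation by (intro mult_left_le power_le_one) auto
  ultimately show ?thesis by (simp add: power_abs abs_mult)
qed

lemma tilt_pos:
  assumes "J \<in> {-1, 1 :: real}" "\<sigma> \<in> configs N" "u \<in> {1..N}" "v \<in> {1..N}" "\<bar>x\<bar> < 1"
  shows "0 < 1 + x * J * \<sigma> u * \<sigma> v"
proof -
  have "\<bar>x * J * \<sigma> u * \<sigma> v\<bar> < 1"
    using assms configs_spin_abs[OF assms(2,3)] configs_spin_abs[OF assms(2,4)] by (auto simp: abs_mult)
  then show ?thesis by linarith
qed

text \<open>Interior sites avoid \<open>B\<close>, so \<open>w\<close> does not depend on their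
  spins and \<open>gibbs_mean_chain\<close> is exact for observed pairs off the interior. The
  tolerance 2 m / N pays for pairs that meet the interior.\<close>

lemma chain_stability_fixed_size:
  assumes N: "N \<ge> 2" and m: "m \<ge> 1" and n: "n > 0" and B: "finite B" "card B \<le> T"
    and w: "\<And>\<sigma>. 0 < w \<sigma>" and free: "\<And>v. v \<notin> B \<Longrightarrow> spin_free v w" and p: "even p"
  shows "(1 - 1 / real N) ^ (2 * n * m) *
      \<bar>avg (bond_lists N (Suc m + n)) (\<lambda>xs. corr_power N p (\<lambda>\<sigma>. w \<sigma> * exp (\<beta> * energy xs \<sigma>)))
       - avg (bond_lists N n) (\<lambda>zs. bonded_average N (corr_power N p) (tanh \<beta> ^ Suc m)
            (\<lambda>\<sigma>. w \<sigma> * exp (\<beta> * energy zs \<sigma>)))\<bar>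
    \<le> 3 * real (Suc m) * sqrt (real (Suc m + n)) * real N ^ m / real n ^ Suc m
      + 2 * (2 * real m / real N + real m * (real (2 + T + m) / real N)) + real m * (4 / real N) * sqrt (real n)"
  unfolding bonded_average_def
proof (rule chain_stability_abstract[OF N m n B])
  have N0: "N > 0" using N by simp
  have t: "\<bar>tanh \<beta> ^ Suc m\<bar> < 1" by (rule abs_tanh_power_less)
  have w0: "0 \<le> w \<sigma> * exp (\<beta> * energy zs \<sigma>)" for zs \<sigma>
    using w[of \<sigma>] by simp
  have w1: "0 \<le> w \<sigma> * exp (\<beta> * energy zs \<sigma>) * (1 + tanh \<beta> ^ Suc m * J * \<sigma> u * \<sigma> v)"
    if "J \<in> {-1, 1 :: real}" "u \<in> {1..N}" "v \<in> {1..N}" "\<sigma> \<in> configs N" for zs \<sigma> J u v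
    by (rule mult_nonneg_nonneg[OF w0 less_imp_le[OF tilt_pos[OF that(1,4,2,3) t]]])
  show "0 \<le> 2 * real m / real N" by simp
  show "\<bar>corr_power N p (\<lambda>\<sigma>. w \<sigma> * exp (\<beta> * energy xs \<sigma>))\<bar> \<le> 1" for xs
    using w0 p by (rule abs_corr_power_le)
  show "\<bar>corr_power N p (\<lambda>\<sigma>. w \<sigma> * exp (\<beta> * energy zs \<sigma>) * (1 + tanh \<beta> ^ Suc m * J * \<sigma> u * \<sigma> v))\<bar> \<le> 1"
    if "J \<in> {-1, 1 :: real}" "u \<in> {1..N}" "v \<in> {1..N}" for zs J u v
    using w1[OF that] p by (rule abs_corr_power_le)
  show "corr_power N p (\<lambda>\<sigma>. w \<sigma> * exp (\<beta> * energy (map (\<lambda>i. xs ! i) ix) \<sigma>))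
      = corr_power N p (\<lambda>\<sigma>. w \<sigma> * exp (\<beta> * energy xs \<sigma>))"
    if "xs \<in> bond_lists N (Suc m + n)" "distinct ix" "set ix = {..<Suc m + n}" for xs ix
    using energy_permute[OF length_lists_of[OF that(1)] that(2,3)] by simp
  fix zs Js u vs
  assume zs: "zs \<in> bond_lists N n" and Js: "Js \<in> lists_of {-1, 1 :: real} (Suc m)"
    and u: "u \<in> {1..N}" and vs: "vs \<in> lists_of {1..N} (Suc m)" and good: "good_path B zs u vs"
  have Js': "length Js = length vs" "set Js \<subseteq> {-1, 1}" and vs': "length vs = Suc m" "vs \<noteq> []" "set vs \<subseteq> {1..N}"
    using Js vs by (auto simp: lists_of_def)
  have last: "last vs \<in> {1..N}" using last_in_set[OF vs'(2)] vs'(3) by blast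
  let ?w = "\<lambda>\<sigma>. w \<sigma> * exp (\<beta> * energy zs \<sigma>)"
  have eq: "(\<lambda>\<sigma>. w \<sigma> * exp (\<beta> * energy (chain_bonds u Js vs @ zs) \<sigma>))
      = (\<lambda>\<sigma>. ?w \<sigma> * exp (\<beta> * energy (chain_bonds u Js vs) \<sigma>))"
    by (simp add: energy_append distrib_left exp_add mult_ac)
  show "\<bar>corr_power N p (\<lambda>\<sigma>. w \<sigma> * exp (\<beta> * energy (chain_bonds u Js vs @ zs) \<sigma>))
      - corr_power N p (\<lambda>\<sigma>. ?w \<sigma> * (1 + tanh \<beta> ^ Suc m * prod_list Js * \<sigma> u * \<sigma> (last vs)))\<bar>
      \<le> 2 * real m / real N"
  proof (rule corr_power_diff_le[where I = "set (butlast vs)"])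
    show "N > 0" "even p" "finite (set (butlast vs))" using N0 p by simp_all
    show "0 \<le> w \<sigma> * exp (\<beta> * energy (chain_bonds u Js vs @ zs) \<sigma>)" for \<sigma> by (rule w0)
    show "0 \<le> ?w \<sigma> * (1 + tanh \<beta> ^ Suc m * prod_list Js * \<sigma> u * \<sigma> (last vs))" if "\<sigma> \<in> configs N" for \<sigma>
      using that by (rule w1[OF prod_list_signs[OF Js'(2)] u last])
    show "card (set (butlast vs)) \<le> m" using card_length[of "butlast vs"] vs' by simp
    fix k l assume kl: "k \<notin> set (butlast vs)" "l \<notin> set (butlast vs)"
    show "gibbs_mean N (\<lambda>\<sigma>. w \<sigma> * exp (\<beta> * energy (chain_bonds u Js vs @ zs) \<sigma>)) (spins2 k l)
        = gibbs_mean N (\<lambda>\<sigma>. ?w \<sigma> * (1 + tanh \<beta> ^ Suc m * prod_list Js * \<sigma> u * \<sigma> (last vs))) (spins2 k l)"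
      unfolding eq vs'(1)[symmetric]
    proof (rule gibbs_mean_chain[OF Js' vs'(2) u vs'(3)])
      show "distinct (butlast vs)" "u \<notin> set (butlast vs)" "last vs \<notin> set (butlast vs)"
        using good by (auto simp: good_path_def)
      fix x assume x: "x \<in> set (butlast vs)"
      have "spin_free x w" using good x by (intro free) (auto simp: good_path_def)
      moreover have "spin_free x (energy zs)"
        using good x by (intro spin_free_energy) (auto simp: good_path_def)
      ultimately show "spin_free x ?w" by (simp add: spin_free_def)
      show "spin_free x (spins2 k l)"
        using kl x by (intro spin_free_mult spin_free_spin) auto
    qed
  qed
qed

section \<open>Poisson averages\<close>

abbreviation poisson_mean :: "real \<Rightarrow> (nat \<Rightarrow> real) \<Rightarrow> real" where
  "poisson_mean \<zeta> \<equiv> measure_pmf.expectation (poisson_pmf \<zeta>)"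

text \<open>The Poisson weights satisfy n p(n) = \<zeta> p(n - 1). Nonnegativity allows the index
  shift to be made with extended nonnegative integrals, so that integrability of the left side is
  part of the result.\<close>

lemma poisson_mecke:
  fixes a :: "nat \<Rightarrow> real"
  assumes "\<zeta> > 0" and a: "\<And>n. 0 \<le> a n" and int: "integrable (poisson_pmf \<zeta>) (\<lambda>n. a (Suc n))"
  shows "has_bochner_integral (poisson_pmf \<zeta>) (\<lambda>n. real n * a n)
     (\<zeta> * poisson_mean \<zeta> (\<lambda>n. a (Suc n)))"
proof (rule has_bochner_integral_nn_integral)
  let ?p = "\<lambda>n. \<zeta> ^ n / fact n * exp (- \<zeta>)"
  have pos: "0 \<le> ?p n" for n using assms by simp
  have "(\<integral>\<^sup>+n. ennreal (real n * a n) \<partial>poisson_pmf \<zeta>) = (\<Sum>n. ennreal (?p n) * ennreal (real n * a n))"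
    using assms by (simp add: nn_integral_measure_pmf nn_integral_count_space_nat)
  also have "\<dots> = (\<Sum>n. ennreal (?p (n + 1)) * ennreal (real (n + 1) * a (n + 1)))"
    by (subst suminf_offset[of _ 1]) (auto intro: summableI)
  also have "\<dots> = (\<Sum>n. ennreal \<zeta> * (ennreal (?p n) * ennreal (a (Suc n))))"
  proof (intro suminf_cong)
    fix n
    have "?p (n + 1) * (real (n + 1) * a (n + 1)) = \<zeta> * (?p n * a (Suc n))"
    proof -
      define c where "c = real (n + 1)"
      have c: "c > 0" by (simp add: c_def)
      have "?p (n + 1) = \<zeta> * \<zeta> ^ n / (c * fact n) * exp (- \<zeta>)" by (simp add: c_def)
      then have "?p (n + 1) * (c * a (Suc n)) = \<zeta> * \<zeta> ^ n / (c * fact n) * exp (- \<zeta>) * (c * a (Suc n))"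
        by (simp only:)
      also have "\<dots> = \<zeta> * (?p n * a (Suc n))" using c by simp
      finally show ?thesis unfolding c_def by simp
    qed
    then show "ennreal (?p (n + 1)) * ennreal (real (n + 1) * a (n + 1)) = ennreal \<zeta> * (ennreal (?p n) * ennreal (a (Suc n)))"
      using assms pos[of n] pos[of "n + 1"] a by (simp add: ennreal_mult[symmetric])
  qed
  also have "\<dots> = ennreal \<zeta> * (\<Sum>n. ennreal (?p n) * ennreal (a (Suc n)))"
    by (rule ennreal_suminf_cmult)
  also have "(\<Sum>n. ennreal (?p n) * ennreal (a (Suc n))) = (\<integral>\<^sup>+n. ennreal (a (Suc n)) \<partial>poisson_pmf \<zeta>)"
    using assms by (simp add: nn_integral_measure_pmf nn_integral_count_space_nat)
  also have "\<dots> = ennreal (poisson_mean \<zeta> (\<lambda>n. a (Suc n)))"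
    by (rule nn_integral_eq_integral[OF int]) (simp add: a)
  finally show "(\<integral>\<^sup>+n. ennreal (real n * a n) \<partial>poisson_pmf \<zeta>)
      = ennreal (\<zeta> * poisson_mean \<zeta> (\<lambda>n. a (Suc n)))"
    using assms by (simp add: ennreal_mult)
  show "0 \<le> \<zeta> * poisson_mean \<zeta> (\<lambda>n. a (Suc n))"
    using assms by (intro mult_nonneg_nonneg integral_nonneg_AE) auto
qed (use assms in simp_all)

lemma integrable_pmf_bounded:
  fixes f :: "'a \<Rightarrow> real"
  assumes "\<And>x. \<bar>f x\<bar> \<le> C"
  shows "integrable (measure_pmf p) f"
  by (rule measure_pmf.integrable_const_bound[where B = C]) (use assms in auto)

text \<open>The variance, from \<open>poisson_mecke\<close> with the constant 1 and then with the
  identity.\<close>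

lemma poisson_moments:
  assumes "\<zeta> > 0"
  shows "has_bochner_integral (poisson_pmf \<zeta>) (\<lambda>n. (real n - \<zeta>)\<^sup>2) \<zeta>"
proof -
  let ?M = "poisson_pmf \<zeta>"
  have 1: "has_bochner_integral ?M (\<lambda>n. real n) \<zeta>"
    using poisson_mecke[OF assms, of "\<lambda>_. 1"] by simp
  then have i1: "integrable ?M (\<lambda>n. real n)" and e1: "measure_pmf.expectation ?M (\<lambda>n. real n) = \<zeta>"
    by (auto simp: has_bochner_integral_iff)
  have i2: "integrable ?M (\<lambda>n. real (Suc n))" using i1 by simp
  have "measure_pmf.expectation ?M (\<lambda>n. real (Suc n)) = 1 + \<zeta>"
    using i1 e1 by simp
  then have 2: "has_bochner_integral ?M (\<lambda>n. real n * real n) (\<zeta> * (1 + \<zeta>))"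
    using poisson_mecke[OF assms, of real, OF _ i2] by simp
  have "has_bochner_integral ?M (\<lambda>n. real n * real n - 2 * \<zeta> * real n + \<zeta>\<^sup>2) (\<zeta> * (1 + \<zeta>) - 2 * \<zeta> * \<zeta> + \<zeta>\<^sup>2)"
    using 1 2 by (intro has_bochner_integral_add has_bochner_integral_diff has_bochner_integral_mult_right)
      (auto simp: has_bochner_integral_iff)
  moreover have "(\<lambda>n. real n * real n - 2 * \<zeta> * real n + \<zeta>\<^sup>2) = (\<lambda>n. (real n - \<zeta>)\<^sup>2)"
    by (auto simp: power2_eq_square algebra_simps)
  moreover have "\<zeta> * (1 + \<zeta>) - 2 * \<zeta> * \<zeta> + \<zeta>\<^sup>2 = \<zeta>"
    by (simp add: power2_eq_square algebra_simps)
  ultimately show ?thesis by simp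
qed

text \<open>By \<open>poisson_mecke\<close>, \<zeta> times the difference is the mean of (n -
  \<zeta>) a(n), which is bounded by the standard deviation sqrt \<zeta>.\<close>

lemma poisson_shift:
  fixes a :: "nat \<Rightarrow> real"
  assumes "\<zeta> > 0" and a: "\<And>n. 0 \<le> a n" "\<And>n. a n \<le> 1"
  shows "\<bar>poisson_mean \<zeta> (\<lambda>n. a (Suc n)) - poisson_mean \<zeta> a\<bar>
     \<le> 1 / sqrt \<zeta>"
proof -
  let ?M = "poisson_pmf \<zeta>"
  let ?E = "measure_pmf.expectation ?M"
  have ia: "integrable ?M a" "integrable ?M (\<lambda>n. a (Suc n))"
    using a by (auto intro!: integrable_pmf_bounded[of _ 1])
  have hb: "has_bochner_integral ?M (\<lambda>n. real n * a n) (\<zeta> * ?E (\<lambda>n. a (Suc n)))"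
    by (rule poisson_mecke[OF assms(1) a(1) ia(2)])
  have d: "has_bochner_integral ?M (\<lambda>n. real n * a n - \<zeta> * a n) (\<zeta> * ?E (\<lambda>n. a (Suc n)) - \<zeta> * ?E a)"
    using hb ia by (intro has_bochner_integral_diff has_bochner_integral_mult_right)
      (auto simp: has_bochner_integral_iff)
  have q: "has_bochner_integral ?M (\<lambda>n. ((real n - \<zeta>)\<^sup>2 * (1 / sqrt \<zeta>) + sqrt \<zeta>) / 2) ((\<zeta> * (1 / sqrt \<zeta>) + sqrt \<zeta>) / 2)"
    using poisson_moments[OF assms(1)]
    by (intro has_bochner_integral_divide has_bochner_integral_add has_bochner_integral_mult_left)
      (auto simp: has_bochner_integral_iff)
  \<comment> \<open>The inequality 2 |d| sqrt \<zeta> \<le> d^2 + \<zeta> for d = n - \<zeta>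
    replaces the Cauchy-Schwarz inequality.\<close>
  have le: "\<bar>real n * a n - \<zeta> * a n\<bar> \<le> ((real n - \<zeta>)\<^sup>2 * (1 / sqrt \<zeta>) + sqrt \<zeta>) / 2" for n
  proof -
    have "\<bar>real n * a n - \<zeta> * a n\<bar> \<le> \<bar>real n - \<zeta>\<bar> * 1"
      unfolding left_diff_distrib[symmetric] abs_mult using a[of n] by (intro mult_left_mono) auto
    also have "\<bar>real n - \<zeta>\<bar> * 1 \<le> ((real n - \<zeta>)\<^sup>2 * (1 / sqrt \<zeta>) + sqrt \<zeta>) / 2"
    proof -
      have "0 \<le> (\<bar>real n - \<zeta>\<bar> - sqrt \<zeta>)\<^sup>2 / sqrt \<zeta>" using assms by simp
      also have "\<dots> = ((real n - \<zeta>)\<^sup>2 - 2 * \<bar>real n - \<zeta>\<bar> * sqrt \<zeta> + \<zeta>) / sqrt \<zeta>"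
        using assms by (simp add: power2_diff)
      also have "\<dots> = (real n - \<zeta>)\<^sup>2 * (1 / sqrt \<zeta>) - 2 * \<bar>real n - \<zeta>\<bar> + sqrt \<zeta>"
        using assms by (simp add: add_divide_distrib diff_divide_distrib real_div_sqrt)
      finally show ?thesis by simp
    qed
    finally show ?thesis .
  qed
  have "\<bar>\<zeta> * ?E (\<lambda>n. a (Suc n)) - \<zeta> * ?E a\<bar> = \<bar>?E (\<lambda>n. real n * a n - \<zeta> * a n)\<bar>"
    using d by (simp add: has_bochner_integral_iff)
  also have "\<dots> \<le> ?E (\<lambda>n. \<bar>real n * a n - \<zeta> * a n\<bar>)"
    by (rule integral_abs_bound)
  also have "\<dots> \<le> ?E (\<lambda>n. ((real n - \<zeta>)\<^sup>2 * (1 / sqrt \<zeta>) + sqrt \<zeta>) / 2)"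
    using d q le by (intro integral_mono) (auto simp: has_bochner_integral_iff)
  also have "\<dots> = sqrt \<zeta>"
    using q assms by (simp add: has_bochner_integral_iff real_div_sqrt)
  finally have "\<zeta> * \<bar>?E (\<lambda>n. a (Suc n)) - ?E a\<bar> \<le> sqrt \<zeta>"
    using assms by (simp add: right_diff_distrib[symmetric] abs_mult)
  then have "\<bar>?E (\<lambda>n. a (Suc n)) - ?E a\<bar> \<le> sqrt \<zeta> / \<zeta>"
    using assms by (simp add: pos_le_divide_eq mult.commute)
  also have "sqrt \<zeta> / \<zeta> = 1 / sqrt \<zeta>" using assms by (simp add: sqrt_divide_self_eq inverse_eq_divide)
  finally show ?thesis .
qed

lemma poisson_shift_iterated:
  fixes a :: "nat \<Rightarrow> real"
  assumes "\<zeta> > 0" and a: "\<And>n. 0 \<le> a n" "\<And>n. a n \<le> 1"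
  shows "\<bar>poisson_mean \<zeta> (\<lambda>n. a (K + n)) - poisson_mean \<zeta> a\<bar>
     \<le> real K / sqrt \<zeta>"
proof (induction K)
  case (Suc K)
  have "\<bar>poisson_mean \<zeta> (\<lambda>n. a (K + Suc n)) - poisson_mean \<zeta> (\<lambda>n. a (K + n))\<bar>
     \<le> 1 / sqrt \<zeta>"
    by (rule poisson_shift[OF assms(1)]) (use a in auto)
  with Suc show ?case by (simp add: add_divide_distrib)
qed simp

text \<open>Outside the window from \<zeta> / 2 to 2 \<zeta> the difference is at most 1, which is
  below 4 (n - \<zeta>)^2 / \<zeta>^2; the mean of this is 4 / \<zeta>, as in Chebyshev's
  inequality. The remaining term pays for the shift by \<open>K\<close>.\<close>

lemma poisson_compare:
  fixes a b :: "nat \<Rightarrow> real"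
  assumes "\<zeta> > 0" and a: "\<And>n. 0 \<le> a n" "\<And>n. a n \<le> 1" and b: "\<And>n. 0 \<le> b n" "\<And>n. b n \<le> 1"
    and "0 \<le> \<delta>" and ab: "\<And>n. \<zeta> / 2 \<le> real n \<Longrightarrow> real n \<le> 2 * \<zeta> \<Longrightarrow> \<bar>a (K + n) - b n\<bar> \<le> \<delta>"
  shows "\<bar>poisson_mean \<zeta> a - poisson_mean \<zeta> b\<bar>
     \<le> real K / sqrt \<zeta> + (\<delta> + 4 / \<zeta>)"
proof -
  let ?M = "poisson_pmf \<zeta>"
  let ?E = "measure_pmf.expectation ?M"
  have i: "integrable ?M (\<lambda>n. a (K + n))" "integrable ?M b"
    using a b by (auto intro!: integrable_pmf_bounded[of _ 1])
  have q: "has_bochner_integral ?M (\<lambda>n. \<delta> + (real n - \<zeta>)\<^sup>2 * (4 / \<zeta>\<^sup>2)) (\<delta> + \<zeta> * (4 / \<zeta>\<^sup>2))"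
    using poisson_moments[OF assms(1)]
    by (intro has_bochner_integral_add has_bochner_integral_mult_left) (auto simp: has_bochner_integral_iff)
  have le: "\<bar>a (K + n) - b n\<bar> \<le> \<delta> + (real n - \<zeta>)\<^sup>2 * (4 / \<zeta>\<^sup>2)" for n
  proof (cases "\<zeta> / 2 \<le> real n \<and> real n \<le> 2 * \<zeta>")
    case True
    have "0 \<le> (real n - \<zeta>)\<^sup>2 * (4 / \<zeta>\<^sup>2)" by simp
    then show ?thesis using ab[of n] True by linarith
  next
    case False
    then have "\<zeta> / 2 \<le> \<bar>real n - \<zeta>\<bar>" using assms(1) by auto
    then have "(\<zeta> / 2)\<^sup>2 \<le> (real n - \<zeta>)\<^sup>2" using assms(1) by (metis abs_le_square_iff abs_of_pos half_gt_zero)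
    then have "1 \<le> (real n - \<zeta>)\<^sup>2 * (4 / \<zeta>\<^sup>2)" using assms(1) by (simp add: field_simps power2_eq_square)
    then show ?thesis using a[of "K + n"] b[of n] \<open>0 \<le> \<delta>\<close> by linarith
  qed
  have "\<bar>?E (\<lambda>n. a (K + n)) - ?E b\<bar> = \<bar>?E (\<lambda>n. a (K + n) - b n)\<bar>" using i by simp
  also have "\<dots> \<le> ?E (\<lambda>n. \<bar>a (K + n) - b n\<bar>)" by (rule integral_abs_bound)
  also have "\<dots> \<le> ?E (\<lambda>n. \<delta> + (real n - \<zeta>)\<^sup>2 * (4 / \<zeta>\<^sup>2))"
    using i q le by (intro integral_mono) (auto simp: has_bochner_integral_iff)
  also have "\<dots> = \<delta> + 4 / \<zeta>"
    using q assms(1) by (simp add: has_bochner_integral_iff power2_eq_square)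
  finally show ?thesis using poisson_shift_iterated[where K = K and a = a, OF assms(1) a] by linarith
qed

section \<open>Stability with a Poisson number of bonds\<close>

definition size_average :: "real \<Rightarrow> nat \<Rightarrow> (bond list \<Rightarrow> real) \<Rightarrow> real" where
  "size_average \<zeta> N f = measure_pmf.expectation (poisson_law \<zeta>) (\<lambda>n. avg (bond_lists N n) f)"

text \<open>The Poisson shift, the fixed-size bound and the Chebyshev term. In the fixed-size bound
  n is replaced by \<alpha> N / 2 in denominators and by 2 \<alpha> N under roots, and the
  exponential is the reciprocal of a lower bound for (1 - 1 / N)^(2 n m).\<close>

definition stability_bound :: "real \<Rightarrow> nat \<Rightarrow> nat \<Rightarrow> nat \<Rightarrow> real" where
  "stability_bound \<alpha> m T N = real (Suc m) / sqrt (\<alpha> * real N) + (exp (8 * \<alpha> * real m) *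
     (3 * real (Suc m) * sqrt (real (Suc m) + 2 * (\<alpha> * real N)) * ((2 / \<alpha>) ^ Suc m / real N)
      + 2 * (2 * real m / real N + real m * (real (2 + T + m) / real N))
      + real m * (4 / real N) * sqrt (2 * (\<alpha> * real N))) + 4 / (\<alpha> * real N))"

lemma stability_bound_tendsto_0:
  assumes "\<alpha> > 0"
  shows "(\<lambda>N. stability_bound \<alpha> m T N) \<longlonglongrightarrow> 0"
proof -
  have *: "(\<lambda>N. c1 / sqrt (\<alpha> * real N) + (c2 * (c3 * sqrt (c4 + 2 * (\<alpha> * real N)) * (c5 / real N)
      + 2 * (c6 / real N + c7 * (c8 / real N)) + c9 * (4 / real N) * sqrt (2 * (\<alpha> * real N))) + 4 / (\<alpha> * real N))) \<longlonglongrightarrow> 0"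
    for c1 c2 c3 c4 c5 c6 c7 c8 c9 :: real
    using assms by real_asymp
  show ?thesis unfolding stability_bound_def by (rule *)
qed

text \<open>For x \<le> 1 / 2 one has 1 - x \<ge> exp (-2 x); with x = 1 / N the exponent becomes 4
  n m / N, at most 8 \<alpha> m.\<close>

lemma one_minus_inverse_power_ge:
  assumes "N \<ge> 2" "real n \<le> 2 * (\<alpha> * real N)"
  shows "exp (- (8 * \<alpha> * real m)) \<le> (1 - 1 / real N) ^ (2 * n * m)"
proof -
  let ?x = "1 / real N"
  have x: "0 \<le> ?x" "?x \<le> 1 / 2" using assms(1) by (auto simp: field_simps)
  have "?x * ?x \<le> ?x * (1 / 2)" using x by (intro mult_left_mono) auto
  then have "- (2 * ?x) \<le> - ?x - 2 * ?x\<^sup>2" by (simp add: power2_eq_square)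
  also have "\<dots> \<le> ln (1 - ?x)" using x by (rule ln_one_minus_pos_lower_bound)
  finally have "exp (- (2 * ?x)) \<le> 1 - ?x"
    using x by (subst ln_ge_iff[symmetric]) auto
  then have "exp (- (2 * ?x)) ^ (2 * n * m) \<le> (1 - ?x) ^ (2 * n * m)"
    by (rule power_mono) simp
  moreover have "exp (- (8 * \<alpha> * real m)) \<le> exp (- (2 * ?x)) ^ (2 * n * m)"
  proof -
    have "real n / real N \<le> 2 * \<alpha>" using assms by (simp add: field_simps)
    then have "4 * real m * (real n / real N) \<le> 4 * real m * (2 * \<alpha>)" by (rule mult_left_mono) simp
    then show ?thesis by (simp add: exp_of_nat_mult[symmetric] mult_ac)
  qed
  ultimately show ?thesis by linarith
qed

lemma bonded_average_bounds:
  assumes w: "\<And>\<sigma>. 0 < w \<sigma>" and x: "\<bar>x\<bar> < 1" and p: "even p"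
  shows "0 \<le> bonded_average N (corr_power N p) x w" "bonded_average N (corr_power N p) x w \<le> 1"
proof -
  have w': "0 \<le> w \<sigma> * (1 + x * J * \<sigma> u * \<sigma> v)"
    if "J \<in> {-1, 1 :: real}" "u \<in> {1..N}" "v \<in> {1..N}" "\<sigma> \<in> configs N" for \<sigma> J u v
    by (rule mult_nonneg_nonneg[OF less_imp_le[OF w] less_imp_le[OF tilt_pos[OF that(1,4,2,3) x]]])
  show "0 \<le> bonded_average N (corr_power N p) x w"
    unfolding bonded_average_def by (intro avg_nonneg corr_power_bounds w' p)
  have "\<bar>bonded_average N (corr_power N p) x w\<bar> \<le> 1"
    unfolding bonded_average_def by (intro abs_avg_le_const abs_corr_power_le w' p) auto
  then show "bonded_average N (corr_power N p) x w \<le> 1" by simp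
qed

lemma chain_stability:
  assumes "\<alpha> > 0" and N: "N \<ge> 2" and m: "m \<ge> 1" and B: "finite B" "card B \<le> T"
    and w: "\<And>\<sigma>. 0 < w \<sigma>" and free: "\<And>v. v \<notin> B \<Longrightarrow> spin_free v w" and p: "even p"
  shows "\<bar>size_average (\<alpha> * real N) N (\<lambda>xs. corr_power N p (\<lambda>\<sigma>. w \<sigma> * exp (\<beta> * energy xs \<sigma>)))
     - size_average (\<alpha> * real N) N (\<lambda>xs. bonded_average N (corr_power N p) (tanh \<beta> ^ Suc m)
            (\<lambda>\<sigma>. w \<sigma> * exp (\<beta> * energy xs \<sigma>)))\<bar> \<le> stability_bound \<alpha> m T N"
proof -
  let ?\<zeta> = "\<alpha> * real N"
  have N0: "N > 0" using N by simp
  have z: "?\<zeta> > 0" using assms(1) N0 by simp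
  let ?L = "lists_of (bond_space N)"
  have L: "finite (?L n)" "?L n \<noteq> {}" for n using bond_space_nonempty[of N] N0 by auto
  let ?F = "\<lambda>xs. corr_power N p (\<lambda>\<sigma>. w \<sigma> * exp (\<beta> * energy xs \<sigma>))"
  let ?A = "\<lambda>xs. bonded_average N (corr_power N p) (tanh \<beta> ^ Suc m) (\<lambda>\<sigma>. w \<sigma> * exp (\<beta> * energy xs \<sigma>))"
  have pos: "0 < w \<sigma> * exp (\<beta> * energy xs \<sigma>)" for \<sigma> xs using w[of \<sigma>] by simp
  have t: "\<bar>tanh \<beta> ^ Suc m\<bar> < 1" by (rule abs_tanh_power_less)
  have F: "0 \<le> ?F xs" "?F xs \<le> 1" for xs
    using less_imp_le[OF pos] p by (rule corr_power_bounds)+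
  have A: "0 \<le> ?A xs" "?A xs \<le> 1" for xs
    using pos t p by (rule bonded_average_bounds)+
  define R where "R = 3 * real (Suc m) * sqrt (real (Suc m) + 2 * ?\<zeta>) * ((2 / \<alpha>) ^ Suc m / real N)
      + 2 * (2 * real m / real N + real m * (real (2 + T + m) / real N))
      + real m * (4 / real N) * sqrt (2 * ?\<zeta>)"
  have R0: "0 \<le> R"
    unfolding R_def using assms(1) by (intro add_nonneg_nonneg mult_nonneg_nonneg divide_nonneg_nonneg) auto
  have "\<bar>measure_pmf.expectation (poisson_pmf ?\<zeta>) (\<lambda>n. avg (?L n) ?F) - measure_pmf.expectation (poisson_pmf ?\<zeta>) (\<lambda>n. avg (?L n) ?A)\<bar>
     \<le> real (Suc m) / sqrt ?\<zeta> + (exp (8 * \<alpha> * real m) * R + 4 / ?\<zeta>)"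
  proof (rule poisson_compare[OF z])
    show "0 \<le> avg (?L n) ?F" "0 \<le> avg (?L n) ?A" for n using F A by (auto intro: avg_nonneg)
    show "avg (?L n) ?F \<le> 1" "avg (?L n) ?A \<le> 1" for n using F A L by (auto intro: avg_le_const)
    show "0 \<le> exp (8 * \<alpha> * real m) * R" using R0 by simp
    fix n assume n: "?\<zeta> / 2 \<le> real n" "real n \<le> 2 * ?\<zeta>"
    have n0: "n > 0" using n z by (cases n) auto
    let ?D = "\<bar>avg (?L (Suc m + n)) ?F - avg (?L n) ?A\<bar>"
    have "exp (- (8 * \<alpha> * real m)) * ?D \<le> (1 - 1 / real N) ^ (2 * n * m) * ?D"
      by (intro mult_right_mono one_minus_inverse_power_ge N n) simp
    also have "\<dots> \<le> 3 * real (Suc m) * sqrt (real (Suc m + n)) * real N ^ m / real n ^ Suc m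
      + 2 * (2 * real m / real N + real m * (real (2 + T + m) / real N)) + real m * (4 / real N) * sqrt (real n)"
      by (rule chain_stability_fixed_size[OF N m n0 B w free p])
    also have "\<dots> \<le> R"
      unfolding R_def
    proof (intro add_mono order.refl mult_left_mono)
      have "real N ^ m / real n ^ Suc m \<le> real N ^ m / (?\<zeta> / 2) ^ Suc m"
        using n z n0 by (intro divide_left_mono power_mono) (auto simp: zero_less_mult_iff)
      also have "\<dots> = (2 / \<alpha>) ^ Suc m / real N"
        using assms(1) N0 by (simp add: power_divide power_mult_distrib field_simps)
      finally have "real N ^ m / real n ^ Suc m \<le> (2 / \<alpha>) ^ Suc m / real N" .
      moreover have "sqrt (real (Suc m + n)) \<le> sqrt (real (Suc m) + 2 * ?\<zeta>)"
        using n by simp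
      ultimately have "sqrt (real (Suc m + n)) * (real N ^ m / real n ^ Suc m)
          \<le> sqrt (real (Suc m) + 2 * ?\<zeta>) * ((2 / \<alpha>) ^ Suc m / real N)"
        using z by (intro mult_mono) auto
      from mult_left_mono[OF this, of "3 * real (Suc m)"]
      show "3 * real (Suc m) * sqrt (real (Suc m + n)) * real N ^ m / real n ^ Suc m
          \<le> 3 * real (Suc m) * sqrt (real (Suc m) + 2 * ?\<zeta>) * ((2 / \<alpha>) ^ Suc m / real N)"
        by (simp only: mult.assoc times_divide_eq_right)
      show "sqrt (real n) \<le> sqrt (2 * ?\<zeta>)" using n by simp
    qed simp_all
    finally have "exp (8 * \<alpha> * real m) * (exp (- (8 * \<alpha> * real m)) * ?D) \<le> exp (8 * \<alpha> * real m) * R"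
      by (rule mult_left_mono) simp
    then show "?D \<le> exp (8 * \<alpha> * real m) * R"
      by (simp add: mult.assoc[symmetric] exp_minus)
  qed
  moreover have "poisson_law ?\<zeta> = poisson_pmf ?\<zeta>" by (simp only: poisson_law_def z[THEN less_imp_neq, symmetric] if_False)
  ultimately show ?thesis
    unfolding size_average_def stability_bound_def R_def by (simp only:)
qed

section \<open>Expansion in the strength of an added bond\<close>

text \<open>The combination of the theorem for fixed sites: \<open>a\<close> will be the correlation
  of the ends of the added bond, \<open>b\<close> that of the observed pair and \<open>c\<close>
  that of all four spins, with \<open>p\<close> the number of shared replicas.\<close>

definition replica_poly :: "nat \<Rightarrow> nat \<Rightarrow> real \<Rightarrow> real \<Rightarrow> real \<Rightarrow> real" where
  "replica_poly m n a b c = (\<Sum>p=0..min m n. (-1) ^ (p + 1) * fact (m + n - p - 1) /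
     (fact p * fact (m - p) * fact (n - p)) * (a ^ (m - p) * b ^ (n - p) * c ^ p))"

text \<open>The coefficient of x^m in ((b + x c) / (1 + x a))^n, the n-th power of a correlation
  after a bond has been added.\<close>

definition tilt_coeff :: "nat \<Rightarrow> real \<Rightarrow> real \<Rightarrow> real \<Rightarrow> nat \<Rightarrow> real" where
  "tilt_coeff n a b c m = (\<Sum>p\<le>m. real (n choose p) * b ^ (n - p) * c ^ p *
     (real ((n + (m - p) - 1) choose (m - p)) * (- a) ^ (m - p)))"

lemma negative_binomial_sums:
  fixes z :: real
  assumes "\<bar>z\<bar> < 1" "n \<ge> 1"
  shows "(\<lambda>j. real ((n + j - 1) choose j) * (- z) ^ j) sums (1 / (1 + z) ^ n)"
proof -
  have "(\<lambda>j. (- real n gchoose j) * z ^ j) sums (1 + z) powr (- real n)"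
    using assms(1) by (rule gen_binomial_real)
  moreover have "(- real n gchoose j) * z ^ j = real ((n + j - 1) choose j) * (- z) ^ j" for j
  proof -
    have "(- real n gchoose j) = (-1) ^ j * (real (n + j - 1) gchoose j)"
      using assms(2) by (subst gbinomial_minus) (simp add: of_nat_diff)
    then show ?thesis by (simp add: binomial_gbinomial power_minus[of z])
  qed
  moreover have "(1 + z) powr (- real n) = 1 / (1 + z) ^ n"
    using assms(1) by (simp add: powr_minus powr_realpow inverse_eq_divide)
  ultimately show ?thesis by simp
qed

text \<open>The Cauchy product of the binomial expansion of the numerator with the negative binomial
  series of the denominator.\<close>

lemma tilt_coeff_sums:
  assumes "\<bar>a\<bar> \<le> 1" "\<bar>x\<bar> < 1" "n \<ge> 1"
  shows "(\<lambda>m. tilt_coeff n a b c m * x ^ m) sums (((b + x * c) / (1 + x * a)) ^ n)"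
proof -
  define u where "u p = real (n choose p) * b ^ (n - p) * c ^ p * x ^ p" for p
  define v where "v j = real ((n + j - 1) choose j) * (- (x * a)) ^ j" for j
  have xa: "\<bar>x * a\<bar> < 1"
    using assms by (simp add: abs_mult) (metis abs_ge_zero mult_left_le order_le_less_trans)
  have u0: "u p = 0" if "p \<notin> {..n}" for p using that by (simp add: u_def)
  have us: "u sums (\<Sum>p\<le>n. u p)" by (rule sums_finite) (use u0 in auto)
  have "(\<Sum>p\<le>n. u p) = (b + x * c) ^ n"
    unfolding u_def add.commute[of b] binomial_ring
    by (intro sum.cong refl) (simp add: power_mult_distrib mult_ac)
  with us have us: "u sums ((b + x * c) ^ n)" by simp
  have un: "summable (\<lambda>k. norm (u k))"
    by (rule summable_finite[of "{..n}"]) (use u0 in auto)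
  have vs: "v sums (1 / (1 + x * a) ^ n)"
    unfolding v_def using negative_binomial_sums[OF xa assms(3)] .
  have vn: "summable (\<lambda>k. norm (v k))"
  proof -
    have "(\<lambda>j. real ((n + j - 1) choose j) * (- (- \<bar>x * a\<bar>)) ^ j) sums (1 / (1 + (- \<bar>x * a\<bar>)) ^ n)"
      by (rule negative_binomial_sums) (use xa assms(3) in auto)
    then show ?thesis
      by (simp add: v_def abs_mult power_abs sums_iff)
  qed
  have "(\<lambda>k. \<Sum>i\<le>k. u i * v (k - i)) sums ((\<Sum>k. u k) * (\<Sum>k. v k))"
    by (rule Cauchy_product_sums[OF un vn])
  moreover have "(\<Sum>i\<le>k. u i * v (k - i)) = tilt_coeff n a b c k * x ^ k" for k
    unfolding tilt_coeff_def sum_distrib_right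
  proof (rule sum.cong[OF refl])
    fix i assume "i \<in> {..k}"
    then have "x ^ k = x ^ i * x ^ (k - i)" by (simp flip: power_add)
    moreover have "(- (x * a)) ^ (k - i) = x ^ (k - i) * (- a) ^ (k - i)"
      by (simp flip: power_mult_distrib)
    ultimately show "u i * v (k - i) = real (n choose i) * b ^ (n - i) * c ^ i *
        (real ((n + (k - i) - 1) choose (k - i)) * (- a) ^ (k - i)) * x ^ k"
      by (simp add: u_def v_def mult_ac)
  qed
  moreover have "(\<Sum>k. u k) * (\<Sum>k. v k) = ((b + x * c) / (1 + x * a)) ^ n"
    using us vs by (simp add: sums_iff power_divide)
  ultimately show ?thesis by simp
qed

text \<open>The choice a = -1, b = c = 1 maximises every term and makes all coefficients
  nonnegative. A single coefficient is then bounded by the whole series at x = 1 / 2, whose sum is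
  3^n.\<close>

lemma abs_tilt_coeff_le:
  assumes "\<bar>a\<bar> \<le> 1" "\<bar>b\<bar> \<le> 1" "\<bar>c\<bar> \<le> 1" "n \<ge> 1"
  shows "\<bar>tilt_coeff n a b c m\<bar> \<le> 3 ^ n * 2 ^ m"
proof -
  have nonneg: "0 \<le> tilt_coeff n (- 1) 1 1 k" for k
    unfolding tilt_coeff_def by (intro sum_nonneg) simp
  have "\<bar>tilt_coeff n a b c m\<bar> \<le> tilt_coeff n (- 1) 1 1 m"
    unfolding tilt_coeff_def
  proof (rule order.trans[OF sum_abs sum_mono])
    fix p assume "p \<in> {..m}"
    have "\<bar>b ^ (n - p)\<bar> * \<bar>c ^ p\<bar> * \<bar>a ^ (m - p)\<bar> \<le> 1 * 1 * 1"
      using assms unfolding power_abs by (intro mult_mono power_le_one mult_nonneg_nonneg) auto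
    then have "real (n choose p) * real ((n + (m - p) - 1) choose (m - p)) * (\<bar>b ^ (n - p)\<bar> * \<bar>c ^ p\<bar> * \<bar>a ^ (m - p)\<bar>)
        \<le> real (n choose p) * real ((n + (m - p) - 1) choose (m - p)) * 1"
      by (intro mult_left_mono) auto
    then show "\<bar>real (n choose p) * b ^ (n - p) * c ^ p * (real ((n + (m - p) - 1) choose (m - p)) * (- a) ^ (m - p))\<bar>
        \<le> real (n choose p) * 1 ^ (n - p) * 1 ^ p * (real ((n + (m - p) - 1) choose (m - p)) * (- (- 1)) ^ (m - p))"
      by (simp add: abs_mult power_abs mult_ac)
  qed
  also have "tilt_coeff n (- 1) 1 1 m \<le> 3 ^ n * 2 ^ m"
  proof -
    have s: "(\<lambda>k. tilt_coeff n (- 1) 1 1 k * (1 / 2) ^ k) sums (((1 + (1 / 2) * 1) / (1 + (1 / 2) * (- 1))) ^ n)"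
      by (rule tilt_coeff_sums) (use assms in auto)
    have "(\<Sum>k\<in>{m}. tilt_coeff n (- 1) 1 1 k * (1 / 2) ^ k) \<le> (\<Sum>k. tilt_coeff n (- 1) 1 1 k * (1 / 2) ^ k)"
      using s nonneg by (intro sum_le_suminf) (auto simp: sums_iff)
    also have "\<dots> = 3 ^ n" using s by (simp add: sums_iff)
    finally show ?thesis by (simp add: power_divide field_simps)
  qed
  finally show ?thesis .
qed

text \<open>The tail is dominated by a geometric series of ratio 2 |x|; |x| \<le> 1 / 4 keeps the
  ratio at most 1 / 2 and its sum at most twice the first term.\<close>

lemma tilt_remainder:
  assumes "\<bar>a\<bar> \<le> 1" "\<bar>b\<bar> \<le> 1" "\<bar>c\<bar> \<le> 1" "n \<ge> 1" "\<bar>x\<bar> \<le> 1 / 4"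
  shows "\<bar>((b + x * c) / (1 + x * a)) ^ n - (\<Sum>m<M. tilt_coeff n a b c m * x ^ m)\<bar> \<le> 2 * 3 ^ n * (2 * \<bar>x\<bar>) ^ M"
proof -
  let ?e = "\<lambda>m. tilt_coeff n a b c m * x ^ m"
  let ?y = "2 * \<bar>x\<bar>"
  have y: "0 \<le> ?y" "?y \<le> 1 / 2" "?y < 1" using assms(5) by auto
  have s: "?e sums (((b + x * c) / (1 + x * a)) ^ n)"
    by (rule tilt_coeff_sums) (use assms in auto)
  have t: "(\<lambda>k. ?e (k + M)) sums (((b + x * c) / (1 + x * a)) ^ n - (\<Sum>m<M. ?e m))"
    using sums_split_initial_segment[OF s, of M] .
  have g: "(\<lambda>k. 3 ^ n * ?y ^ M * ?y ^ k) sums (3 ^ n * ?y ^ M * (1 / (1 - ?y)))"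
    by (intro sums_mult geometric_sums) (use y in simp)
  have le: "\<bar>?e (k + M)\<bar> \<le> 3 ^ n * ?y ^ M * ?y ^ k" for k
  proof -
    have "\<bar>?e (k + M)\<bar> \<le> 3 ^ n * 2 ^ (k + M) * \<bar>x\<bar> ^ (k + M)"
      unfolding abs_mult power_abs by (intro mult_right_mono abs_tilt_coeff_le assms) auto
    also have "\<dots> = 3 ^ n * ?y ^ M * ?y ^ k" by (simp add: power_mult_distrib power_add mult_ac)
    finally show ?thesis .
  qed
  have "\<bar>((b + x * c) / (1 + x * a)) ^ n - (\<Sum>m<M. ?e m)\<bar> = \<bar>\<Sum>k. ?e (k + M)\<bar>"
    using t by (simp add: sums_iff)
  also have "\<dots> \<le> (\<Sum>k. \<bar>?e (k + M)\<bar>)"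
    by (rule summable_rabs, rule summable_comparison_test'[of "\<lambda>k. 3 ^ n * ?y ^ M * ?y ^ k" 0])
      (use g le in \<open>auto simp: sums_iff\<close>)
  also have "\<dots> \<le> (\<Sum>k. 3 ^ n * ?y ^ M * ?y ^ k)"
    by (rule suminf_le[OF le], rule summable_comparison_test'[of "\<lambda>k. 3 ^ n * ?y ^ M * ?y ^ k" 0])
      (use g le in \<open>auto simp: sums_iff\<close>)
  also have "\<dots> = 3 ^ n * ?y ^ M * (1 / (1 - ?y))" using g by (simp add: sums_iff)
  also have "\<dots> \<le> 3 ^ n * ?y ^ M * 2"
    using y by (intro mult_left_mono) (auto simp: field_simps)
  finally show ?thesis by (simp add: mult_ac)
qed

lemma tilt_coeff_0: "tilt_coeff n a b c 0 = b ^ n"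
  by (simp add: tilt_coeff_def)

text \<open>The factors (n - 1)! of the two binomial coefficients cancel, leaving one factor n. As
  \<open>m\<close> is even, the sign of (-a)^(m - p) is that of (-1)^p.\<close>

lemma tilt_coeff_even:
  assumes "even m" "n \<ge> 1" "m \<ge> 1"
  shows "tilt_coeff n a b c m = - real n * replica_poly m n a b c"
proof -
  have "tilt_coeff n a b c m = (\<Sum>p\<in>{0..min m n}. real (n choose p) * b ^ (n - p) * c ^ p *
     (real ((n + (m - p) - 1) choose (m - p)) * (- a) ^ (m - p)))"
    unfolding tilt_coeff_def by (rule sum.mono_neutral_right) auto
  also have "\<dots> = (\<Sum>p\<in>{0..min m n}. - real n * ((-1) ^ (p + 1) * fact (m + n - p - 1) /
     (fact p * fact (m - p) * fact (n - p)) * (a ^ (m - p) * b ^ (n - p) * c ^ p)))"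
  proof (rule sum.cong[OF refl])
    fix p assume p: "p \<in> {0..min m n}"
    have sgn: "(- a) ^ (m - p) = (- 1) ^ p * a ^ (m - p)"
      using assms(1) p by (simp add: power_minus[of a] minus_one_power_iff)
    have "fact n = real n * fact (n - 1)" using assms(2) by (simp add: fact_reduce)
    then have c1: "real (n choose p) = real n * fact (n - 1) / (fact p * fact (n - p))"
      using p by (simp add: binomial_fact)
    have e: "m + n - p - 1 - (m - p) = n - 1" "n + (m - p) - 1 = m + n - p - 1" "m - p \<le> m + n - p - 1"
      using p assms(2) by auto
    have c2: "real ((n + (m - p) - 1) choose (m - p)) = fact (m + n - p - 1) / (fact (m - p) * fact (n - 1))"
      using binomial_fact[OF e(3), where 'a = real] unfolding e(1,2) .
    show "real (n choose p) * b ^ (n - p) * c ^ p * (real ((n + (m - p) - 1) choose (m - p)) * (- a) ^ (m - p))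
      = - real n * ((-1) ^ (p + 1) * fact (m + n - p - 1) /
     (fact p * fact (m - p) * fact (n - p)) * (a ^ (m - p) * b ^ (n - p) * c ^ p))"
      unfolding c1 c2 sgn by (simp add: field_simps)
  qed
  finally show ?thesis unfolding replica_poly_def by (simp only: sum_distrib_left)
qed

text \<open>Averaging over the sign of the new bond keeps only the even powers of its strength.\<close>

lemma tilt_symmetrized:
  assumes "\<bar>a\<bar> \<le> 1" "\<bar>b\<bar> \<le> 1" "\<bar>c\<bar> \<le> 1" "n \<ge> 1" "\<bar>x\<bar> \<le> 1 / 4"
  shows "\<bar>avg {-1, 1} (\<lambda>J. ((b + x * J * c) / (1 + x * J * a)) ^ n) - b ^ n
      + real n * (\<Sum>r=1..R. x ^ (2 * r) * replica_poly (2 * r) n a b c)\<bar> \<le> 2 * 3 ^ n * (2 * \<bar>x\<bar>) ^ (2 * R + 2)"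
proof -
  let ?f = "\<lambda>x. ((b + x * c) / (1 + x * a)) ^ n"
  let ?S = "\<lambda>x. \<Sum>m<2 * R + 2. tilt_coeff n a b c m * x ^ m"
  have h: "\<bar>?f y - ?S y\<bar> \<le> 2 * 3 ^ n * (2 * \<bar>x\<bar>) ^ (2 * R + 2)" if "\<bar>y\<bar> = \<bar>x\<bar>" for y
    using tilt_remainder[OF assms(1-4), of y "2 * R + 2"] that assms(5) by simp
  have even: "?S x + ?S (- x) = 2 * (\<Sum>r\<le>R. tilt_coeff n a b c (2 * r) * x ^ (2 * r))"
  proof (induction R)
    case (Suc R)
    have "2 * Suc R + 2 = Suc (Suc (2 * R + 2))" by simp
    then show ?case using Suc by (simp add: algebra_simps)
  \<comment> \<open>The cut-off at exponent 2 R + 2 leaves precisely the even exponents up to 2 R,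
    with a remainder two orders beyond the last of them.\<close>
  qed (simp add: numeral_2_eq_2)
  have "(\<Sum>r\<le>R. tilt_coeff n a b c (2 * r) * x ^ (2 * r))
      = b ^ n + (\<Sum>r=1..R. tilt_coeff n a b c (2 * r) * x ^ (2 * r))"
    by (simp add: atMost_atLeast0 sum.atLeast_Suc_atMost tilt_coeff_0)
  also have "(\<Sum>r=1..R. tilt_coeff n a b c (2 * r) * x ^ (2 * r))
      = - real n * (\<Sum>r=1..R. x ^ (2 * r) * replica_poly (2 * r) n a b c)"
    unfolding sum_distrib_left using assms(4) by (intro sum.cong refl) (simp add: tilt_coeff_even)
  finally have E: "?S x + ?S (- x) = 2 * (b ^ n - real n * (\<Sum>r=1..R. x ^ (2 * r) * replica_poly (2 * r) n a b c))"
    using even by simp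
  have "avg {-1, 1} (\<lambda>J. ((b + x * J * c) / (1 + x * J * a)) ^ n) = (?f x + ?f (- x)) / 2"
    by (simp add: avg_def)
  moreover have "\<bar>(f1 + f2) / 2 - B + t\<bar> \<le> e"
    if "\<bar>f1 - s1\<bar> \<le> e" "\<bar>f2 - s2\<bar> \<le> e" "s1 + s2 = 2 * (B - t)" for f1 f2 s1 s2 e B t :: real
  proof -
    have "(f1 + f2) / 2 - B + t = ((f1 - s1) + (f2 - s2)) / 2" using that(3) by (simp add: field_simps)
    then have "\<bar>(f1 + f2) / 2 - B + t\<bar> = \<bar>(f1 - s1) + (f2 - s2)\<bar> / 2"
      by (simp only: abs_divide abs_numeral)
    also have "\<dots> \<le> (e + e) / 2"
      by (intro divide_right_mono order.trans[OF abs_triangle_ineq add_mono[OF that(1,2)]]) simp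
    also have "(e + e) / 2 = e" by simp
    finally show ?thesis .
  qed
  from this[OF h[OF refl] h[OF abs_minus_cancel] E]
  have "\<bar>(?f x + ?f (- x)) / 2 - b ^ n + real n * (\<Sum>r=1..R. x ^ (2 * r) * replica_poly (2 * r) n a b c)\<bar>
      \<le> 2 * 3 ^ n * (2 * \<bar>x\<bar>) ^ (2 * R + 2)" .
  ultimately show ?thesis by (simp only:)
qed

section \<open>Overlaps and the quenched law\<close>

definition replica_poly_average :: "nat \<Rightarrow> nat \<Rightarrow> nat \<Rightarrow> (config \<Rightarrow> real) \<Rightarrow> real" where
  "replica_poly_average N m n w = avg {1..N} (\<lambda>i. avg {1..N} (\<lambda>j. avg {1..N} (\<lambda>k. avg {1..N} (\<lambda>l.
     replica_poly m n (gibbs_mean N w (spins2 i j)) (gibbs_mean N w (spins2 k l))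
       (gibbs_mean N w (spins4 i j k l))))))"

lemma gibbs_mean_tilt:
  assumes "0 < (\<Sum>\<sigma>\<in>configs N. w \<sigma>)"
  shows "gibbs_mean N (\<lambda>\<sigma>. w \<sigma> * (1 + y * \<sigma> u * \<sigma> v)) (spins2 k l)
    = (gibbs_mean N w (spins2 k l) + y * gibbs_mean N w (spins4 u v k l))
      / (1 + y * gibbs_mean N w (spins2 u v))"
proof -
  let ?Z = "\<Sum>\<sigma>\<in>configs N. w \<sigma>"
  have num: "(\<Sum>\<sigma>\<in>configs N. w \<sigma> * (1 + y * \<sigma> u * \<sigma> v) * (\<sigma> k * \<sigma> l))
     = (\<Sum>\<sigma>\<in>configs N. w \<sigma> * (\<sigma> k * \<sigma> l)) + y * (\<Sum>\<sigma>\<in>configs N. w \<sigma> * (\<sigma> u * \<sigma> v * (\<sigma> k * \<sigma> l)))"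
    unfolding sum_distrib_left sum.distrib[symmetric] by (intro sum.cong refl) (simp add: algebra_simps)
  have den: "(\<Sum>\<sigma>\<in>configs N. w \<sigma> * (1 + y * \<sigma> u * \<sigma> v)) = ?Z + y * (\<Sum>\<sigma>\<in>configs N. w \<sigma> * (\<sigma> u * \<sigma> v))"
    unfolding sum_distrib_left sum.distrib[symmetric] by (intro sum.cong refl) (simp add: algebra_simps)
  have "(A + y * C) / (?Z + y * B) = (A / ?Z + y * (C / ?Z)) / (1 + y * (B / ?Z))" for A B C
  proof -
    have "A / ?Z + y * (C / ?Z) = (A + y * C) / ?Z" "1 + y * (B / ?Z) = (?Z + y * B) / ?Z"
      using assms by (simp_all add: add_divide_distrib)
    then show ?thesis using assms by simp
  qed
  then show ?thesis unfolding gibbs_mean_def num den by blast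
qed

lemma sum_weights_pos: "(\<And>\<sigma>. 0 < w \<sigma>) \<Longrightarrow> 0 < (\<Sum>\<sigma>\<in>configs N. w \<sigma> :: real)"
  by (rule sum_pos) (auto simp: configs_nonempty)

lemma abs_gibbs_mean_four_spin_le:
  assumes "\<And>\<sigma>. 0 < w \<sigma>" "i \<in> {1..N}" "j \<in> {1..N}" "k \<in> {1..N}" "l \<in> {1..N}"
  shows "\<bar>gibbs_mean N w (spins4 i j k l)\<bar> \<le> 1"
  by (rule abs_gibbs_mean_le)
    (use assms in \<open>simp_all add: less_imp_le abs_mult configs_spin_abs\<close>)

lemma avg_swap_inner:
  "avg A (\<lambda>J. avg B (\<lambda>u. avg C (\<lambda>v. avg D (\<lambda>k. avg E (f J u v k)))))
   = avg B (\<lambda>u. avg C (\<lambda>v. avg D (\<lambda>k. avg E (\<lambda>l. avg A (\<lambda>J. f J u v k l)))))"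
proof -
  have "avg A (\<lambda>J. avg B (\<lambda>u. avg C (\<lambda>v. avg D (\<lambda>k. avg E (f J u v k)))))
    = avg B (\<lambda>u. avg A (\<lambda>J. avg C (\<lambda>v. avg D (\<lambda>k. avg E (f J u v k)))))" by (rule avg_swap)
  also have "\<dots> = avg B (\<lambda>u. avg C (\<lambda>v. avg A (\<lambda>J. avg D (\<lambda>k. avg E (f J u v k)))))"
    by (intro avg_cong refl avg_swap)
  also have "\<dots> = avg B (\<lambda>u. avg C (\<lambda>v. avg D (\<lambda>k. avg A (\<lambda>J. avg E (f J u v k)))))"
    by (intro avg_cong refl avg_swap)
  also have "\<dots> = avg B (\<lambda>u. avg C (\<lambda>v. avg D (\<lambda>k. avg E (\<lambda>l. avg A (\<lambda>J. f J u v k l)))))"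
    by (intro avg_cong refl avg_swap)
  finally show ?thesis .
qed

lemma bonded_average_expansion:
  assumes N: "N > 0" and w: "\<And>\<sigma>. 0 < w \<sigma>" and n: "n \<ge> 1" and x: "\<bar>x\<bar> \<le> 1 / 4"
  shows "\<bar>bonded_average N (corr_power N n) x w - corr_power N n w
      + real n * (\<Sum>r=1..R. x ^ (2 * r) * replica_poly_average N (2 * r) n w)\<bar>
    \<le> 2 * 3 ^ n * (2 * \<bar>x\<bar>) ^ (2 * R + 2)"
proof -
  let ?S = "{1..N}"
  let ?a = "\<lambda>u v. gibbs_mean N w (spins2 u v)"
  let ?c = "\<lambda>u v k l. gibbs_mean N w (spins4 u v k l)"
  let ?Q = "\<lambda>f. avg ?S (\<lambda>u. avg ?S (\<lambda>v. avg ?S (\<lambda>k. avg ?S (f u v k))))"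
  have S: "finite ?S" "?S \<noteq> {}" using N by auto
  have 1: "bonded_average N (corr_power N n) x w
     = ?Q (\<lambda>u v k l. avg {-1, 1} (\<lambda>J. ((?a k l + x * J * ?c u v k l) / (1 + x * J * ?a u v)) ^ n))"
    unfolding bonded_average_def corr_power_def gibbs_mean_tilt[OF sum_weights_pos[OF w]]
    by (rule avg_swap_inner)
  have 2: "corr_power N n w = ?Q (\<lambda>u v k l. ?a k l ^ n)"
    unfolding corr_power_def using S by simp
  have 3: "real n * (\<Sum>r=1..R. x ^ (2 * r) * replica_poly_average N (2 * r) n w)
     = ?Q (\<lambda>u v k l. real n * (\<Sum>r=1..R. x ^ (2 * r) * replica_poly (2 * r) n (?a u v) (?a k l) (?c u v k l)))"
    unfolding replica_poly_average_def avg_cmult avg_sum by (rule refl)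
  show ?thesis
    unfolding 1 2 3 avg_diff[symmetric] avg_add[symmetric]
  proof (intro abs_avg_le_const)
    fix u v k l assume h: "u \<in> ?S" "v \<in> ?S" "k \<in> ?S" "l \<in> ?S"
    have w': "0 \<le> w \<sigma>" for \<sigma> using w[of \<sigma>] by simp
    have a: "\<bar>?a i j\<bar> \<le> 1" if "i \<in> ?S" "j \<in> ?S" for i j
      using w' that by (rule abs_gibbs_mean_two_spin_le)
    have c: "\<bar>?c u v k l\<bar> \<le> 1" using w h by (rule abs_gibbs_mean_four_spin_le)
    show "\<bar>avg {-1, 1} (\<lambda>J. ((?a k l + x * J * ?c u v k l) / (1 + x * J * ?a u v)) ^ n) - ?a k l ^ n
      + real n * (\<Sum>r=1..R. x ^ (2 * r) * replica_poly (2 * r) n (?a u v) (?a k l) (?c u v k l))\<bar>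
      \<le> 2 * 3 ^ n * (2 * \<bar>x\<bar>) ^ (2 * R + 2)"
      using a[OF h(1,2)] a[OF h(3,4)] c n x by (rule tilt_symmetrized)
  qed simp_all
qed

section \<open>From replica averages to products of Gibbs means\<close>

lemma expectation_gibbs:
  fixes f :: "config \<Rightarrow> real"
  shows "measure_pmf.expectation (gibbs N \<beta> \<beta>1 \<beta>2 \<xi>) f = gibbs_mean N (boltzmann_weight \<beta> \<beta>1 \<beta>2 \<xi>) f"
proof -
  have "measure_pmf.expectation (gibbs N \<beta> \<beta>1 \<beta>2 \<xi>) f
     = (\<Sum>\<sigma>\<in>configs N. f \<sigma> * pmf (gibbs N \<beta> \<beta>1 \<beta>2 \<xi>) \<sigma>)"
    by (rule integral_measure_pmf_real[OF finite_configs]) (simp add: set_pmf_gibbs)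
  also have "\<dots> = (\<Sum>\<sigma>\<in>configs N. boltzmann_weight \<beta> \<beta>1 \<beta>2 \<xi> \<sigma> * f \<sigma> / partition_function N \<beta> \<beta>1 \<beta>2 \<xi>)"
    by (intro sum.cong refl) (simp add: pmf_gibbs)
  finally show ?thesis
    by (simp add: gibbs_mean_def partition_function_def sum_divide_distrib)
qed

lemma expectation_prod_replicas:
  fixes g :: "nat \<Rightarrow> config \<Rightarrow> real"
  shows "measure_pmf.expectation (replicas N \<beta> \<beta>1 \<beta>2 \<xi> k) (\<lambda>s. \<Prod>l\<in>{1..k}. g l (s l))
    = (\<Prod>l\<in>{1..k}. gibbs_mean N (boltzmann_weight \<beta> \<beta>1 \<beta>2 \<xi>) (g l))"
proof -
  let ?G = "gibbs N \<beta> \<beta>1 \<beta>2 \<xi>"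
  let ?P = "Pi_pmf {1..k} undefined (\<lambda>_. ?G)"
  have fin: "finite (set_pmf ?P)"
    by (simp add: set_Pi_pmf set_pmf_gibbs comp_def finite_PiE_dflt)
  have ind: "prob_space.indep_vars (measure_pmf ?P) (\<lambda>_. borel) (\<lambda>l s. g l (s l)) {1..k}"
    by (rule prob_space.indep_vars_compose2[OF measure_pmf.prob_space_axioms indep_vars_Pi_pmf]) auto
  have "measure_pmf.expectation ?P (\<lambda>s. \<Prod>l\<in>{1..k}. g l (s l)) = (\<Prod>l\<in>{1..k}. measure_pmf.expectation ?P (\<lambda>s. g l (s l)))"
    by (rule prob_space.indep_vars_lebesgue_integral[OF measure_pmf.prob_space_axioms _ ind]) (use integrable_measure_pmf_finite[OF fin] in auto)
  also have "\<dots> = (\<Prod>l\<in>{1..k}. measure_pmf.expectation ?G (g l))"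
  proof (rule prod.cong[OF refl])
    fix l assume "l \<in> {1..k}"
    then have "map_pmf (\<lambda>s. s l) ?P = ?G" by (simp add: Pi_pmf_component)
    then show "measure_pmf.expectation ?P (\<lambda>s. g l (s l)) = measure_pmf.expectation ?G (g l)"
      by (metis integral_map_pmf)
  qed
  finally show ?thesis by (simp only: replicas_def expectation_gibbs)
qed

lemma integrable_replicas:
  fixes f :: "(nat \<Rightarrow> config) \<Rightarrow> real"
  shows "integrable (replicas N \<beta> \<beta>1 \<beta>2 \<xi> k) f"
  by (rule integrable_measure_pmf_finite)
    (simp add: replicas_def set_Pi_pmf set_pmf_gibbs comp_def finite_PiE_dflt)

lemma integral_avg:
  assumes "\<And>x. x \<in> A \<Longrightarrow> integrable M (f x)"
  shows "(\<integral>\<omega>. avg A (\<lambda>x. f x \<omega>) \<partial>M) = avg A (\<lambda>x. \<integral>\<omega>. f x \<omega> \<partial>M)"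
  unfolding avg_def using assms by simp

lemma overlap_sq: "(overlap N R s)\<^sup>2 = avg {1..N} (\<lambda>i. avg {1..N} (\<lambda>j. \<Prod>l\<in>R. s l i * s l j))"
proof -
  have "overlap N R s = avg {1..N} (\<lambda>i. \<Prod>l\<in>R. s l i)" by (simp add: overlap_def avg_def)
  then show ?thesis
    by (simp add: power2_eq_square prod.distrib avg_cmult avg_multc)
qed

text \<open>The squared overlaps expand into sums over site pairs i, j and k, l. For fixed sites the
  replicas are independent: the \<open>p\<close> shared ones each give a four-spin mean, the others
  of the first overlap the pair i, j, and those of the second the pair k, l.\<close>

lemma expectation_overlaps:
  assumes p: "p \<le> min m n"
  shows "measure_pmf.expectation (replicas N \<beta> \<beta>1 \<beta>2 \<xi> (m + n - p))
      (\<lambda>s. (overlap N {1..m} s)\<^sup>2 * (overlap N ({1..p} \<union> {m + 1..m + n - p}) s)\<^sup>2)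
    = avg {1..N} (\<lambda>i. avg {1..N} (\<lambda>j. avg {1..N} (\<lambda>k. avg {1..N} (\<lambda>l.
        gibbs_mean N (boltzmann_weight \<beta> \<beta>1 \<beta>2 \<xi>) (spins2 i j) ^ (m - p) *
        gibbs_mean N (boltzmann_weight \<beta> \<beta>1 \<beta>2 \<xi>) (spins2 k l) ^ (n - p) *
        gibbs_mean N (boltzmann_weight \<beta> \<beta>1 \<beta>2 \<xi>) (spins4 i j k l) ^ p))))"
proof -
  let ?K = "m + n - p" and ?R = "{1..p} \<union> {m + 1..m + n - p}"
  let ?M = "replicas N \<beta> \<beta>1 \<beta>2 \<xi> ?K" and ?g = "gibbs_mean N (boltzmann_weight \<beta> \<beta>1 \<beta>2 \<xi>)"
  let ?f = "\<lambda>i j k l s. (\<Prod>x\<in>{1..m}. s x i * s x j) * (\<Prod>x\<in>?R. s x k * s x l) :: real"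
  have "(\<lambda>s. (overlap N {1..m} s)\<^sup>2 * (overlap N ?R s)\<^sup>2)
     = (\<lambda>s. avg {1..N} (\<lambda>i. avg {1..N} (\<lambda>j. avg {1..N} (\<lambda>k. avg {1..N} (\<lambda>l. ?f i j k l s)))))"
    unfolding overlap_sq avg_cmult avg_multc by (rule refl)
  then have "measure_pmf.expectation ?M (\<lambda>s. (overlap N {1..m} s)\<^sup>2 * (overlap N ?R s)\<^sup>2)
     = avg {1..N} (\<lambda>i. avg {1..N} (\<lambda>j. avg {1..N} (\<lambda>k. avg {1..N} (\<lambda>l. measure_pmf.expectation ?M (?f i j k l)))))"
    by (simp only: integral_avg[OF integrable_replicas])
  moreover have "measure_pmf.expectation ?M (?f i j k l)
     = ?g (spins2 i j) ^ (m - p) * ?g (spins2 k l) ^ (n - p) * ?g (spins4 i j k l) ^ p"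
    for i j k l
  proof -
    define h where "h x = (if x \<le> p then (\<lambda>\<sigma> :: config. \<sigma> i * \<sigma> j * (\<sigma> k * \<sigma> l))
       else if x \<le> m then (spins2 i j) else (spins2 k l))" for x :: nat
    have split: "(\<Prod>x\<in>{1..?K}. F x) = (\<Prod>x\<in>{1..p}. F x) * (\<Prod>x\<in>{p + 1..m}. F x) * (\<Prod>x\<in>{m + 1..?K}. F x)"
      for F :: "nat \<Rightarrow> real"
    proof -
      have 1: "{1..?K} = {1..p} \<union> {p + 1..m} \<union> {m + 1..?K}" using p by auto
      show ?thesis unfolding 1
      proof (subst prod.union_disjoint)
        show "({1..p} \<union> {p + 1..m}) \<inter> {m + 1..?K} = {}" using p by auto
        show "(\<Prod>x\<in>{1..p} \<union> {p + 1..m}. F x) * (\<Prod>x\<in>{m + 1..?K}. F x)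
          = (\<Prod>x\<in>{1..p}. F x) * (\<Prod>x\<in>{p + 1..m}. F x) * (\<Prod>x\<in>{m + 1..?K}. F x)"
          by (subst prod.union_disjoint) auto
      qed simp_all
    qed
    have "?f i j k l s = (\<Prod>x\<in>{1..?K}. h x (s x))" for s
    proof -
      have 1: "{1..m} = {1..p} \<union> {p + 1..m}" using p by auto
      have "(\<Prod>x\<in>{1..m}. s x i * s x j) = (\<Prod>x\<in>{1..p}. s x i * s x j) * (\<Prod>x\<in>{p + 1..m}. s x i * s x j)"
        unfolding 1 by (rule prod.union_disjoint) auto
      moreover have "(\<Prod>x\<in>?R. s x k * s x l) = (\<Prod>x\<in>{1..p}. s x k * s x l) * (\<Prod>x\<in>{m + 1..?K}. s x k * s x l)"
        by (rule prod.union_disjoint) (use p in auto)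
      moreover have "(\<Prod>x\<in>{1..p}. h x (s x)) = (\<Prod>x\<in>{1..p}. s x i * s x j) * (\<Prod>x\<in>{1..p}. s x k * s x l)"
        unfolding prod.distrib[symmetric] by (intro prod.cong refl) (simp add: h_def)
      moreover have "(\<Prod>x\<in>{p + 1..m}. h x (s x)) = (\<Prod>x\<in>{p + 1..m}. s x i * s x j)"
        by (intro prod.cong refl) (simp add: h_def)
      moreover have "(\<Prod>x\<in>{m + 1..?K}. h x (s x)) = (\<Prod>x\<in>{m + 1..?K}. s x k * s x l)"
        using p by (intro prod.cong refl) (simp add: h_def)
      ultimately show ?thesis unfolding split by (simp only: mult_ac)
    qed
    then have "measure_pmf.expectation ?M (?f i j k l) = (\<Prod>x\<in>{1..?K}. ?g (h x))"
      by (simp only: expectation_prod_replicas)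
    also have "\<dots> = ?g (spins4 i j k l) ^ p * ?g (spins2 i j) ^ (m - p) * ?g (spins2 k l) ^ (n - p)"
    proof -
      have "(\<Prod>x\<in>{1..p}. ?g (h x)) = (\<Prod>x\<in>{1..p}. ?g (spins4 i j k l))"
        by (intro prod.cong refl arg_cong[of _ _ ?g] ext) (simp add: h_def)
      moreover have "(\<Prod>x\<in>{p + 1..m}. ?g (h x)) = (\<Prod>x\<in>{p + 1..m}. ?g (spins2 i j))"
        by (intro prod.cong refl arg_cong[of _ _ ?g] ext) (simp add: h_def)
      moreover have "(\<Prod>x\<in>{m + 1..?K}. ?g (h x)) = (\<Prod>x\<in>{m + 1..?K}. ?g (spins2 k l))"
        using p by (intro prod.cong refl arg_cong[of _ _ ?g] ext) (simp add: h_def)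
      moreover have "?K - m = n - p" using p by simp
      ultimately show ?thesis unfolding split by simp
    qed
    finally show ?thesis by (simp only: mult_ac)
  qed
  ultimately show ?thesis by simp
qed

lemma sum_overlap_sq_average:
  "(\<Sum>p=0..min m n. (-1) ^ (p + 1) * fact (m + n - p - 1) / (fact p * fact (m - p) * fact (n - p))
      * overlap_sq_average N \<alpha> \<beta> \<alpha>1 \<beta>1 \<alpha>2 \<beta>2 m n p)
    = (\<integral>\<xi>. replica_poly_average N m n (boltzmann_weight \<beta> \<beta>1 \<beta>2 \<xi>) \<partial>quenched_law N \<alpha> \<alpha>1 \<alpha>2)"
  and integrable_replica_poly_average:
  "integrable (quenched_law N \<alpha> \<alpha>1 \<alpha>2) (\<lambda>\<xi>. replica_poly_average N m n (boltzmann_weight \<beta> \<beta>1 \<beta>2 \<xi>))"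
proof -
  let ?c = "\<lambda>p. (-1) ^ (p + 1) * fact (m + n - p - 1) / (fact p * fact (m - p) * fact (n - p)) :: real"
  let ?F = "\<lambda>p \<xi>. measure_pmf.expectation (replicas N \<beta> \<beta>1 \<beta>2 \<xi> (m + n - p))
      (\<lambda>s. (overlap N {1..m} s)\<^sup>2 * (overlap N ({1..p} \<union> {m + 1..m + n - p}) s)\<^sup>2)"
  have eq: "replica_poly_average N m n (boltzmann_weight \<beta> \<beta>1 \<beta>2 \<xi>) = (\<Sum>p=0..min m n. ?c p * ?F p \<xi>)" for \<xi>
    unfolding replica_poly_average_def replica_poly_def avg_sum
  proof (rule sum.cong[OF refl])
    fix p assume "p \<in> {0..min m n}"
    then have p: "p \<le> min m n" by simp
    show "avg {1..N} (\<lambda>i. avg {1..N} (\<lambda>j. avg {1..N} (\<lambda>k. avg {1..N} (\<lambda>l. ?c p *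
        (gibbs_mean N (boltzmann_weight \<beta> \<beta>1 \<beta>2 \<xi>) (spins2 i j) ^ (m - p) *
        gibbs_mean N (boltzmann_weight \<beta> \<beta>1 \<beta>2 \<xi>) (spins2 k l) ^ (n - p) *
        gibbs_mean N (boltzmann_weight \<beta> \<beta>1 \<beta>2 \<xi>) (spins4 i j k l) ^ p)))))
      = ?c p * ?F p \<xi>"
      unfolding expectation_overlaps[OF p] avg_cmult by (rule refl)
  qed
  have i: "integrable (quenched_law N \<alpha> \<alpha>1 \<alpha>2) (\<lambda>\<xi>. ?c p * ?F p \<xi>)" for p
    by (intro integrable_mult_right integrable_quenched_average)
  show "integrable (quenched_law N \<alpha> \<alpha>1 \<alpha>2) (\<lambda>\<xi>. replica_poly_average N m n (boltzmann_weight \<beta> \<beta>1 \<beta>2 \<xi>))"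
    unfolding eq by (intro Bochner_Integration.integrable_sum i)
  show "(\<Sum>p=0..min m n. ?c p * overlap_sq_average N \<alpha> \<beta> \<alpha>1 \<beta>1 \<alpha>2 \<beta>2 m n p)
    = (\<integral>\<xi>. replica_poly_average N m n (boltzmann_weight \<beta> \<beta>1 \<beta>2 \<xi>) \<partial>quenched_law N \<alpha> \<alpha>1 \<alpha>2)"
    unfolding eq overlap_sq_average_def quenched_average_def
    by (subst Bochner_Integration.integral_sum[OF i]) simp
qed

section \<open>The quenched law as an average over finite bond lists\<close>

definition bond_list :: "bonds \<Rightarrow> bond list" where
  "bond_list b = map (snd b) [0..<fst b]"

lemma bond_sum_eq_energy: "bond_sum b \<sigma> = energy (bond_list b) \<sigma>"
  unfolding bond_sum_def energy_def bond_list_def map_map comp_def interv_sum_list_conv_sum_set_nat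
  by (simp add: atLeast0LessThan)

lemma pmf_bond_law:
  assumes "x \<in> bond_space N"
  shows "pmf (bond_law N) x = 1 / real (card (bond_space N))"
proof -
  obtain J i j where x: "x = (J, i, j)" by (cases x) auto
  have "J \<in> {-1, 1}" and ij: "i \<in> {1..N}" "j \<in> {1..N}" using assms by (auto simp: x bond_space_def)
  then have "pmf (pmf_of_set {-1, 1 :: real}) J = 1 / 2" by (subst pmf_of_set) auto
  moreover have "pmf (pmf_of_set {1..N}) k = 1 / real N" if "k \<in> {1..N}" for k
    using that by (subst pmf_of_set) auto
  ultimately show ?thesis
    using ij by (simp add: bond_law_def x pmf_pair card_bond_space power2_eq_square)
qed

abbreviation bond_sequences :: "nat \<Rightarrow> (nat \<Rightarrow> bond) measure" where
  "bond_sequences N \<equiv> \<Pi>\<^sub>M \<nu>\<in>UNIV. measure_pmf (bond_law N)"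

lemma measure_bond_sequences:
  assumes "xs \<in> bond_lists N n"
  shows "{e \<in> space (bond_sequences N). map e [0..<n] = xs} \<in> sets (bond_sequences N)" (is "?A \<in> _")
    and "measure (bond_sequences N) {e \<in> space (bond_sequences N). map e [0..<n] = xs} = 1 / real (card (bond_space N)) ^ n"
proof -
  interpret product_prob_space "\<lambda>_. measure_pmf (bond_law N)" UNIV ..
  have len: "length xs = n" using assms by (rule length_lists_of)
  have eq: "?A = {e \<in> space (bond_sequences N). \<forall>i\<in>{..<n}. e i \<in> {xs ! i}}"
    using len by (auto simp: list_eq_iff_nth_eq)
  show "?A \<in> sets (bond_sequences N)"
    unfolding eq by (intro sets.sets_Collect_finite_All sets_Collect_single) auto
  have "emeasure (bond_sequences N) ?A = (\<Prod>i\<in>{..<n}. emeasure (measure_pmf (bond_law N)) {xs ! i})"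
    unfolding eq by (rule emeasure_PiM_Collect) auto
  also have "\<dots> = (\<Prod>i\<in>{..<n}. ennreal (1 / real (card (bond_space N))))"
  proof (rule prod.cong[OF refl])
    fix i assume "i \<in> {..<n}"
    then have "xs ! i \<in> bond_space N" using assms nth_mem[of i xs] unfolding lists_of_def by auto
    then show "emeasure (measure_pmf (bond_law N)) {xs ! i} = ennreal (1 / real (card (bond_space N)))"
      by (simp add: emeasure_pmf_single pmf_bond_law)
  qed
  also have "\<dots> = ennreal (1 / real (card (bond_space N)) ^ n)"
    by (simp add: ennreal_power power_one_over)
  finally show "measure (bond_sequences N) ?A = 1 / real (card (bond_space N)) ^ n"
    by (simp add: measure_def)
qed

text \<open>The first \<open>n\<close> entries are uniform on \<open>bond_lists N n\<close>: the
  cylinder sets of these lists have equal measure and total measure 1, so \<open>g\<close> agrees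
  almost everywhere with a finite step function.\<close>

lemma integral_bond_sequences:
  fixes g :: "(nat \<Rightarrow> bond) \<Rightarrow> real"
  assumes N: "N > 0" and g: "g \<in> borel_measurable (bond_sequences N)" and G: "\<And>e. g e = G (map e [0..<n])"
  shows "(\<integral>e. g e \<partial>bond_sequences N) = avg (bond_lists N n) G"
proof -
  let ?Q = "bond_sequences N" and ?L = "bond_lists N n"
  let ?A = "\<lambda>xs. {e \<in> space ?Q. map e [0..<n] = xs}"
  interpret prob_space ?Q by (intro prob_space_PiM measure_pmf.prob_space_axioms)
  have L: "finite ?L" by simp
  have c: "real (card ?L) = real (card (bond_space N)) ^ n" "card (bond_space N) > 0"
    using N by (simp_all add: card_lists_of card_bond_space)
  have sm: "(\<lambda>e. \<Sum>xs\<in>?L. indicator (?A xs) e * G xs) \<in> borel_measurable ?Q"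
    by (intro borel_measurable_sum borel_measurable_times borel_measurable_indicator borel_measurable_const
        measure_bond_sequences(1))
  have "prob (\<Union>xs\<in>?L. ?A xs) = (\<Sum>xs\<in>?L. prob (?A xs))"
    by (rule finite_measure_finite_Union[OF L]) (auto simp: disjoint_family_on_def intro: measure_bond_sequences)
  also have "\<dots> = 1"
    using c bond_space_nonempty[of N] N by (simp add: measure_bond_sequences(2))
  finally have "AE e in ?Q. e \<in> (\<Union>xs\<in>?L. ?A xs)" by (rule AE_prob_1)
  then have "AE e in ?Q. g e = (\<Sum>xs\<in>?L. indicator (?A xs) e * G xs)"
  proof eventually_elim
    case (elim e)
    then have e: "map e [0..<n] \<in> ?L" "e \<in> space ?Q" by auto
    have "(\<Sum>xs\<in>?L. indicator (?A xs) e * G xs) = (\<Sum>xs\<in>?L. if xs = map e [0..<n] then G xs else 0)"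
      using e(2) by (intro sum.cong refl) (auto simp: indicator_def)
    then show ?case using e(1) by (simp add: G)
  qed
  then have "(\<integral>e. g e \<partial>?Q) = (\<integral>e. (\<Sum>xs\<in>?L. indicator (?A xs) e * G xs) \<partial>?Q)"
    by (rule integral_cong_AE[OF g sm])
  also have "\<dots> = (\<Sum>xs\<in>?L. \<integral>e. indicator (?A xs) e * G xs \<partial>?Q)"
    by (rule Bochner_Integration.integral_sum)
      (use measure_bond_sequences(1) in \<open>auto intro!: integrable_mult_left integrable_real_indicator simp: emeasure_eq_measure\<close>)
  also have "\<dots> = (\<Sum>xs\<in>?L. G xs / real (card ?L))"
  proof (rule sum.cong[OF refl])
    fix xs assume xs: "xs \<in> ?L"
    have "(\<integral>e. indicator (?A xs) e * G xs \<partial>?Q) = prob (?A xs) * G xs"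
      using measure_bond_sequences(1)[OF xs] by simp
    then show "(\<integral>e. indicator (?A xs) e * G xs \<partial>?Q) = G xs / real (card ?L)"
      using measure_bond_sequences(2)[OF xs] c(1) by simp
  qed
  finally show ?thesis by (simp add: avg_def sum_divide_distrib)
qed

lemma integral_bonds_law:
  fixes g :: "bonds \<Rightarrow> real"
  assumes N: "N > 0" and g: "g \<in> borel_measurable (bonds_law N \<zeta>)" and C: "\<And>b. \<bar>g b\<bar> \<le> C"
    and G: "\<And>b. g b = G (bond_list b)"
  shows "(\<integral>b. g b \<partial>bonds_law N \<zeta>) = size_average \<zeta> N G"
proof -
  let ?Q = "bond_sequences N" and ?P = "measure_pmf (poisson_law \<zeta>)"
  interpret Q: prob_space ?Q by (intro prob_space_PiM measure_pmf.prob_space_axioms)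
  interpret pair_prob_space ?P ?Q ..
  have int: "integrable (?P \<Otimes>\<^sub>M ?Q) (case_prod (\<lambda>n e. g (n, e)))"
    using g C by (intro integrable_const_bound[where B = C]) (auto simp: bonds_law_def)
  have inner: "(\<integral>e. g (n, e) \<partial>?Q) = avg (bond_lists N n) G" for n
  proof (rule integral_bond_sequences[OF N])
    show "(\<lambda>e. g (n, e)) \<in> borel_measurable ?Q"
      by (rule measurable_Pair2[of g ?P]) (use g in \<open>auto simp: bonds_law_def\<close>)
    show "g (n, e) = G (map e [0..<n])" for e by (simp add: G bond_list_def)
  qed
  have "(\<integral>b. g b \<partial>bonds_law N \<zeta>) = (\<integral>n. (\<integral>e. g (n, e) \<partial>?Q) \<partial>?P)"
    using integral_fst[OF int] by (simp add: bonds_law_def)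
  also have "\<dots> = (\<integral>n. avg (bond_lists N n) G \<partial>?P)"
    by (simp only: inner)
  finally show ?thesis by (simp add: size_average_def)
qed

text \<open>Fubini, with the Viana-Bray bonds innermost, so that chain stability can be applied for
  fixed perturbation bonds.\<close>

lemma integral_quenched_law:
  fixes h :: "bonds \<times> bonds \<times> bonds \<Rightarrow> real"
  assumes N: "N > 0" and h: "h \<in> borel_measurable (quenched_law N \<alpha> \<alpha>1 \<alpha>2)" and C: "\<And>\<xi>. \<bar>h \<xi>\<bar> \<le> C"
    and H: "\<And>b b\<^sub>1 b\<^sub>2. h (b, b\<^sub>1, b\<^sub>2) = H (bond_list b) (bond_list b\<^sub>1) (bond_list b\<^sub>2)"
  shows "(\<integral>\<xi>. h \<xi> \<partial>quenched_law N \<alpha> \<alpha>1 \<alpha>2)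
    = size_average \<alpha>1 N (\<lambda>z1. size_average \<alpha>2 N (\<lambda>z2. size_average (\<alpha> * real N) N (\<lambda>z. H z z1 z2)))"
proof -
  let ?M = "bonds_law N (\<alpha> * real N)" and ?M1 = "bonds_law N \<alpha>1" and ?M2 = "bonds_law N \<alpha>2"
  interpret M: prob_space ?M by (rule prob_space_bonds_law)
  interpret M1: prob_space ?M1 by (rule prob_space_bonds_law)
  interpret M2: prob_space ?M2 by (rule prob_space_bonds_law)
  interpret P: pair_prob_space ?M1 ?M2 ..
  interpret PP: pair_prob_space ?M "?M1 \<Otimes>\<^sub>M ?M2" ..
  define k where "k b' = (\<integral>b. h (b, b') \<partial>?M)" for b'
  have hm: "h \<in> borel_measurable (?M \<Otimes>\<^sub>M (?M1 \<Otimes>\<^sub>M ?M2))" using h by (simp add: quenched_law_def)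
  have int: "integrable (?M \<Otimes>\<^sub>M (?M1 \<Otimes>\<^sub>M ?M2)) (case_prod (\<lambda>b b'. h (b, b')))"
    using hm C by (intro PP.integrable_const_bound[where B = C]) auto
  have k: "k (b1, b2) = size_average (\<alpha> * real N) N (\<lambda>z. H z (bond_list b1) (bond_list b2))"
    if "b1 \<in> space ?M1" "b2 \<in> space ?M2" for b1 b2
    unfolding k_def
  proof (rule integral_bonds_law[OF N _ C])
    show "(\<lambda>b. h (b, b1, b2)) \<in> borel_measurable ?M"
      by (rule measurable_Pair1[OF hm]) (use that in \<open>simp add: space_pair_measure\<close>)
  qed (rule H)
  have sp: "space (bonds_law N \<zeta>) = UNIV" for \<zeta>
    by (auto simp: bonds_law_def space_pair_measure space_PiM PiE_def extensional_def)
  have kC: "\<bar>k b'\<bar> \<le> C" for b'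
  proof -
    have C0: "0 \<le> C" using C abs_ge_zero order_trans by blast
    have "(\<lambda>b. h (b, b')) \<in> borel_measurable ?M"
      by (rule measurable_Pair1[OF hm]) (cases b', simp add: space_pair_measure sp)
    then have i: "integrable ?M (\<lambda>b. h (b, b'))"
      using C by (intro M.integrable_const_bound[where B = C]) auto
    have "\<bar>k b'\<bar> \<le> (\<integral>b. \<bar>h (b, b')\<bar> \<partial>?M)" unfolding k_def by (rule integral_abs_bound)
    also have "\<dots> \<le> C" by (rule M.integral_le_const) (use i C in auto)
    finally show ?thesis .
  qed
  have km: "k \<in> borel_measurable (?M1 \<Otimes>\<^sub>M ?M2)"
    unfolding k_def
    by (rule M.borel_measurable_lebesgue_integral) (use measurable_pair_swap[OF hm] in \<open>simp add: case_prod_beta'\<close>)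
  have intk: "integrable (?M1 \<Otimes>\<^sub>M ?M2) (case_prod (\<lambda>b1 b2. k (b1, b2)))"
    using km kC by (intro P.integrable_const_bound[where B = C]) auto
  have "(\<integral>\<xi>. h \<xi> \<partial>quenched_law N \<alpha> \<alpha>1 \<alpha>2) = (\<integral>b'. k b' \<partial>(?M1 \<Otimes>\<^sub>M ?M2))"
    using PP.integral_snd[OF int] by (simp add: quenched_law_def k_def)
  also have "\<dots> = (\<integral>b1. (\<integral>b2. k (b1, b2) \<partial>?M2) \<partial>?M1)"
    using P.integral_fst[OF intk] by simp
  also have "\<dots> = size_average \<alpha>1 N (\<lambda>z1. size_average \<alpha>2 N (\<lambda>z2. size_average (\<alpha> * real N) N (\<lambda>z. H z z1 z2)))"
  proof (rule integral_bonds_law[OF N])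
    show "(\<lambda>b1. \<integral>b2. k (b1, b2) \<partial>?M2) \<in> borel_measurable ?M1"
      by (rule M2.borel_measurable_lebesgue_integral) (use km in simp)
    have m2: "(\<lambda>b2. k (b1, b2)) \<in> borel_measurable ?M2" for b1
      by (rule measurable_Pair2[OF km]) (simp add: sp)
    then have i2: "integrable ?M2 (\<lambda>b2. k (b1, b2))" for b1
      using kC by (intro M2.integrable_const_bound[where B = C]) auto
    show "\<bar>\<integral>b2. k (b1, b2) \<partial>?M2\<bar> \<le> C" for b1
    proof -
      have "\<bar>\<integral>b2. k (b1, b2) \<partial>?M2\<bar> \<le> (\<integral>b2. \<bar>k (b1, b2)\<bar> \<partial>?M2)" by (rule integral_abs_bound)
      also have "\<dots> \<le> C" by (rule M2.integral_le_const) (use i2 kC in auto)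
      finally show ?thesis .
    qed
    show "(\<integral>b2. k (b1, b2) \<partial>?M2)
       = size_average \<alpha>2 N (\<lambda>z2. size_average (\<alpha> * real N) N (\<lambda>z. H z (bond_list b1) z2))" for b1
      by (rule integral_bonds_law[OF N m2 kC]) (simp add: k sp)
  qed
  finally show ?thesis .
qed

section \<open>The limit of large systems\<close>

definition perturbation_weight ::
    "real \<Rightarrow> real \<Rightarrow> bond list \<Rightarrow> bond list \<Rightarrow> config \<Rightarrow> real" where
  "perturbation_weight \<beta>1 \<beta>2 z1 z2 \<sigma> = exp (- \<beta>1 * energy z1 \<sigma> - \<beta>2 * energy z2 \<sigma>)"

lemma perturbation_weight_pos: "0 < perturbation_weight \<beta>1 \<beta>2 z1 z2 \<sigma>"
  by (simp add: perturbation_weight_def)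

definition touched_sites :: "bond list \<Rightarrow> nat set" where
  "touched_sites z = src ` set z \<union> tgt ` set z"

lemma finite_touched_sites [simp]: "finite (touched_sites z)"
  by (simp add: touched_sites_def)

lemma card_touched_sites_le: "card (touched_sites z) \<le> 2 * length z"
proof -
  have "card (f ` set z) \<le> length z" for f :: "_ \<Rightarrow> nat"
    by (rule order.trans[OF card_image_le card_length]) simp
  then show ?thesis
    unfolding touched_sites_def using card_Un_le[of "src ` set z" "tgt ` set z"]
    by (metis (no_types, lifting) add_mono mult_2 order_trans)
qed

lemma spin_free_perturbation_weight:
  assumes "v \<notin> touched_sites z1 \<union> touched_sites z2"
  shows "spin_free v (perturbation_weight \<beta>1 \<beta>2 z1 z2)"
proof -
  have "spin_free v (energy z)" if "v \<notin> touched_sites z" for z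
    by (rule spin_free_energy) (use that in \<open>auto simp: touches_def touched_sites_def image_iff\<close>)
  then have "spin_free v (energy z1)" "spin_free v (energy z2)"
    using assms by simp_all
  then show ?thesis by (simp add: spin_free_def perturbation_weight_def)
qed

lemma boltzmann_weight_eq:
  "boltzmann_weight \<beta> \<beta>1 \<beta>2 (b, b\<^sub>1, b\<^sub>2)
    = (\<lambda>\<sigma>. perturbation_weight \<beta>1 \<beta>2 (bond_list b\<^sub>1) (bond_list b\<^sub>2) \<sigma> * exp (\<beta> * energy (bond_list b) \<sigma>))"
  by (rule ext) (simp add: boltzmann_weight_def perturbation_weight_def viana_bray_hamiltonian_def
      perturbation_hamiltonian_def bond_sum_eq_energy exp_add[symmetric])

definition replica_poly_bound :: "nat \<Rightarrow> nat \<Rightarrow> real" where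
  "replica_poly_bound m n = (\<Sum>p=0..min m n. fact (m + n - p - 1) / (fact p * fact (m - p) * fact (n - p)))"

lemma replica_poly_bound_nonneg: "0 \<le> replica_poly_bound m n"
  unfolding replica_poly_bound_def by (intro sum_nonneg) simp

lemma abs_replica_poly_le:
  assumes "\<bar>a\<bar> \<le> 1" "\<bar>b\<bar> \<le> 1" "\<bar>c\<bar> \<le> 1"
  shows "\<bar>replica_poly m n a b c\<bar> \<le> replica_poly_bound m n"
  unfolding replica_poly_def replica_poly_bound_def
proof (rule order.trans[OF sum_abs sum_mono])
  fix p
  let ?k = "fact (m + n - p - 1) / (fact p * fact (m - p) * fact (n - p)) :: real"
  have "\<bar>a ^ (m - p)\<bar> * \<bar>b ^ (n - p)\<bar> * \<bar>c ^ p\<bar> \<le> 1 * 1 * 1"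
    using assms unfolding power_abs by (intro mult_mono power_le_one mult_nonneg_nonneg) auto
  then have "?k * (\<bar>a ^ (m - p)\<bar> * \<bar>b ^ (n - p)\<bar> * \<bar>c ^ p\<bar>) \<le> ?k * 1"
    by (intro mult_left_mono) auto
  then show "\<bar>(-1) ^ (p + 1) * fact (m + n - p - 1) / (fact p * fact (m - p) * fact (n - p)) * (a ^ (m - p) * b ^ (n - p) * c ^ p)\<bar> \<le> ?k"
    by (simp add: abs_mult power_abs mult_ac)
qed

lemma abs_replica_poly_gibbs_le:
  assumes w: "\<And>\<sigma>. 0 < w \<sigma>" and "i \<in> {1..N}" "j \<in> {1..N}" "k \<in> {1..N}" "l \<in> {1..N}"
  shows "\<bar>replica_poly m n (gibbs_mean N w (spins2 i j)) (gibbs_mean N w (spins2 k l))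
       (gibbs_mean N w (spins4 i j k l))\<bar> \<le> replica_poly_bound m n"
proof (rule abs_replica_poly_le)
  have w': "0 \<le> w \<sigma>" for \<sigma> using w[of \<sigma>] by simp
  show "\<bar>gibbs_mean N w (spins2 i j)\<bar> \<le> 1" using w' assms(2,3) by (rule abs_gibbs_mean_two_spin_le)
  show "\<bar>gibbs_mean N w (spins2 k l)\<bar> \<le> 1" using w' assms(4,5) by (rule abs_gibbs_mean_two_spin_le)
  show "\<bar>gibbs_mean N w (spins4 i j k l)\<bar> \<le> 1"
    using assms by (rule abs_gibbs_mean_four_spin_le)
qed

lemma abs_replica_poly_average_le:
  assumes "\<And>\<sigma>. 0 < w \<sigma>"
  shows "\<bar>replica_poly_average N m n w\<bar> \<le> replica_poly_bound m n"
  unfolding replica_poly_average_def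
  by (intro abs_avg_le_const replica_poly_bound_nonneg abs_replica_poly_gibbs_le assms)

text \<open>A free site \<open>i\<close> different from j, k and l has vanishing correlations, which
  kills every term of the polynomial. The exceptional sites are those of \<open>B\<close> and the
  three others, hence T + 3.\<close>

lemma replica_poly_average_few_bonds:
  assumes N: "N > 0" and w: "\<And>\<sigma>. 0 < w \<sigma>" and B: "finite B" "card B \<le> T"
    and free: "\<And>v. v \<notin> B \<Longrightarrow> spin_free v w" and m: "m \<ge> 1"
  shows "\<bar>replica_poly_average N m n w\<bar> \<le> replica_poly_bound m n * (real (T + 3) / real N)"
proof -
  let ?C = "replica_poly_bound m n"
  let ?q = "\<lambda>i j k l. replica_poly m n (gibbs_mean N w (spins2 i j)) (gibbs_mean N w (spins2 k l))
       (gibbs_mean N w (spins4 i j k l))"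
  have zero: "?q i j k l = 0" if i: "i \<in> {1..N}" "i \<notin> B" "i \<noteq> j" "i \<noteq> k" "i \<noteq> l" for i j k l
  proof -
    have a: "gibbs_mean N w (spins2 i j) = 0"
      using sum_configs_free_spin[OF i(1), of "\<lambda>\<sigma>. w \<sigma> * \<sigma> j"] free[OF i(2)] i(3)
      by (simp add: gibbs_mean_def spin_free_def mult_ac)
    have c: "gibbs_mean N w (spins4 i j k l) = 0"
      using sum_configs_free_spin[OF i(1), of "\<lambda>\<sigma>. w \<sigma> * \<sigma> j * (\<sigma> k * \<sigma> l)"] free[OF i(2)] i(3-5)
      by (simp add: gibbs_mean_def spin_free_def mult_ac)
    show ?thesis
      unfolding replica_poly_def a c
    proof (rule sum.neutral, intro ballI)
      fix p assume "p \<in> {0..min m n}"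
      \<comment> \<open>For p = m the first power is 0^0 = 1, and it is the four-spin factor that
        vanishes, as m is positive.\<close>
      then have "p = m \<or> m - p > 0" by auto
      then have "(0 :: real) ^ (m - p) * gibbs_mean N w (spins2 k l) ^ (n - p) * 0 ^ p = 0"
        using m by auto
      then show "(-1) ^ (p + 1) * fact (m + n - p - 1) / (fact p * fact (m - p) * fact (n - p)) *
          (0 ^ (m - p) * gibbs_mean N w (spins2 k l) ^ (n - p) * 0 ^ p) = 0"
        by (simp only: mult_zero_right)
    qed
  qed
  have le: "\<bar>?q i j k l\<bar> \<le> ?C * of_bool (i \<in> insert j (insert k (insert l B)))"
    if "i \<in> {1..N}" "j \<in> {1..N}" "k \<in> {1..N}" "l \<in> {1..N}" for i j k l
  proof (cases "i \<in> insert j (insert k (insert l B))")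
    case True
    then show ?thesis using abs_replica_poly_gibbs_le[OF w that, of m n] by simp
  next
    case False
    then show ?thesis using zero[of i j k l] that by simp
  qed
  have "replica_poly_average N m n w = avg {1..N} (\<lambda>j. avg {1..N} (\<lambda>k. avg {1..N} (\<lambda>l. avg {1..N} (\<lambda>i. ?q i j k l))))"
  proof -
    have "replica_poly_average N m n w = avg {1..N} (\<lambda>j. avg {1..N} (\<lambda>i. avg {1..N} (\<lambda>k. avg {1..N} (\<lambda>l. ?q i j k l))))"
      unfolding replica_poly_average_def by (rule avg_swap)
    also have "\<dots> = avg {1..N} (\<lambda>j. avg {1..N} (\<lambda>k. avg {1..N} (\<lambda>i. avg {1..N} (\<lambda>l. ?q i j k l))))"
      by (intro avg_cong refl avg_swap)
    also have "\<dots> = avg {1..N} (\<lambda>j. avg {1..N} (\<lambda>k. avg {1..N} (\<lambda>l. avg {1..N} (\<lambda>i. ?q i j k l))))"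
      by (intro avg_cong refl avg_swap)
    finally show ?thesis .
  qed
  then have "replica_poly_average N m n w = avg {1..N} (\<lambda>j. avg {1..N} (\<lambda>k. avg {1..N} (\<lambda>l. avg {1..N} (\<lambda>i. ?q i j k l))))" .
  moreover have "\<bar>avg {1..N} (\<lambda>i. ?q i j k l)\<bar> \<le> ?C * (real (T + 3) / real N)"
    if jkl: "j \<in> {1..N}" "k \<in> {1..N}" "l \<in> {1..N}" for j k l
  proof -
    let ?I = "insert j (insert k (insert l B))"
    have "\<bar>avg {1..N} (\<lambda>i. ?q i j k l)\<bar> \<le> avg {1..N} (\<lambda>i. \<bar>?q i j k l\<bar>)" by (rule abs_avg_le)
    also have "\<dots> \<le> avg {1..N} (\<lambda>i. ?C * of_bool (i \<in> ?I))" by (intro avg_mono le jkl)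
    also have "\<dots> = ?C * (real (card {i \<in> {1..N}. i \<in> ?I}) / real N)"
      unfolding avg_cmult by (subst avg_of_bool) simp_all
    also have "\<dots> \<le> ?C * (real (T + 3) / real N)"
    proof (intro mult_left_mono divide_right_mono replica_poly_bound_nonneg)
      have "card {i \<in> {1..N}. i \<in> ?I} \<le> card ?I" using B(1) by (intro card_mono) auto
      also have "\<dots> \<le> T + 3" using B by (simp add: card_insert_if)
      finally show "real (card {i \<in> {1..N}. i \<in> ?I}) \<le> real (T + 3)" by simp
    qed simp
    finally show ?thesis .
  qed
  moreover have C0: "0 \<le> ?C * (real (T + 3) / real N)"
    by (intro mult_nonneg_nonneg replica_poly_bound_nonneg) simp
  ultimately show ?thesis
    by (simp only:) (rule abs_avg_le_const[OF C0], rule abs_avg_le_const[OF C0], rule abs_avg_le_const[OF C0])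
qed

section \<open>Averaging over the perturbation bonds\<close>

lemma integrable_size_average:
  assumes "\<And>z. \<bar>f z\<bar> \<le> C"
  shows "integrable (poisson_law \<zeta>) (\<lambda>n. avg (bond_lists N n) f)"
proof (rule integrable_pmf_bounded)
  have "0 \<le> C" using assms abs_ge_zero order_trans by blast
  then show "\<bar>avg (bond_lists N n) f\<bar> \<le> C" for n
    using assms by (intro abs_avg_le_const)
qed

lemma size_average_add:
  assumes "\<And>z. \<bar>f z\<bar> \<le> C" "\<And>z. \<bar>g z\<bar> \<le> D"
  shows "size_average \<zeta> N (\<lambda>z. f z + g z) = size_average \<zeta> N f + size_average \<zeta> N g"
  unfolding size_average_def avg_add
  by (rule Bochner_Integration.integral_add[OF integrable_size_average[OF assms(1)] integrable_size_average[OF assms(2)]])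

lemma size_average_cmult: "size_average \<zeta> N (\<lambda>z. c * f z) = c * size_average \<zeta> N f"
  unfolding size_average_def avg_cmult by simp

lemma size_average_diff:
  assumes "\<And>z. \<bar>f z\<bar> \<le> C" "\<And>z. \<bar>g z\<bar> \<le> D"
  shows "size_average \<zeta> N (\<lambda>z. f z - g z) = size_average \<zeta> N f - size_average \<zeta> N g"
  unfolding size_average_def avg_diff
  by (rule Bochner_Integration.integral_diff[OF integrable_size_average[OF assms(1)] integrable_size_average[OF assms(2)]])

lemma size_average_sum:
  assumes "\<And>i z. \<bar>f i z\<bar> \<le> C i"
  shows "size_average \<zeta> N (\<lambda>z. \<Sum>i\<in>I. f i z) = (\<Sum>i\<in>I. size_average \<zeta> N (f i))"
  unfolding size_average_def avg_sum
  by (rule Bochner_Integration.integral_sum[OF integrable_size_average[OF assms]])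

text \<open>Bounding by a function of the number of bonds only makes dominated convergence applicable:
  the law of the number of perturbation bonds does not depend on \<open>N\<close>.\<close>

lemma abs_size_average_le:
  assumes "\<And>z. \<bar>f z\<bar> \<le> \<delta> (length z)" "\<And>n. \<delta> n \<le> C"
  shows "\<bar>size_average \<zeta> N f\<bar> \<le> measure_pmf.expectation (poisson_law \<zeta>) \<delta>"
proof -
  have \<delta>: "0 \<le> \<delta> n" for n
  proof -
    \<comment> \<open>Any list of length \<open>n\<close> serves as witness, since the bound is
      assumed for all lists and not only for those in the support.\<close>
    have "0 \<le> \<bar>f (replicate n (0, 0, 0))\<bar>" by simp
    also have "\<dots> \<le> \<delta> n" using assms(1)[of "replicate n (0, 0, 0)"] by simp
    finally show ?thesis .
  qed
  have b: "\<bar>avg (bond_lists N n) f\<bar> \<le> \<delta> n" for n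
    by (rule abs_avg_le_const[OF \<delta>]) (use assms(1) length_lists_of in metis)
  have i\<delta>: "integrable (poisson_law \<zeta>) \<delta>"
    using \<delta> assms(2) by (intro integrable_pmf_bounded[of _ C]) simp
  have ia: "integrable (poisson_law \<zeta>) (\<lambda>n. avg (bond_lists N n) f)"
    using b assms(2) by (intro integrable_pmf_bounded[of _ C]) (metis order.trans)
  have "\<bar>size_average \<zeta> N f\<bar> \<le> measure_pmf.expectation (poisson_law \<zeta>) (\<lambda>n. \<bar>avg (bond_lists N n) f\<bar>)"
    unfolding size_average_def by (rule integral_abs_bound)
  also have "\<dots> \<le> measure_pmf.expectation (poisson_law \<zeta>) \<delta>"
    using ia i\<delta> b by (intro integral_mono) auto
  finally show ?thesis .
qed

lemma abs_size_average_le_const: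
  assumes "\<And>z. \<bar>f z\<bar> \<le> C"
  shows "\<bar>size_average \<zeta> N f\<bar> \<le> C"
  using abs_size_average_le[of f "\<lambda>_. C" C] assms by simp

lemma expectation_pmf_tendsto_0:
  fixes \<delta> :: "nat \<Rightarrow> 'a \<Rightarrow> real"
  assumes "\<And>n. (\<lambda>N. \<delta> N n) \<longlonglongrightarrow> 0" "\<And>N n. \<bar>\<delta> N n\<bar> \<le> C"
  shows "(\<lambda>N. measure_pmf.expectation p (\<delta> N)) \<longlonglongrightarrow> 0"
proof -
  have "(\<lambda>N. measure_pmf.expectation p (\<delta> N)) \<longlonglongrightarrow> measure_pmf.expectation p (\<lambda>_. 0)"
    by (rule integral_dominated_convergence[where w = "\<lambda>_. C"]) (use assms in auto)
  then show ?thesis by simp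
qed

text \<open>Dominated convergence, once for each perturbation. The pointwise bound sees the
  perturbation bonds only through their numbers, whose laws are the same for all N.\<close>

lemma size_average_tendsto_0:
  fixes \<delta> :: "nat \<Rightarrow> nat \<Rightarrow> real"
  assumes C: "\<And>N z1 z2. \<bar>U N z1 z2\<bar> \<le> C" and \<delta>: "\<And>T. (\<lambda>N. \<delta> T N) \<longlonglongrightarrow> 0"
    and U: "\<And>N z1 z2. N \<ge> 2 \<Longrightarrow> \<bar>U N z1 z2\<bar> \<le> \<delta> (2 * (length z1 + length z2)) N"
  shows "(\<lambda>N. size_average \<alpha>1 N (\<lambda>z1. size_average \<alpha>2 N (\<lambda>z2. U N z1 z2))) \<longlonglongrightarrow> 0"
proof -
  have C0: "0 \<le> C" using C abs_ge_zero order_trans by blast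
  \<comment> \<open>\<open>\<delta>\<close> may grow without bound in the number of bonds; cutting
    it off at \<open>C\<close> supplies the dominating constant.\<close>
  define e where "e N a b = min C \<bar>\<delta> (2 * (a + b)) N\<bar>" for N a b
  define e1 where "e1 N a = measure_pmf.expectation (poisson_law \<alpha>2) (e N a)" for N a
  have e: "\<bar>e N a b\<bar> \<le> C" for N a b using C0 by (simp add: e_def)
  have e0: "(\<lambda>N. e N a b) \<longlonglongrightarrow> 0" for a b
  proof -
    have "(\<lambda>N. min C \<bar>\<delta> (2 * (a + b)) N\<bar>) \<longlonglongrightarrow> min C \<bar>0\<bar>"
      by (intro tendsto_min tendsto_const tendsto_rabs \<delta>)
    then show ?thesis using C0 by (simp add: e_def)
  qed
  have e1: "\<bar>e1 N a\<bar> \<le> C" for N a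
  proof -
    have "\<bar>e1 N a\<bar> \<le> measure_pmf.expectation (poisson_law \<alpha>2) (\<lambda>b. \<bar>e N a b\<bar>)"
      unfolding e1_def by (rule integral_abs_bound)
    also have "\<dots> \<le> C"
      using e by (intro measure_pmf.integral_le_const integrable_pmf_bounded[of _ C]) auto
    finally show ?thesis .
  qed
  have e10: "(\<lambda>N. e1 N a) \<longlonglongrightarrow> 0" for a
    unfolding e1_def by (rule expectation_pmf_tendsto_0[OF e0 e])
  have lim: "(\<lambda>N. measure_pmf.expectation (poisson_law \<alpha>1) (e1 N)) \<longlonglongrightarrow> 0"
    by (rule expectation_pmf_tendsto_0[OF e10 e1])
  show ?thesis
  proof (rule Lim_null_comparison[OF _ lim], rule eventually_sequentiallyI[of 2])
    fix N :: nat assume N: "2 \<le> N"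
    have "\<bar>size_average \<alpha>2 N (\<lambda>z2. U N z1 z2)\<bar> \<le> e1 N (length z1)" for z1
      unfolding e1_def
    proof (rule abs_size_average_le)
      show "\<bar>U N z1 z2\<bar> \<le> e N (length z1) (length z2)" for z2
        using C[of N z1 z2] U[OF N, of z1 z2] by (simp add: e_def)
      show "e N (length z1) b \<le> C" for b by (simp add: e_def)
    qed
    then show "norm (size_average \<alpha>1 N (\<lambda>z1. size_average \<alpha>2 N (\<lambda>z2. U N z1 z2)))
        \<le> measure_pmf.expectation (poisson_law \<alpha>1) (e1 N)"
      unfolding real_norm_def by (rule abs_size_average_le) (use e1 in \<open>auto simp: abs_le_iff\<close>)
  qed
qed

text \<open>The coefficients of a power series are recovered from its values at arbitrarily small arguments.\<close>

lemma coefficients_tendsto_0: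
  fixes M :: "nat \<Rightarrow> nat \<Rightarrow> real" and D :: "real \<Rightarrow> nat \<Rightarrow> real"
  assumes small: "\<And>\<epsilon>. \<epsilon> > 0 \<Longrightarrow> \<exists>x. 0 < x \<and> x < \<epsilon> \<and> x \<le> 1 / 4 \<and> (\<lambda>N. D x N) \<longlonglongrightarrow> 0"
    and expand: "\<And>x R. 0 < x \<Longrightarrow> x \<le> 1 / 4 \<Longrightarrow>
      eventually (\<lambda>N. \<bar>D x N + c * (\<Sum>r=1..R. x ^ (2 * r) * M r N)\<bar> \<le> K * (2 * x) ^ (2 * R + 2)) sequentially"
    and "0 < c" "0 < K" and "1 \<le> r"
  shows "(\<lambda>N. M r N) \<longlonglongrightarrow> 0"
  using \<open>1 \<le> r\<close>
proof (induction r rule: less_induct)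
  case (less R)
  \<comment> \<open>Chosen so that the remainder \<open>K * (2 * x) ^ (2 * R + 2)\<close>, divided
    by the factor \<open>c * x ^ (2 * R)\<close> of the coefficient sought, is L x^2.\<close>
  define L where "L = K * 2 ^ (2 * R + 2) / c"
  have L: "L > 0" using assms(3,4) by (simp add: L_def)
  show ?case
  proof (rule LIMSEQ_I)
    fix \<epsilon> :: real assume \<epsilon>: "0 < \<epsilon>"
    obtain x where x: "0 < x" "x < min 1 (\<epsilon> / (2 * L))" "x \<le> 1 / 4" "(\<lambda>N. D x N) \<longlonglongrightarrow> 0"
      using small[of "min 1 (\<epsilon> / (2 * L))"] \<epsilon> L by auto
    \<comment> \<open>For this fixed x the known part vanishes in the limit, by the choice of x and
      the induction hypothesis; division by a power of x is harmless because x does not vary with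
      N.\<close>
    define S where "S N = (D x N + c * (\<Sum>r=1..<R. x ^ (2 * r) * M r N)) / (c * x ^ (2 * R))" for N
    have S: "S \<longlonglongrightarrow> 0"
    proof -
      have "(\<lambda>N. (D x N + c * (\<Sum>r=1..<R. x ^ (2 * r) * M r N)) / (c * x ^ (2 * R)))
          \<longlonglongrightarrow> (0 + c * (\<Sum>r=1..<R. x ^ (2 * r) * 0)) / (c * x ^ (2 * R))"
        using x(1,4) assms(3) less.IH
        by (intro tendsto_divide tendsto_add tendsto_mult tendsto_sum tendsto_const) auto
      then show ?thesis by (simp add: S_def[abs_def])
    qed
    have half: "0 < \<epsilon> / 2" using \<epsilon> by simp
    have "eventually (\<lambda>N. \<bar>S N\<bar> < \<epsilon> / 2) sequentially"
      using order_tendstoD(2)[OF tendsto_rabs_zero[OF S] half] .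
    with expand[OF x(1,3), of R] have "eventually (\<lambda>N. \<bar>M R N\<bar> < \<epsilon>) sequentially"
    proof eventually_elim
      case (elim N)
      let ?P = "c * x ^ (2 * R)"
      have P: "?P > 0" using x(1) assms(3) by simp
      have "{1..R} = insert R {1..<R}" using less.prems by auto
      then have "D x N + c * (\<Sum>r=1..R. x ^ (2 * r) * M r N) = ?P * (S N + M R N)"
      proof -
        have "?P * S N = D x N + c * (\<Sum>r=1..<R. x ^ (2 * r) * M r N)"
          using x(1) assms(3) by (simp add: S_def)
        then show ?thesis using \<open>{1..R} = insert R {1..<R}\<close> by (simp add: algebra_simps)
      qed
      then have "\<bar>?P * (S N + M R N)\<bar> \<le> K * (2 * x) ^ (2 * R + 2)"
        using elim(1) by simp
      then have "?P * \<bar>S N + M R N\<bar> \<le> K * (2 * x) ^ (2 * R + 2)"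
        by (simp only: abs_mult[of ?P] abs_of_pos[OF P])
      also have "K * (2 * x) ^ (2 * R + 2) = ?P * (L * x\<^sup>2)"
        using assms(3) by (simp add: L_def power_mult_distrib power_add power2_eq_square)
      finally have "\<bar>S N + M R N\<bar> \<le> L * x\<^sup>2"
        using P by (simp only: mult_le_cancel_left_pos)
      also have "\<dots> \<le> L * x"
        using x L by (intro mult_left_mono) (auto simp: power2_eq_square intro: mult_left_le)
      also have "L * x < \<epsilon> / 2"
        using x(2) L by (simp add: field_simps)
      finally show ?case using elim(2) by linarith
    qed
    then show "\<exists>no. \<forall>n\<ge>no. norm (M R n - 0) < \<epsilon>" by (simp add: eventually_sequentially)
  qed
qed

section \<open>Assembling the limit\<close>

definition gibbs_weight ::
    "real \<Rightarrow> real \<Rightarrow> real \<Rightarrow> bond list \<Rightarrow> bond list \<Rightarrow> bond list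
      \<Rightarrow> config \<Rightarrow> real" where
  "gibbs_weight \<beta> \<beta>1 \<beta>2 z z1 z2 = (\<lambda>\<sigma>. perturbation_weight \<beta>1 \<beta>2 z1 z2 \<sigma> * exp (\<beta> * energy z \<sigma>))"

lemma gibbs_weight_pos: "0 < gibbs_weight \<beta> \<beta>1 \<beta>2 z z1 z2 \<sigma>"
  by (simp add: gibbs_weight_def perturbation_weight_pos)

definition bonds_average :: "nat \<Rightarrow> real \<Rightarrow> real \<Rightarrow> real \<Rightarrow>
    (bond list \<Rightarrow> bond list \<Rightarrow> bond list \<Rightarrow> real) \<Rightarrow> real" where
  "bonds_average N \<alpha> \<alpha>1 \<alpha>2 f = size_average \<alpha>1 N (\<lambda>z1. size_average \<alpha>2 N (\<lambda>z2.
     size_average (\<alpha> * real N) N (\<lambda>z. f z z1 z2)))"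

lemma abs_bonds_average_le:
  assumes "\<And>z z1 z2. \<bar>f z z1 z2\<bar> \<le> C"
  shows "\<bar>bonds_average N \<alpha> \<alpha>1 \<alpha>2 f\<bar> \<le> C"
  unfolding bonds_average_def by (intro abs_size_average_le_const assms)

lemma bonds_average_add:
  assumes f: "\<And>z z1 z2. \<bar>f z z1 z2\<bar> \<le> C" and g: "\<And>z z1 z2. \<bar>g z z1 z2\<bar> \<le> D"
  shows "bonds_average N \<alpha> \<alpha>1 \<alpha>2 (\<lambda>z z1 z2. f z z1 z2 + g z z1 z2)
    = bonds_average N \<alpha> \<alpha>1 \<alpha>2 f + bonds_average N \<alpha> \<alpha>1 \<alpha>2 g"
  unfolding bonds_average_def
  by (simp only: size_average_add[of _ C _ D] f g abs_size_average_le_const)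

lemma bonds_average_cmult:
  "bonds_average N \<alpha> \<alpha>1 \<alpha>2 (\<lambda>z z1 z2. c * f z z1 z2) = c * bonds_average N \<alpha> \<alpha>1 \<alpha>2 f"
  unfolding bonds_average_def size_average_cmult by (rule refl)

lemma bonds_average_sum:
  assumes f: "\<And>i z z1 z2. \<bar>f i z z1 z2\<bar> \<le> C i"
  shows "bonds_average N \<alpha> \<alpha>1 \<alpha>2 (\<lambda>z z1 z2. \<Sum>i\<in>I. f i z z1 z2) = (\<Sum>i\<in>I. bonds_average N \<alpha> \<alpha>1 \<alpha>2 (f i))"
  unfolding bonds_average_def
  by (simp only: size_average_sum[of _ C] f abs_size_average_le_const)

lemma sum_overlap_sq_average_eq_bonds_average:
  assumes "N > 0"
  shows "(\<Sum>p=0..min m n. (-1) ^ (p + 1) * fact (m + n - p - 1) / (fact p * fact (m - p) * fact (n - p))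
      * overlap_sq_average N \<alpha> \<beta> \<alpha>1 \<beta>1 \<alpha>2 \<beta>2 m n p)
    = bonds_average N \<alpha> \<alpha>1 \<alpha>2 (\<lambda>z z1 z2. replica_poly_average N m n (gibbs_weight \<beta> \<beta>1 \<beta>2 z z1 z2))"
  unfolding sum_overlap_sq_average bonds_average_def
proof (rule integral_quenched_law[OF assms])
  show "(\<lambda>\<xi>. replica_poly_average N m n (boltzmann_weight \<beta> \<beta>1 \<beta>2 \<xi>)) \<in> borel_measurable (quenched_law N \<alpha> \<alpha>1 \<alpha>2)"
    by (rule borel_measurable_integrable[OF integrable_replica_poly_average])
  show "\<bar>replica_poly_average N m n (boltzmann_weight \<beta> \<beta>1 \<beta>2 \<xi>)\<bar> \<le> replica_poly_bound m n" for \<xi>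
    by (rule abs_replica_poly_average_le[OF boltzmann_weight_pos])
qed (simp only: boltzmann_weight_eq gibbs_weight_def)

lemma touched_sites_perturbation:
  fixes z1 z2 :: "bond list"
  defines "B \<equiv> touched_sites z1 \<union> touched_sites z2"
  shows "finite B" "card B \<le> 2 * (length z1 + length z2)"
    "\<And>v. v \<notin> B \<Longrightarrow> spin_free v (perturbation_weight \<beta>1 \<beta>2 z1 z2)"
  using card_Un_le[of "touched_sites z1" "touched_sites z2"] card_touched_sites_le[of z1] card_touched_sites_le[of z2]
  by (auto simp: B_def intro: spin_free_perturbation_weight)

text \<open>Without Viana-Bray interaction only the boundedly many sites of the perturbation bonds interact.\<close>

lemma replica_poly_average_tendsto_0_trivial:
  assumes "\<alpha> = 0 \<or> \<beta> = 0" "m \<ge> 1"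
  shows "(\<lambda>N. bonds_average N \<alpha> \<alpha>1 \<alpha>2 (\<lambda>z z1 z2. replica_poly_average N m n (gibbs_weight \<beta> \<beta>1 \<beta>2 z z1 z2))) \<longlonglongrightarrow> 0"
  unfolding bonds_average_def
proof (rule size_average_tendsto_0[where \<delta> = "\<lambda>T N. replica_poly_bound m n * (real (T + 3) / real N)"])
  show "\<bar>size_average (\<alpha> * real N) N (\<lambda>z. replica_poly_average N m n (gibbs_weight \<beta> \<beta>1 \<beta>2 z z1 z2))\<bar> \<le> replica_poly_bound m n"
    for N z1 z2
    by (intro abs_size_average_le_const abs_replica_poly_average_le gibbs_weight_pos)
  show "(\<lambda>N. replica_poly_bound m n * (real (T + 3) / real N)) \<longlonglongrightarrow> 0" for T
    by (intro tendsto_mult_right_zero lim_const_over_n)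
  fix N :: nat and z1 z2 :: "bond list"
  assume N: "2 \<le> N"
  let ?w = "perturbation_weight \<beta>1 \<beta>2 z1 z2"
  have le: "\<bar>replica_poly_average N m n ?w\<bar> \<le> replica_poly_bound m n * (real (2 * (length z1 + length z2) + 3) / real N)"
    by (rule replica_poly_average_few_bonds[OF _ perturbation_weight_pos touched_sites_perturbation assms(2)])
      (use N in auto)
  show "\<bar>size_average (\<alpha> * real N) N (\<lambda>z. replica_poly_average N m n (gibbs_weight \<beta> \<beta>1 \<beta>2 z z1 z2))\<bar>
      \<le> replica_poly_bound m n * (real (2 * (length z1 + length z2) + 3) / real N)"
    using assms(1)
  proof
    assume "\<beta> = 0"
    then have "gibbs_weight \<beta> \<beta>1 \<beta>2 z z1 z2 = ?w" for z by (simp add: gibbs_weight_def)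
    then show ?thesis using le by (intro abs_size_average_le_const) simp
  next
    \<comment> \<open>With mean 0 the number of bonds is 0, and \<open>[]\<close> is the only list
      to average over.\<close>
    assume "\<alpha> = 0"
    moreover have "gibbs_weight \<beta> \<beta>1 \<beta>2 [] z1 z2 = ?w" by (simp add: gibbs_weight_def energy_def)
    ultimately show ?thesis using le by (simp add: size_average_def poisson_law_def avg_def)
  qed
qed

text \<open>The error of \<open>chain_stability\<close> involves the perturbation bonds only through
  the number of sites that they touch, at most twice their number, which is the form required by
  \<open>size_average_tendsto_0\<close>.\<close>

lemma bonded_average_limit:
  assumes "\<alpha> > 0" "even p" "m \<ge> 1"
  shows "(\<lambda>N. bonds_average N \<alpha> \<alpha>1 \<alpha>2 (\<lambda>z z1 z2.
      bonded_average N (corr_power N p) (tanh \<beta> ^ Suc m) (gibbs_weight \<beta> \<beta>1 \<beta>2 z z1 z2)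
      - corr_power N p (gibbs_weight \<beta> \<beta>1 \<beta>2 z z1 z2))) \<longlonglongrightarrow> 0"
  unfolding bonds_average_def
proof (rule size_average_tendsto_0[where \<delta> = "stability_bound \<alpha> m"])
  let ?F = "\<lambda>N z z1 z2. corr_power N p (gibbs_weight \<beta> \<beta>1 \<beta>2 z z1 z2)"
  let ?A = "\<lambda>N z z1 z2. bonded_average N (corr_power N p) (tanh \<beta> ^ Suc m) (gibbs_weight \<beta> \<beta>1 \<beta>2 z z1 z2)"
  have t: "\<bar>tanh \<beta> ^ Suc m\<bar> < 1" by (rule abs_tanh_power_less)
  have F: "0 \<le> ?F N z z1 z2" "?F N z z1 z2 \<le> 1" for N z z1 z2
    using less_imp_le[OF gibbs_weight_pos] assms(2) by (rule corr_power_bounds)+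
  have A: "0 \<le> ?A N z z1 z2" "?A N z z1 z2 \<le> 1" for N z z1 z2
    using gibbs_weight_pos t assms(2) by (rule bonded_average_bounds)+
  show "\<bar>size_average (\<alpha> * real N) N (\<lambda>z. ?A N z z1 z2 - ?F N z z1 z2)\<bar> \<le> 1" for N z1 z2
  proof (rule abs_size_average_le_const)
    show "\<bar>?A N z z1 z2 - ?F N z z1 z2\<bar> \<le> 1" for z
      using F[of N z z1 z2] A[of N z z1 z2] by linarith
  qed
  show "stability_bound \<alpha> m T \<longlonglongrightarrow> 0" for T using assms(1) by (rule stability_bound_tendsto_0)
  fix N :: nat and z1 z2 :: "bond list"
  assume N: "2 \<le> N"
  have "size_average (\<alpha> * real N) N (\<lambda>z. ?A N z z1 z2 - ?F N z z1 z2)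
      = size_average (\<alpha> * real N) N (\<lambda>z. ?A N z z1 z2) - size_average (\<alpha> * real N) N (\<lambda>z. ?F N z z1 z2)"
    by (rule size_average_diff[where C = 1 and D = 1]) (use F A in auto)
  moreover have "\<bar>size_average (\<alpha> * real N) N (\<lambda>z. ?F N z z1 z2) - size_average (\<alpha> * real N) N (\<lambda>z. ?A N z z1 z2)\<bar>
      \<le> stability_bound \<alpha> m (2 * (length z1 + length z2)) N"
    unfolding gibbs_weight_def
    by (rule chain_stability[OF assms(1) N assms(3) touched_sites_perturbation(1,2) perturbation_weight_pos
          touched_sites_perturbation(3) assms(2)])
  ultimately show "\<bar>size_average (\<alpha> * real N) N (\<lambda>z. ?A N z z1 z2 - ?F N z z1 z2)\<bar>
      \<le> stability_bound \<alpha> m (2 * (length z1 + length z2)) N"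
    by (simp add: abs_minus_commute)
qed

lemma replica_poly_average_tendsto_0:
  assumes "\<alpha> > 0" "\<beta> > 0" "even n" "n \<ge> 1" "r \<ge> 1"
  shows "(\<lambda>N. bonds_average N \<alpha> \<alpha>1 \<alpha>2 (\<lambda>z z1 z2. replica_poly_average N (2 * r) n (gibbs_weight \<beta> \<beta>1 \<beta>2 z z1 z2))) \<longlonglongrightarrow> 0"
proof -
  let ?w = "gibbs_weight \<beta> \<beta>1 \<beta>2" and ?E = "\<lambda>N. bonds_average N \<alpha> \<alpha>1 \<alpha>2"
  define d where "d x N z z1 z2 = bonded_average N (corr_power N n) x (?w z z1 z2) - corr_power N n (?w z z1 z2)"
    for x N z z1 z2
  define q where "q r N z z1 z2 = replica_poly_average N (2 * r) n (?w z z1 z2)" for r N z z1 z2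
  have "(\<lambda>N. ?E N (q r N)) \<longlonglongrightarrow> 0"
  proof (rule coefficients_tendsto_0[where c = "real n" and K = "2 * 3 ^ n" and
      M = "\<lambda>r N. ?E N (q r N)" and D = "\<lambda>x N. ?E N (d x N)"])
    fix \<epsilon> :: real assume "\<epsilon> > 0"
    have t: "0 < tanh \<beta>" "tanh \<beta> < 1" using assms(2) tanh_real_lt_1[of \<beta>] by auto
    obtain k where k: "tanh \<beta> ^ k < min \<epsilon> (1 / 4)"
      using real_arch_pow_inv[of "min \<epsilon> (1 / 4)" "tanh \<beta>"] t \<open>\<epsilon> > 0\<close> by auto
    \<comment> \<open>The double successor guarantees a chain of at least two bonds, so that it has
      an interior site.\<close>
    define x where "x = tanh \<beta> ^ Suc (Suc k)"
    have "x \<le> tanh \<beta> ^ k" unfolding x_def using t by (intro power_decreasing) auto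
    moreover have "0 < x" unfolding x_def using t by (intro zero_less_power)
    moreover have "(\<lambda>N. ?E N (d x N)) \<longlonglongrightarrow> 0"
      unfolding x_def d_def by (rule bonded_average_limit[OF assms(1,3)]) simp
    ultimately show "\<exists>x. 0 < x \<and> x < \<epsilon> \<and> x \<le> 1 / 4 \<and> (\<lambda>N. ?E N (d x N)) \<longlonglongrightarrow> 0"
      using k by (intro exI[of _ x]) simp
  next
    fix x :: real and R assume x: "0 < x" "x \<le> 1 / 4"
    show "eventually (\<lambda>N. \<bar>?E N (d x N) + real n * (\<Sum>r=1..R. x ^ (2 * r) * ?E N (q r N))\<bar>
        \<le> 2 * 3 ^ n * (2 * x) ^ (2 * R + 2)) sequentially"
    proof (rule eventually_sequentiallyI[of 1])
      fix N :: nat assume "1 \<le> N"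
      then have N: "N > 0" by simp
      have d: "\<bar>d x N z z1 z2\<bar> \<le> 1" for z z1 z2
        unfolding d_def
        using corr_power_bounds[where w = "?w z z1 z2" and N = N, OF less_imp_le[OF gibbs_weight_pos] assms(3)]
          bonded_average_bounds[where w = "?w z z1 z2" and N = N and x = x, OF gibbs_weight_pos _ assms(3)] x
        by auto
      have q: "\<bar>x ^ (2 * r) * q r N z z1 z2\<bar> \<le> x ^ (2 * r) * replica_poly_bound (2 * r) n" for r z z1 z2
        unfolding q_def abs_mult using x by (intro mult_mono abs_replica_poly_average_le gibbs_weight_pos) auto
      have sq: "\<bar>real n * (\<Sum>r=1..R. x ^ (2 * r) * q r N z z1 z2)\<bar>
          \<le> real n * (\<Sum>r=1..R. x ^ (2 * r) * replica_poly_bound (2 * r) n)" for z z1 z2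
        unfolding abs_mult by (intro mult_mono order.trans[OF sum_abs sum_mono] q) auto
      have "?E N (d x N) + real n * (\<Sum>r=1..R. x ^ (2 * r) * ?E N (q r N))
        = ?E N (\<lambda>z z1 z2. d x N z z1 z2 + real n * (\<Sum>r=1..R. x ^ (2 * r) * q r N z z1 z2))"
        unfolding bonds_average_add[OF d sq] bonds_average_cmult bonds_average_sum[OF q] by (rule refl)
      also have "\<bar>\<dots>\<bar> \<le> 2 * 3 ^ n * (2 * x) ^ (2 * R + 2)"
      proof (rule abs_bonds_average_le)
        fix z z1 z2
        show "\<bar>d x N z z1 z2 + real n * (\<Sum>r=1..R. x ^ (2 * r) * q r N z z1 z2)\<bar> \<le> 2 * 3 ^ n * (2 * x) ^ (2 * R + 2)"
          using bonded_average_expansion[where w = "?w z z1 z2" and R = R and x = x, OF N gibbs_weight_pos assms(4)] x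
          unfolding d_def q_def by simp
      qed
      finally show "\<bar>?E N (d x N) + real n * (\<Sum>r=1..R. x ^ (2 * r) * ?E N (q r N))\<bar>
        \<le> 2 * 3 ^ n * (2 * x) ^ (2 * R + 2)" .
    qed
  qed (use assms in auto)
  then show ?thesis unfolding q_def .
qed

theorem corollary1:
  fixes \<alpha> \<beta> \<beta>\<^sub>1 \<beta>\<^sub>2 :: real
  assumes "\<alpha> \<ge> 0" "\<beta> \<ge> 0" "\<beta>\<^sub>1 \<ge> 0" "\<beta>\<^sub>2 \<ge> 0"
  shows "AE (\<alpha>\<^sub>1, \<alpha>\<^sub>2) in (lebesgue :: (real \<times> real) measure). \<alpha>\<^sub>1 \<ge> 0 \<longrightarrow> \<alpha>\<^sub>2 \<ge> 0 \<longrightarrow>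
    (\<forall>r s :: nat. r \<ge> 1 \<longrightarrow> s \<ge> 1 \<longrightarrow>
      (\<lambda>N. \<Sum>a=0..min (2 * r) (2 * s).
          (-1) ^ (a + 1) * fact (2 * r + 2 * s - a - 1) / (fact a * fact (2 * r - a) * fact (2 * s - a))
          * overlap_sq_average N \<alpha> \<beta> \<alpha>\<^sub>1 \<beta>\<^sub>1 \<alpha>\<^sub>2 \<beta>\<^sub>2 (2 * r) (2 * s) a)
        \<longlonglongrightarrow> 0)"
proof -
  have "(\<lambda>N. \<Sum>a=0..min (2 * r) (2 * s).
          (-1) ^ (a + 1) * fact (2 * r + 2 * s - a - 1) / (fact a * fact (2 * r - a) * fact (2 * s - a))
          * overlap_sq_average N \<alpha> \<beta> \<alpha>\<^sub>1 \<beta>\<^sub>1 \<alpha>\<^sub>2 \<beta>\<^sub>2 (2 * r) (2 * s) a) \<longlonglongrightarrow> 0"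
    if rs: "r \<ge> 1" "s \<ge> 1" for \<alpha>\<^sub>1 \<alpha>\<^sub>2 :: real and r s :: nat
  proof (rule Lim_transform_eventually)
    show "(\<lambda>N. bonds_average N \<alpha> \<alpha>\<^sub>1 \<alpha>\<^sub>2 (\<lambda>z z\<^sub>1 z\<^sub>2.
        replica_poly_average N (2 * r) (2 * s) (gibbs_weight \<beta> \<beta>\<^sub>1 \<beta>\<^sub>2 z z\<^sub>1 z\<^sub>2))) \<longlonglongrightarrow> 0"
    proof (cases "\<alpha> = 0 \<or> \<beta> = 0")
      case True
      then show ?thesis using rs by (intro replica_poly_average_tendsto_0_trivial) auto
    next
      case False
      then show ?thesis using rs assms by (intro replica_poly_average_tendsto_0) auto
    qed
    show "\<forall>\<^sub>F N in sequentially. bonds_average N \<alpha> \<alpha>\<^sub>1 \<alpha>\<^sub>2 (\<lambda>z z\<^sub>1 z\<^sub>2.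
        replica_poly_average N (2 * r) (2 * s) (gibbs_weight \<beta> \<beta>\<^sub>1 \<beta>\<^sub>2 z z\<^sub>1 z\<^sub>2))
      = (\<Sum>a=0..min (2 * r) (2 * s).
          (-1) ^ (a + 1) * fact (2 * r + 2 * s - a - 1) / (fact a * fact (2 * r - a) * fact (2 * s - a))
          * overlap_sq_average N \<alpha> \<beta> \<alpha>\<^sub>1 \<beta>\<^sub>1 \<alpha>\<^sub>2 \<beta>\<^sub>2 (2 * r) (2 * s) a)"
      \<comment> \<open>The reduction to bond lists requires at least one site, hence an equality
        for N \<ge> 1 only.\<close>
      by (rule eventually_sequentiallyI[of 1], rule sum_overlap_sq_average_eq_bonds_average[symmetric]) simp
  qed
  then show ?thesis by (intro AE_I2) (auto simp: case_prod_beta)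
qed

end
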